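(* Let $1<p<\infty$, $T>0$, and let $\Theta\subset\mathbb{R}^l$ be a nonempty compact set. Let $F_0,F_1,\dots,F_k:\mathbb{R}^d\times\Theta\to\mathbb{R}^d$ be such that, for some $L>0$, $$\sup_{i=0,\dots,k}|F_i(x_1,\theta_1)-F_i(x_2,\theta_2)|_2\le L\big(|x_1-x_2|_2+|x_1+x_2|_2\,|\theta_1-\theta_2|_2\big)$$ for all $(x_1,\theta_1),(x_2,\theta_2)\in\mathbb{R}^d\times\Theta$; let $x_0:\Theta\to\mathbb{R}^d$ be continuous; let $a:\mathbb{R}^d\times\Theta\to[0,+\infty)$ be continuous; and let $f:[0,T]\times\mathbb{R}^k\to\mathbb{R}$ satisfy: (i) $f(\cdot,u)$ is measurable for every $u\in\mathbb{R}^k$; (ii) $f(t,\cdot)$ is continuous and convex for a.e. $t\in[0,T]$; (iii) there exist $c\in L^1([0,T],[0,+\infty))$ and $C>0$ such that $f(t,u)\ge C|u|_2^p-c(t)$ for a.e. $t\in[0,T]$ and every $u\in\mathbb{R}^k$; (iv) there exist $u'\in\mathbb{R}^k$ and $c'\in L^1([0,T],[0,+\infty))$ such that $|f(t,u')|\le c'(t)$ for a.e. $t\in[0,T]$. Let $\mathcal{U}:=L^p([0,T],\mathbb{R}^k)$ and let $\mathcal{J}:\mathcal{U}\to\mathbb{R}\cup\{+\infty\}$ be $$\mathcal{J}(u):=\max_{\theta\in\Theta}a(X_u(T,\theta),\theta)+\int_0^Tf(t,u(t))\,dt.$$ Then $\mathcal{J}$ attains its minimum: there exists $\hat u\in\mathcal{U}$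 such that $\mathcal{J}(\hat u)=\inf_{u\in\mathcal{U}}\mathcal{J}(u)$.
   Context: Write $F=(F_1,\dots,F_k):\mathbb{R}^d\times\Theta\to\mathbb{R}^{d\times k}$. For $u\in\mathcal{U}=L^p([0,T],\mathbb{R}^k)$ and $\theta\in\Theta$, $x_u^\theta:[0,T]\to\mathbb{R}^d$ denotes the (Carathéodory, absolutely continuous) solution of $\dot x(t)=F_0(x(t),\theta)+F(x(t),\theta)u(t)$ for a.e. $t\in[0,T]$, $x(0)=x_0(\theta)$, and $X_u(t,\theta):=x_u^\theta(t)$ for $(t,\theta)\in[0,T]\times\Theta$. $|\cdot|_2$ is the Euclidean norm. *)

theory Defs
  imports "HOL-Analysis.Analysis"
begin

text \<open>Functions on \<^term>\<open>{0..T}\<close> are represented by total functions on the reals whose values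
  outside the interval are irrelevant; elements of an \<open>L\<^sup>p\<close> space are represented by
  functions rather than by classes modulo a.e. equality.\<close>

definition Lp_space :: "real \<Rightarrow> real \<Rightarrow> (real \<Rightarrow> real ^ 'k) set" where
  "Lp_space p T = {u. u \<in> borel_measurable (lebesgue_on {0..T}) \<and>
                      integrable (lebesgue_on {0..T}) (\<lambda>t. norm (u t) powr p)}"

definition abs_continuous_on :: "real \<Rightarrow> real \<Rightarrow> (real \<Rightarrow> 'a::real_normed_vector) \<Rightarrow> bool" where
  "abs_continuous_on a b x \<longleftrightarrow>
     (\<forall>\<epsilon>>0. \<exists>\<delta>>0. \<forall>D. finite D \<and> (\<forall>(r, s)\<in>D. a \<le> r \<and> r \<le> s \<and> s \<le> b) \<and>
          disjoint_family_on (\<lambda>(r, s). {r<..<s}) D \<and> (\<Sum>(r, s)\<in>D. s - r) < \<delta>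
        \<longrightarrow> (\<Sum>(r, s)\<in>D. norm (x s - x r)) < \<epsilon>)"

text \<open>The fields \<open>F\<^sub>1, \<dots>, F\<^sub>k\<close> are the columns of the matrix-valued map \<open>F\<close>.\<close>

definition caratheodory_solution ::
  "(real ^ 'd \<Rightarrow> real ^ 'l \<Rightarrow> real ^ 'd) \<Rightarrow> (real ^ 'd \<Rightarrow> real ^ 'l \<Rightarrow> real ^ 'k ^ 'd) \<Rightarrow>
   (real ^ 'l \<Rightarrow> real ^ 'd) \<Rightarrow> real \<Rightarrow> (real \<Rightarrow> real ^ 'k) \<Rightarrow> real ^ 'l \<Rightarrow> (real \<Rightarrow> real ^ 'd) \<Rightarrow> bool" where
  "caratheodory_solution F0 F x0 T u \<theta> x \<longleftrightarrow>
     abs_continuous_on 0 T x \<and> x 0 = x0 \<theta> \<and>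
     (AE t in lebesgue_on {0..T}.
        (x has_vector_derivative (F0 (x t) \<theta> + F (x t) \<theta> *v u t)) (at t within {0..T}))"

text \<open>The value \<open>X\<^sub>u(t,\<theta>)\<close>. The description is applied to the value at time \<open>t\<close>,
  not to the trajectory, because a trajectory as a total function on the reals is determined only
  on \<^term>\<open>{0..T}\<close>.\<close>

definition state ::
  "(real ^ 'd \<Rightarrow> real ^ 'l \<Rightarrow> real ^ 'd) \<Rightarrow> (real ^ 'd \<Rightarrow> real ^ 'l \<Rightarrow> real ^ 'k ^ 'd) \<Rightarrow>
   (real ^ 'l \<Rightarrow> real ^ 'd) \<Rightarrow> real \<Rightarrow> (real \<Rightarrow> real ^ 'k) \<Rightarrow> real \<Rightarrow> real ^ 'l \<Rightarrow> real ^ 'd" where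
  "state F0 F x0 T u t \<theta> = (THE y. \<exists>x. caratheodory_solution F0 F x0 T u \<theta> x \<and> x t = y)"

text \<open>Lebesgue integral of a real function whose negative part is integrable, with value
  \<open>\<infinity>\<close> allowed (the Bochner integral would return 0 in that case).\<close>

definition ext_integral :: "'a measure \<Rightarrow> ('a \<Rightarrow> real) \<Rightarrow> ereal" where
  "ext_integral M g =
     enn2ereal (\<integral>\<^sup>+ t. ennreal (g t) \<partial>M) - enn2ereal (\<integral>\<^sup>+ t. ennreal (- g t) \<partial>M)"

definition cost ::
  "(real ^ 'd \<Rightarrow> real ^ 'l \<Rightarrow> real ^ 'd) \<Rightarrow> (real ^ 'd \<Rightarrow> real ^ 'l \<Rightarrow> real ^ 'k ^ 'd) \<Rightarrow>
   (real ^ 'l \<Rightarrow> real ^ 'd) \<Rightarrow> real \<Rightarrow> (real ^ 'l) set \<Rightarrow> (real ^ 'd \<Rightarrow> real ^ 'l \<Rightarrow> real) \<Rightarrow>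
   (real \<Rightarrow> real ^ 'k \<Rightarrow> real) \<Rightarrow> (real \<Rightarrow> real ^ 'k) \<Rightarrow> ereal" where
  "cost F0 F x0 T \<Theta> a f u =
     ereal (GREATEST m. m \<in> (\<lambda>\<theta>. a (state F0 F x0 T u T \<theta>) \<theta>) ` \<Theta>) +
     ext_integral (lebesgue_on {0..T}) (\<lambda>t. f t (u t))"

end

theory Submission
  imports Defs "HOL-Complex_Analysis.Great_Picard"
begin

text \<open>By coercivity a minimising sequence is bounded in \<open>L\<^sup>p\<close>, so its primitives are equicontinuous
  (as \<open>p > 1\<close>) and a subsequence of them converges uniformly. This is weak convergence of the
  controls \<open>u\<^sub>n\<close>. Instead of invoking weak compactness of \<open>L\<^sup>p\<close>, the limit \<open>u\<close> is found as the strong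
  \<open>L\<^sup>1\<close> limit of almost minimisers of the strictly convex functional \<open>\<integral> sqrt (1 + |v|\<^sup>2)\<close> over shrinking
  convex sets of controls; convexity of \<open>f\<close> and Fatou's lemma then bound the integral cost of \<open>u\<close>.
  Since the system is affine in the control, weak convergence gives \<open>X\<^sub>u\<^sub>n(T,\<theta>) \<longrightarrow> X\<^sub>u(T,\<theta>)\<close> for each
  fixed \<open>\<theta>\<close> by Gronwall's inequality. Pointwise convergence suffices: applied to a maximiser \<open>\<theta>\<close> for
  the limit \<open>u\<close> it yields lower semicontinuity of the terminal cost.\<close>

section \<open>Absolutely continuous functions and indefinite integrals\<close>

text \<open>\<open>state\<close> is a definite description and the terminal cost a
  \<open>GREATEST\<close>, so neither has a meaning before solutions are known to exist and to be
  unique, and the maximum over \<open>\<Theta>\<close> to be attained; the latter rests on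
  continuity of the final state in \<open>\<theta>\<close>. As solutions are absolutely continuous
  with a derivative almost everywhere, both halves of Lebesgue's fundamental theorem of calculus are
  derived, from the gauge integral. Integral costs may be infinite or negative. Adding the lower
  bound \<open>c\<close> makes the integrand nonnegative, so that it can be treated in
  \<open>ennreal\<close>. Weak convergence gives no convergence almost everywhere, which continuity
  of \<open>f t\<close> and Fatou's lemma would require. Hence the convex sets: the n-th consists of
  all controls whose primitive is within 1/(n+1) of the limit primitive and whose shifted integral
  cost is at most \<open>\<beta>\<close> + 1/(n+1), where \<open>\<beta>\<close> is the limit of
  these costs along the sequence. Strongly convergent members of these sets keep both constraints in
  the limit, and \<open>\<beta>\<close> allows the integral part and the terminal part to be bounded
  separately.\<close>

lemma abs_continuous_on_subinterval:
  assumes "abs_continuous_on a b x" "a \<le> c" "d \<le> b"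
  shows "abs_continuous_on c d x"
  unfolding abs_continuous_on_def
proof (intro allI impI)
  fix e :: real assume "e > 0"
  with assms(1) obtain \<delta> where d0: "\<delta> > 0" and d: "\<And>D. finite D \<and> (\<forall>(r, s)\<in>D. a \<le> r \<and> r \<le> s \<and> s \<le> b) \<and>
          disjoint_family_on (\<lambda>(r, s). {r<..<s}) D \<and> (\<Sum>(r, s)\<in>D. s - r) < \<delta>
        \<Longrightarrow> (\<Sum>(r, s)\<in>D. norm (x s - x r)) < e"
    unfolding abs_continuous_on_def by meson
  show "\<exists>\<delta>>0. \<forall>D. finite D \<and> (\<forall>(r, s)\<in>D. c \<le> r \<and> r \<le> s \<and> s \<le> d) \<and>
          disjoint_family_on (\<lambda>(r, s). {r<..<s}) D \<and> (\<Sum>(r, s)\<in>D. s - r) < \<delta>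
        \<longrightarrow> (\<Sum>(r, s)\<in>D. norm (x s - x r)) < e"
    using d0 by (intro exI[of _ \<delta>] conjI allI impI d) (use assms in fastforce)+
qed

text \<open>Disjointness puts each point into at most one of the open intervals, so the restrictions
  of \<open>q\<close> to them add up to at most \<open>q\<close>. Passing from closed to open
  intervals changes no integral.\<close>

lemma sum_integral_disjoint_le:
  fixes q :: "real \<Rightarrow> real"
  assumes "finite D" "\<And>r s. (r, s) \<in> D \<Longrightarrow> a \<le> r \<and> r \<le> s \<and> s \<le> b"
    and disj: "disjoint_family_on (\<lambda>(r, s). {r<..<s}) D"
    and q: "q integrable_on {a..b}" "\<And>t. t \<in> {a..b} \<Longrightarrow> 0 \<le> q t"
  shows "(\<Sum>(r, s)\<in>D. integral {r..s} q) \<le> integral {a..b} q"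
proof -
  let ?g = "\<lambda>d t. if t \<in> (case d of (r, s) \<Rightarrow> {r<..<s}) then q t else 0"
  have i: "?g d integrable_on {a..b} \<and> integral {a..b} (?g d) = (case d of (r, s) \<Rightarrow> integral {r..s} q)"
    if "d \<in> D" for d
  proof -
    obtain r s where rs: "d = (r, s)" by (cases d)
    then have *: "a \<le> r" "r \<le> s" "s \<le> b" using assms(2) that by auto
    have sub: "{r<..<s} \<subseteq> {a..b}" using * by auto
    have "q integrable_on {r..s}"
      using q(1) * integrable_on_subinterval by (metis atLeastatMost_subset_iff)
    then have "q integrable_on {r<..<s}" by (simp add: integrable_on_open_interval_real)
    then have "(q has_integral integral {r<..<s} q) {r<..<s}" by blast
    then have "(?g d has_integral integral {r<..<s} q) {a..b}"
      using has_integral_restrict[OF sub, of q] by (simp add: rs)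
    then show ?thesis
      by (auto simp: rs integral_open_interval_real has_integral_iff)
  qed
  have "(\<Sum>(r, s)\<in>D. integral {r..s} q) = (\<Sum>d\<in>D. integral {a..b} (?g d))"
    by (rule sum.cong) (use i in auto)
  also have "\<dots> = integral {a..b} (\<lambda>t. \<Sum>d\<in>D. ?g d t)"
    by (rule integral_sum[symmetric]) (use assms i in auto)
  also have "\<dots> \<le> integral {a..b} q"
  proof (rule integral_le)
    show "(\<lambda>t. \<Sum>d\<in>D. ?g d t) integrable_on {a..b}"
      by (rule integrable_sum) (use assms i in auto)
    fix t assume t: "t \<in> {a..b}"
    let ?E = "{d \<in> D. t \<in> (case d of (r, s) \<Rightarrow> {r<..<s})}"
    have "\<forall>d\<in>?E. \<forall>d'\<in>?E. d = d'"
      using disj unfolding disjoint_family_on_def by blast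
    then have "card ?E \<le> 1"
      using card_le_Suc0_iff_eq[of ?E] assms(1) by auto
    then have "real (card ?E) * q t \<le> 1 * q t"
      using q(2)[OF t] by (intro mult_right_mono) auto
    moreover have "(\<Sum>d\<in>D. ?g d t) = real (card ?E) * q t"
      using assms(1) by (subst sum.inter_filter[symmetric]) auto
    ultimately show "(\<Sum>d\<in>D. ?g d t) \<le> q t" by simp
  qed (use q in auto)
  finally show ?thesis .
qed

text \<open>Truncation: \<open>q n\<close> is the part of \<open>norm (f t)\<close> above the level
  \<open>n\<close>. Dominated convergence makes its integral over the whole interval smaller than
  \<open>e / 2\<close>; what remains is bounded by \<open>n\<close> and hence controlled by the
  total length of the intervals.\<close>

lemma abs_continuous_on_integral:
  fixes f :: "real \<Rightarrow> 'a::euclidean_space"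
  assumes f: "f absolutely_integrable_on {a..b}"
  shows "abs_continuous_on a b (\<lambda>t. c + integral {a..t} f)"
  unfolding abs_continuous_on_def
proof (intro allI impI)
  fix e :: real assume e: "e > 0"
  define q where "q n t = norm (f t) - min (norm (f t)) (real n)" for n :: nat and t
  have nf: "(\<lambda>t. norm (f t)) absolutely_integrable_on {a..b}"
    using f absolutely_integrable_norm[OF f] by (simp add: o_def)
  then have nf': "(\<lambda>t. norm (f t)) integrable_on {a..b}"
    using set_lebesgue_integral_eq_integral(1) by blast
  have "(\<lambda>t. min (norm (f t)) (real n)) absolutely_integrable_on {a..b}" for n
    using absolutely_integrable_min[OF nf, of "\<lambda>_. real n"]
    by (simp add: inf_min absolutely_integrable_on_const min_def inf_real_def)
  then have qi: "q n integrable_on {a..b}" for n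
    unfolding q_def using nf' set_lebesgue_integral_eq_integral(1) by (intro integrable_diff) blast+
  have "(\<lambda>n. integral {a..b} (q n)) \<longlonglongrightarrow> integral {a..b} (\<lambda>t. 0)"
  proof (rule dominated_convergence(2)[OF qi nf'])
    show "norm (q n t) \<le> norm (f t)" for n t by (auto simp: q_def)
    fix t
    have "\<forall>\<^sub>F n in sequentially. norm (f t) \<le> real n"
      using eventually_ge_at_top[of "nat \<lceil>norm (f t)\<rceil>"] by eventually_elim linarith
    then have "\<forall>\<^sub>F n in sequentially. q n t = 0"
      by eventually_elim (simp add: q_def)
    then show "(\<lambda>n. q n t) \<longlonglongrightarrow> 0" by (simp add: tendsto_eventually)
  qed
  then have "\<forall>\<^sub>F n in sequentially. integral {a..b} (q n) < e / 2"
    using e by (intro order_tendstoD(2)[of _ 0]) auto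
  then obtain n where n: "integral {a..b} (q n) < e / 2"
    by (auto simp: eventually_sequentially)
  show "\<exists>\<delta>>0. \<forall>D. finite D \<and> (\<forall>(r, s)\<in>D. a \<le> r \<and> r \<le> s \<and> s \<le> b) \<and>
          disjoint_family_on (\<lambda>(r, s). {r<..<s}) D \<and> (\<Sum>(r, s)\<in>D. s - r) < \<delta>
        \<longrightarrow> (\<Sum>(r, s)\<in>D. norm (c + integral {a..s} f - (c + integral {a..r} f))) < e"
  \<comment> \<open>The bounded part contributes at most \<open>n\<close> times the total length,
    hence at most \<open>e / 2\<close>; the denominator has \<open>n + 1\<close> because
    \<open>n\<close> may be 0.\<close>
  proof (intro exI[of _ "e / (2 * (real n + 1))"] conjI allI impI; (elim conjE)?)
    show "0 < e / (2 * (real n + 1))" using e by simp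
    fix D assume D: "finite D" "\<forall>(r, s)\<in>D. a \<le> r \<and> r \<le> s \<and> s \<le> b"
      "disjoint_family_on (\<lambda>(r, s). {r<..<s}) D" "(\<Sum>(r, s)\<in>D. s - r) < e / (2 * (real n + 1))"
    have "(\<Sum>(r, s)\<in>D. norm (c + integral {a..s} f - (c + integral {a..r} f)))
       \<le> (\<Sum>(r, s)\<in>D. real n * (s - r) + integral {r..s} (q n))"
    proof (rule sum_mono, safe)
      fix r s assume "(r, s) \<in> D"
      then have *: "a \<le> r" "r \<le> s" "s \<le> b" using D by auto
      have fi: "f absolutely_integrable_on {r..s}"
        using absolutely_integrable_on_subinterval[OF f, of r s] * by auto
      have "f integrable_on {a..s}" using set_lebesgue_integral_eq_integral(1)[OF f] *
        integrable_on_subinterval by (metis atLeastatMost_subset_iff order_refl)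
      then have "integral {a..r} f + integral {r..s} f = integral {a..s} f"
        using * by (intro Henstock_Kurzweil_Integration.integral_combine) auto
      then have "norm (c + integral {a..s} f - (c + integral {a..r} f)) = norm (integral {r..s} f)"
        by (metis add_diff_cancel_left add_diff_cancel_left')
      also have "\<dots> \<le> integral {r..s} (\<lambda>t. real n + q n t)"
      proof (rule integral_norm_bound_integral)
        show "f integrable_on {r..s}" using fi set_lebesgue_integral_eq_integral(1) by blast
        show "(\<lambda>t. real n + q n t) integrable_on {r..s}"
          using integrable_on_subinterval[OF qi[of n], of r s] * by (intro integrable_add) auto
      qed (auto simp: q_def)
      also have "\<dots> = real n * (s - r) + integral {r..s} (q n)"
        using integrable_on_subinterval[OF qi[of n], of r s] *
        by (subst integral_add) auto
      finally show "norm (c + integral {a..s} f - (c + integral {a..r} f)) \<le> real n * (s - r) + integral {r..s} (q n)" .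
    qed
    also have "\<dots> = real n * (\<Sum>(r, s)\<in>D. s - r) + (\<Sum>(r, s)\<in>D. integral {r..s} (q n))"
      by (simp add: sum.distrib sum_distrib_left split_def)
    also have "\<dots> \<le> real n * (e / (2 * (real n + 1))) + integral {a..b} (q n)"
      using D by (intro add_mono mult_left_mono sum_integral_disjoint_le qi) (auto simp: q_def)
    also have "\<dots> < e / 2 + e / 2"
      using n e by (intro add_le_less_mono) (auto simp: field_simps)
    finally show "(\<Sum>(r, s)\<in>D. norm (c + integral {a..s} f - (c + integral {a..r} f))) < e" by simp
  qed
qed

text \<open>Off \<open>N\<close> the derivative makes the Riemann terms of small intervals agree
  with the increments of \<open>x\<close> up to a small multiple of their length. Intervals tagged
  in \<open>N\<close> are forced by the gauge into an open set whose measure is below the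
  \<open>\<delta>\<close> of absolute continuity, so their increments sum to less than
  \<open>e / 2\<close>; setting the integrand to 0 on \<open>N\<close> removes their Riemann
  terms.\<close>

theorem abs_continuous_on_has_integral:
  fixes x :: "real \<Rightarrow> 'a::euclidean_space"
  assumes ab: "a \<le> b" and ac: "abs_continuous_on a b x" and N: "negligible N"
    and der: "\<And>t. t \<in> {a..b} - N \<Longrightarrow> (x has_vector_derivative g t) (at t within {a..b})"
  shows "(g has_integral (x b - x a)) {a..b}"
proof -
  define g' where "g' t = (if t \<in> N then 0 else g t)" for t
  have "(g' has_integral (x b - x a)) {a..b}"
    unfolding has_integral_real
  proof (intro allI impI)
    fix e :: real assume e: "e > 0"
    define e' where "e' = e / (2 * (b - a + 1))"
    have e': "e' > 0" "e' * (b - a) \<le> e / 2"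
      using e ab by (auto simp: e'_def field_simps)
    have "e / 2 > 0" using e by simp
    from ac[unfolded abs_continuous_on_def, rule_format, OF this] obtain \<delta> where d0: "\<delta> > 0" and \<delta>: "\<And>D. finite D \<Longrightarrow> (\<forall>(r, s)\<in>D. a \<le> r \<and> r \<le> s \<and> s \<le> b) \<Longrightarrow>
          disjoint_family_on (\<lambda>(r, s). {r<..<s}) D \<Longrightarrow> (\<Sum>(r, s)\<in>D. s - r) < \<delta>
        \<Longrightarrow> (\<Sum>(r, s)\<in>D. norm (x s - x r)) < e / 2"
      by meson
    obtain U where U: "open U" "N \<subseteq> U" "U \<in> lmeasurable" "measure lebesgue U < \<delta>"
    proof -
      obtain U where "open U" "N \<subseteq> U" "(U - N) \<in> lmeasurable" "emeasure lebesgue (U - N) < ennreal \<delta>"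
        using sets_lebesgue_outer_open[of N \<delta>] N d0 negligible_imp_sets by metis
      moreover have "measure lebesgue (U - N) = measure lebesgue U"
        using N \<open>N \<subseteq> U\<close> by (metis measure_Diff_null_set negligible_iff_null_sets borel_open calculation(1) sets_completionI_sets sets_lborel)
      moreover have "U \<in> lmeasurable"
        using calculation N by (metis Diff_partition fmeasurable.Un negligible_imp_measurable)
      ultimately show ?thesis using that
        by (metis d0 emeasure_eq_measure2 ennreal_less_iff measure_nonneg)
    qed
    have "\<forall>t. \<exists>d>0. t \<in> {a..b} - N \<longrightarrow>
         (\<forall>y\<in>{a..b}. norm (y-t) < d \<longrightarrow> norm (x y - x t - (y-t) *\<^sub>R g t) \<le> e' * norm (y-t))"
      using der[unfolded has_vector_derivative_def has_derivative_within_alt] e' by blast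
    then obtain d where d: "\<And>t. 0 < d t"
                 "\<And>t y. \<lbrakk>t \<in> {a..b} - N; y \<in> {a..b}; norm (y-t) < d t\<rbrakk>
                        \<Longrightarrow> norm (x y - x t - (y-t) *\<^sub>R g t) \<le> e' * norm (y-t)"
      by metis
    define \<gamma> where "\<gamma> t = (if t \<in> N then U else ball t (d t))" for t
    show "\<exists>\<gamma>. gauge \<gamma> \<and> (\<forall>\<D>. \<D> tagged_division_of {a..b} \<and> \<gamma> fine \<D> \<longrightarrow>
            norm ((\<Sum>(t, k)\<in>\<D>. measure lborel k *\<^sub>R g' t) - (x b - x a)) < e)"
    proof (intro exI conjI allI impI; (elim conjE)?)
      show "gauge \<gamma>" using U d(1) by (auto simp: gauge_def \<gamma>_def)
      fix p assume p: "p tagged_division_of {a..b}" and fine: "\<gamma> fine p"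
      have pf: "finite p" using p by blast
      have K: "\<exists>u v. K = {u..v} \<and> u \<le> v \<and> a \<le> u \<and> v \<le> b \<and> t \<in> K \<and> Inf K = u \<and> Sup K = v \<and> measure lborel K = v - u"
        if tK: "(t, K) \<in> p" for t K
      proof -
        obtain u v where "K = cbox u v" using tagged_division_ofD(4)[OF p tK] by blast
        moreover have "t \<in> K" "K \<subseteq> {a..b}" using tagged_division_ofD(2,3)[OF p tK] by auto
        ultimately show ?thesis by (intro exI[of _ u] exI[of _ v]) auto
      qed
      \<comment> \<open>\<open>?B\<close> has the tags in \<open>N\<close> with nondegenerate
        intervals, \<open>?G\<close> the tags outside \<open>N\<close>, and \<open>?Z\<close> the
        tags in \<open>N\<close> with one-point intervals, which contribute 0. These are split off
        because injectivity of the map to end points is read off from nonempty interiors.\<close>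
      let ?B = "{z \<in> p. fst z \<in> N \<and> measure lborel (snd z) > 0}"
      let ?G = "{z \<in> p. fst z \<notin> N}"
      let ?Z = "{z \<in> p. fst z \<in> N \<and> \<not> measure lborel (snd z) > 0}"
      let ?h = "\<lambda>(t, K). measure lborel K *\<^sub>R g' t - (x (Sup K) - x (Inf K))"
      have "(\<Sum>(t, k)\<in>p. measure lborel k *\<^sub>R g' t) - (x b - x a) = sum ?h p"
        using additive_tagged_division_1[OF ab p, of x] by (simp add: sum_subtractf split_def)
      also have "\<dots> = sum ?h (?B \<union> ?G \<union> ?Z)"
        by (rule sum.cong) auto
      also have "\<dots> = sum ?h (?B \<union> ?G) + sum ?h ?Z"
        by (rule sum.union_disjoint) (use pf in auto)
      also have "sum ?h (?B \<union> ?G) = sum ?h ?B + sum ?h ?G"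
        by (rule sum.union_disjoint) (use pf in auto)
      also have "sum ?h ?Z = 0"
        by (rule sum.neutral) (use K in \<open>force simp: g'_def\<close>)
      finally have eq: "(\<Sum>(t, k)\<in>p. measure lborel k *\<^sub>R g' t) - (x b - x a) = sum ?h ?B + sum ?h ?G" by simp
      have "norm (sum ?h ?G) \<le> (\<Sum>(t, K)\<in>?G. e' * (Sup K - Inf K))"
      proof (rule sum_norm_le, clarsimp)
        fix t L assume tK: "(t, L) \<in> p" "t \<notin> N"
        obtain u v where uv: "L = {u..v}" "u \<le> v" "a \<le> u" "v \<le> b" "t \<in> L" "Inf L = u" "Sup L = v" "measure lborel L = v - u"
          using K[OF tK(1)] by blast
        have "L \<subseteq> ball t (d t)" using fineD[OF fine tK(1)] tK by (simp add: \<gamma>_def)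
        moreover have "u \<in> L" "v \<in> L" using uv by auto
        ultimately have "u \<in> ball t (d t)" "v \<in> ball t (d t)" by blast+
        then have ut: "norm (u - t) < d t" and vt: "norm (v - t) < d t"
          by (auto simp: dist_real_def)
        have tG: "t \<in> {a..b} - N" "u \<in> {a..b}" "v \<in> {a..b}" using uv tK by auto
        note d(2)[OF tG(1,2) ut] d(2)[OF tG(1,3) vt]
        \<comment> \<open>The tag lies between \<open>u\<close> and \<open>v\<close>, so the errors
          at the two end points, \<open>e' * (t - u)\<close> and \<open>e' * (v - t)\<close>, add up
          to \<open>e' * (v - u)\<close>.\<close>
        moreover have "(v - u) *\<^sub>R g t - (x v - x u) = (x u - x t - (u-t) *\<^sub>R g t) - (x v - x t - (v-t) *\<^sub>R g t)"
          by (simp add: algebra_simps)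
        ultimately have "norm ((v - u) *\<^sub>R g t - (x v - x u)) \<le> e' * norm (u-t) + e' * norm (v-t)"
          by (metis norm_triangle_le_diff add_mono)
        also have "\<dots> = e' * (v - u)" using uv by (simp add: algebra_simps)
        finally show "norm (measure lborel L *\<^sub>R g' t - (x (Sup L) - x (Inf L))) \<le> e' * (Sup L - Inf L)"
          using uv tK by (simp add: g'_def)
      qed
      also have "\<dots> \<le> (\<Sum>(t, K)\<in>p. e' * (Sup K - Inf K))"
        by (rule sum_mono2[OF pf]) (use K e' in fastforce)+
      also have "\<dots> = e' * (\<Sum>(t, K)\<in>p. Sup K - Inf K)"
        by (simp add: sum_distrib_left split_def)
      also have "\<dots> = e' * (b - a)"
        using additive_tagged_division_1[OF ab p, of "\<lambda>x. x"] by simp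
      also note e'(2)
      finally have G: "norm (sum ?h ?G) \<le> e / 2" .
      let ?c = "\<lambda>(t, K). (Inf K, Sup K)"
      have disj: "{Inf K<..<Sup K} \<inter> {Inf K'<..<Sup K'} = {}"
        if "(t, K) \<in> p" "(t', K') \<in> p" "(t, K) \<noteq> (t', K')" for t K t' K'
      proof -
        have "K = {Inf K..Sup K}" "K' = {Inf K'..Sup K'}"
          using K[OF that(1)] K[OF that(2)] by auto
        then have "interior {Inf K..Sup K} \<inter> interior {Inf K'..Sup K'} = {}"
          using tagged_division_ofD(5)[OF p that] by simp
        then show ?thesis by simp
      qed
      have inj: "inj_on ?c ?B"
      proof (rule inj_onI, clarsimp)
        fix t K1 t' K' assume *: "(t, K1) \<in> p" "(t', K') \<in> p" "Inf K1 = Inf K'" "Sup K1 = Sup K'" "0 < measure lborel K1"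
        then have "{Inf K1<..<Sup K1} \<noteq> {}" using K[OF *(1)] by auto
        then show "t = t' \<and> K1 = K'" using disj[OF *(1,2)] * by auto
      qed
      have "(\<Sum>(r, s)\<in>?c ` ?B. norm (x s - x r)) < e / 2"
      proof (rule \<delta>)
        show "finite (?c ` ?B)" using pf by auto
        show "\<forall>(r, s)\<in>?c ` ?B. a \<le> r \<and> r \<le> s \<and> s \<le> b"
          using K by fastforce
        show dis: "disjoint_family_on (\<lambda>(r, s). {r<..<s}) (?c ` ?B)"
          unfolding disjoint_family_on_def using disj by fastforce
        have "(\<Sum>(r, s)\<in>?c ` ?B. s - r) = (\<Sum>z\<in>?c ` ?B. measure lebesgue ((\<lambda>(r, s). {r<..<s}) z))"
          using K by (intro sum.cong) fastforce+
        also have "\<dots> = measure lebesgue (\<Union>z\<in>?c ` ?B. (\<lambda>(r, s). {r<..<s}) z)"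
        proof (rule measure_finite_Union[symmetric])
          have "emeasure lborel {u<..<v::real} \<noteq> top" for u v
            using emeasure_lborel_box_finite[of u v] by simp
          then show "emeasure lebesgue ((\<lambda>(r, s). {r<..<s}) z) \<noteq> \<infinity>" for z :: "real \<times> real"
            by (simp add: split_def)
        qed (use pf dis in \<open>auto simp: split_def\<close>)
        also have "\<dots> \<le> measure lebesgue U"
        proof (rule measure_mono_fmeasurable)
          have "{Inf L<..<Sup L} \<subseteq> U" if "(t, L) \<in> p" "t \<in> N" for t L
          proof -
            have "L \<subseteq> U" using fineD[OF fine that(1)] that by (simp add: \<gamma>_def)
            then show ?thesis using K[OF that(1)] by force
          qed
          then show "(\<Union>z\<in>?c ` ?B. (\<lambda>(r, s). {r<..<s}) z) \<subseteq> U" by fastforce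
        qed (use U pf in \<open>auto simp: split_def\<close>)
        finally show "(\<Sum>(r, s)\<in>?c ` ?B. s - r) < \<delta>" using U by simp
      qed
      then have "(\<Sum>(t, K)\<in>?B. norm (x (Sup K) - x (Inf K))) < e / 2"
        by (subst (asm) sum.reindex[OF inj]) (simp add: split_def o_def)
      moreover have "norm (sum ?h ?B) \<le> (\<Sum>(t, K)\<in>?B. norm (x (Sup K) - x (Inf K)))"
        by (rule sum_norm_le) (auto simp: g'_def norm_minus_commute)
      ultimately have "norm (sum ?h ?B) < e / 2" by simp
      with G show "norm ((\<Sum>(t, k)\<in>p. measure lborel k *\<^sub>R g' t) - (x b - x a)) < e"
        unfolding eq by (smt (verit) norm_triangle_ineq field_sum_of_halves)
    qed
  qed
  then show ?thesis
    by (rule has_integral_spike[OF N, rotated]) (auto simp: g'_def)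
qed

text \<open>By Henstock's lemma, pairwise disjoint intervals on which the difference quotient deviates from
  \<open>f t\<close> by more than \<open>e\<close> have small total length; Vitali's theorem selects such
  intervals covering almost all exceptional points.\<close>

theorem integral_has_vector_derivative_ae:
  fixes f :: "real \<Rightarrow> 'a::euclidean_space"
  assumes f: "f integrable_on {a..b}"
  obtains N where "negligible N"
    "\<And>t. t \<in> {a..b} - N \<Longrightarrow> ((\<lambda>t. integral {a..t} f) has_vector_derivative f t) (at t within {a..b})"
proof -
  define \<Phi> where "\<Phi> t = integral {a..t} f" for t
  define bad where "bad e t s \<longleftrightarrow> s \<in> {a..b} \<and> s \<noteq> t \<and> norm (\<Phi> s - \<Phi> t - (s - t) *\<^sub>R f t) > e * \<bar>s - t\<bar>" for e t s
  define E where "E e = {t \<in> {a..b}. \<forall>d>0. \<exists>s. \<bar>s - t\<bar> < d \<and> bad e t s}" for e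
  have dev: "norm (measure lborel {min t s..max t s} *\<^sub>R f t - integral {min t s..max t s} f)
       = norm (\<Phi> s - \<Phi> t - (s - t) *\<^sub>R f t)" if "t \<in> {a..b}" "s \<in> {a..b}" for t s
  proof -
    have *: "integral {u..v} f = \<Phi> v - \<Phi> u" if "u \<in> {a..b}" "v \<in> {a..b}" "u \<le> v" for u v
    proof -
      have "f integrable_on {a..v}" using f that integrable_on_subinterval
        by (metis atLeastAtMost_iff atLeastatMost_subset_iff order_refl)
      then have "integral {a..u} f + integral {u..v} f = integral {a..v} f"
        using that by (intro Henstock_Kurzweil_Integration.integral_combine) auto
      then show ?thesis by (simp add: \<Phi>_def algebra_simps)
    qed
    show ?thesis
    proof (cases "t \<le> s")
      case True
      then show ?thesis using *[of t s] that by (simp add: norm_minus_commute)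
    next
      case False
      then have "measure lborel {min t s..max t s} *\<^sub>R f t - integral {min t s..max t s} f
         = \<Phi> s - \<Phi> t - (s - t) *\<^sub>R f t"
        using *[of s t] that by (simp add: algebra_simps)
      then show ?thesis by simp
    qed
  qed
  \<comment> \<open>Vitali's theorem is applied to balls, so the interval between \<open>t\<close>
    and \<open>s\<close> is written as the ball about its midpoint.\<close>
  have cb: "cball ((t + s) / 2) (\<bar>s - t\<bar> / 2) = {min t s..max t s}" for t s :: real
    by (auto simp: dist_real_def abs_if min_def max_def field_simps split: if_splits)
  have "negligible (E e)" if e: "e > 0" for e
    unfolding negligible_outer_le
  proof (intro allI impI)
    fix \<eta> :: real assume \<eta>: "\<eta> > 0"
    obtain \<gamma> where \<gamma>: "gauge \<gamma>" "\<And>p. \<lbrakk>p tagged_partial_division_of (cbox a b); \<gamma> fine p\<rbrakk> \<Longrightarrow>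
             sum (\<lambda>(x,k). norm(measure lborel k *\<^sub>R f x - integral k f)) p < e * \<eta>"
      using Henstock_lemma[of f a b "e * \<eta>"] f e \<eta> by (auto simp: cbox_interval)
    define K where "K = {(t, s). t \<in> {a..b} \<and> bad e t s \<and> {min t s..max t s} \<subseteq> \<gamma> t}"
    let ?I = "\<lambda>(t, s). {min t s..max t s :: real}"
    let ?c = "\<lambda>(t, s). (t + s) / 2 :: real"
    let ?r = "\<lambda>(t, s). \<bar>s - t\<bar> / 2 :: real"
    have cI: "cball (?c z) (?r z) = ?I z" for z
      by (cases z) (simp add: cb)
    obtain C where C: "countable C" "C \<subseteq> K" "pairwise (\<lambda>i j. disjnt (cball (?c i) (?r i)) (cball (?c j) (?r j))) C"
     "negligible(E e - (\<Union>i \<in> C. cball (?c i) (?r i)))"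
    proof (rule Vitali_covering_theorem_cballs[of K ?r "E e" ?c])
      show "0 < ?r i" if "i \<in> K" for i using that by (auto simp: K_def bad_def)
      fix t d :: real assume t: "t \<in> E e" and d: "0 < d"
      have "open (\<gamma> t)" "t \<in> \<gamma> t" using \<gamma>(1) by (auto simp: gauge_def)
      then obtain d' where d': "d' > 0" "ball t d' \<subseteq> \<gamma> t" by (meson openE)
      have "0 < min d d'" using d d' by simp
      then obtain s where s: "\<bar>s - t\<bar> < min d d'" "bad e t s"
        using t unfolding E_def by blast
      have "{min t s..max t s} \<subseteq> ball t d'" using s by (auto simp: dist_real_def min_def max_def split: if_splits)
      then show "\<exists>i. i \<in> K \<and> t \<in> cball (?c i) (?r i) \<and> ?r i < d"
        using s d' t d unfolding cI by (intro exI[of _ "(t, s)"]) (auto simp: K_def E_def)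
    qed auto
    have disj: "pairwise (\<lambda>i j. disjnt (?I i) (?I j)) C" using C(3) unfolding cI .
    have fin: "measure lebesgue (\<Union>(?I ` P)) \<le> \<eta>" if P: "finite P" "P \<subseteq> C" for P
    proof -
      let ?p = "\<lambda>(t, s). (t, ?I (t, s))"
      have PK: "P \<subseteq> K" using P C by auto
      have inj: "inj_on ?p P"
      proof (rule inj_onI, clarsimp)
        fix t s s' assume *: "(t, s) \<in> P" "(t, s') \<in> P"
        show "s = s'"
        proof (rule ccontr)
          assume "s \<noteq> s'"
          then have "disjnt (?I (t, s)) (?I (t, s'))" using disj * P unfolding pairwise_def by blast
          then show False by (auto simp: disjnt_def)
        qed
      qed
      have "(\<Sum>(x,k)\<in>?p ` P. norm(measure lborel k *\<^sub>R f x - integral k f)) < e * \<eta>"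
      proof (rule \<gamma>(2))
        show "\<gamma> fine ?p ` P" using PK by (auto simp: fine_def K_def)
        show "?p ` P tagged_partial_division_of cbox a b"
          unfolding tagged_partial_division_of_def
        proof (intro conjI allI impI)
          show "finite (?p ` P)" using P by auto
          fix x k assume xk: "(x, k) \<in> ?p ` P"
          show "x \<in> k" using xk by auto
          obtain y where "(x, y) \<in> P" "k = {min x y..max x y}" using xk by auto
          moreover from this have "x \<in> {a..b}" "y \<in> {a..b}" using PK by (auto simp: K_def bad_def)
          ultimately show "k \<subseteq> cbox a b" by (auto simp: cbox_interval min_def max_def split: if_splits)
          show "\<exists>a b. k = cbox a b" using xk by (auto simp: cbox_interval)
        next
          fix x1 K1 x2 K2 assume *: "(x1, K1) \<in> ?p ` P \<and> (x2, K2) \<in> ?p ` P \<and> (x1, K1) \<noteq> (x2, K2)"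
          then obtain i j where ij: "i \<in> P" "j \<in> P" "K1 = ?I i" "K2 = ?I j" "i \<noteq> j" by fastforce
          then have "disjnt (?I i) (?I j)" using disj P unfolding pairwise_def by blast
          then have "K1 \<inter> K2 = {}" using ij by (simp add: disjnt_def)
          then show "interior K1 \<inter> interior K2 = {}"
            using interior_subset[of K1] interior_subset[of K2] by blast
        qed
      qed
      also have "(\<Sum>(x,k)\<in>?p ` P. norm(measure lborel k *\<^sub>R f x - integral k f))
        = (\<Sum>(t, s)\<in>P. norm (\<Phi> s - \<Phi> t - (s - t) *\<^sub>R f t))"
        by (subst sum.reindex[OF inj]) (use PK in \<open>auto intro!: sum.cong dev simp: K_def bad_def\<close>)
      finally have "(\<Sum>(t, s)\<in>P. norm (\<Phi> s - \<Phi> t - (s - t) *\<^sub>R f t)) < e * \<eta>" .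
      moreover have "(\<Sum>(t, s)\<in>P. e * \<bar>s - t\<bar>) \<le> (\<Sum>(t, s)\<in>P. norm (\<Phi> s - \<Phi> t - (s - t) *\<^sub>R f t))"
        by (rule sum_mono) (use PK in \<open>auto simp: K_def bad_def\<close>)
      ultimately have "e * (\<Sum>(t, s)\<in>P. \<bar>s - t\<bar>) \<le> e * \<eta>"
        by (simp add: sum_distrib_left split_def)
      then have "(\<Sum>(t, s)\<in>P. \<bar>s - t\<bar>) \<le> \<eta>" using e by simp
      moreover have "measure lebesgue (\<Union>(?I ` P)) \<le> (\<Sum>i\<in>P. measure lebesgue (?I i))"
        by (rule measure_UNION_le) (use P in auto)
      moreover have "(\<Sum>i\<in>P. measure lebesgue (?I i)) = (\<Sum>(t, s)\<in>P. \<bar>s - t\<bar>)"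
        by (rule sum.cong) (auto simp: min_def max_def)
      ultimately show ?thesis by simp
    qed
    have meas: "?I i \<in> lmeasurable" for i by (simp add: split_def)
    have bd: "measure lebesgue (\<Union>i\<in>P. ?I i) \<le> \<eta>" if "P \<subseteq> C" "finite P" for P
      using fin[OF that(2,1)] .
    let ?V = "\<Union>i\<in>C. ?I i" and ?W = "E e - (\<Union>i\<in>C. ?I i)"
    have V: "?V \<in> lmeasurable" by (rule fmeasurable_UN_bound[OF C(1) meas bd])
    have V_le: "measure lebesgue ?V \<le> \<eta>" by (rule measure_UN_bound[OF C(1) meas bd])
    have W: "negligible ?W" using C(4) unfolding cI .
    show "\<exists>T. E e \<subseteq> T \<and> T \<in> lmeasurable \<and> measure lebesgue T \<le> \<eta>"
    proof (intro exI[of _ "?V \<union> ?W"] conjI)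
      show "E e \<subseteq> ?V \<union> ?W" by blast
      show "?V \<union> ?W \<in> lmeasurable" by (rule fmeasurable.Un[OF V negligible_imp_measurable[OF W]])
      have "measure lebesgue (?V \<union> ?W) \<le> measure lebesgue ?V + measure lebesgue ?W"
        by (rule measure_Un_le[OF fmeasurableD[OF V] negligible_imp_sets[OF W]])
      then show "measure lebesgue (?V \<union> ?W) \<le> \<eta>"
        using V_le negligible_imp_measure0[OF W] by linarith
    qed
  qed
  then have "negligible (\<Union>n. E (inverse (real (Suc n))))"
    by (intro negligible_countable_Union) auto
  moreover have "(\<Phi> has_vector_derivative f t) (at t within {a..b})"
    if t: "t \<in> {a..b} - (\<Union>n. E (inverse (real (Suc n))))" for t
    unfolding has_vector_derivative_def has_derivative_within_alt
  proof (intro conjI allI impI bounded_linear_scaleR_left)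
    fix e :: real assume "0 < e"
    then obtain n where n: "inverse (real (Suc n)) < e" using reals_Archimedean by blast
    have "t \<notin> E (inverse (real (Suc n)))" "t \<in> {a..b}" using t by blast+
    then obtain d where d: "d > 0" "\<And>s. \<bar>s - t\<bar> < d \<Longrightarrow> \<not> bad (inverse (real (Suc n))) t s"
      unfolding E_def by blast
    show "\<exists>d>0. \<forall>y\<in>{a..b}. norm (y - t) < d \<longrightarrow> norm (\<Phi> y - \<Phi> t - (y - t) *\<^sub>R f t) \<le> e * norm (y - t)"
    proof (intro exI[of _ d] conjI ballI impI d(1))
      fix y assume y: "y \<in> {a..b}" "norm (y - t) < d"
      show "norm (\<Phi> y - \<Phi> t - (y - t) *\<^sub>R f t) \<le> e * norm (y - t)"
      proof (cases "y = t")
        case False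
        then have "norm (\<Phi> y - \<Phi> t - (y - t) *\<^sub>R f t) \<le> inverse (real (Suc n)) * \<bar>y - t\<bar>"
          using d(2)[of y] y unfolding bad_def by (simp add: not_less)
        also have "\<dots> \<le> e * \<bar>y - t\<bar>" using n by (intro mult_right_mono) auto
        finally show ?thesis by simp
      qed simp
    qed
  qed
  ultimately show thesis
    using that unfolding \<Phi>_def by blast
qed

lemma abs_continuous_on_transform:
  assumes ac: "abs_continuous_on a b x" and eq: "\<And>t. t \<in> {a..b} \<Longrightarrow> y t = x t"
  shows "abs_continuous_on a b y"
  unfolding abs_continuous_on_def
proof (intro allI impI)
  fix e :: real assume "e > 0"
  from ac[unfolded abs_continuous_on_def, rule_format, OF this] obtain \<delta> where d0: "\<delta> > 0"
    and d: "\<And>D. finite D \<and> (\<forall>(r, s)\<in>D. a \<le> r \<and> r \<le> s \<and> s \<le> b) \<and>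
          disjoint_family_on (\<lambda>(r, s). {r<..<s}) D \<and> (\<Sum>(r, s)\<in>D. s - r) < \<delta>
        \<Longrightarrow> (\<Sum>(r, s)\<in>D. norm (x s - x r)) < e"
    by meson
  show "\<exists>\<delta>>0. \<forall>D. finite D \<and> (\<forall>(r, s)\<in>D. a \<le> r \<and> r \<le> s \<and> s \<le> b) \<and>
          disjoint_family_on (\<lambda>(r, s). {r<..<s}) D \<and> (\<Sum>(r, s)\<in>D. s - r) < \<delta>
        \<longrightarrow> (\<Sum>(r, s)\<in>D. norm (y s - y r)) < e"
  proof (intro exI[of _ \<delta>] conjI allI impI d0)
    fix D assume D: "finite D \<and> (\<forall>(r, s)\<in>D. a \<le> r \<and> r \<le> s \<and> s \<le> b) \<and>
          disjoint_family_on (\<lambda>(r, s). {r<..<s}) D \<and> (\<Sum>(r, s)\<in>D. s - r) < \<delta>"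
    have "(\<Sum>(r, s)\<in>D. norm (y s - y r)) = (\<Sum>(r, s)\<in>D. norm (x s - x r))"
    proof (rule sum.cong[OF refl], clarify)
      fix r s assume "(r, s) \<in> D"
      then have "r \<in> {a..b}" "s \<in> {a..b}" using D by auto
      then show "norm (y s - y r) = norm (x s - x r)" by (simp only: eq)
    qed
    then show "(\<Sum>(r, s)\<in>D. norm (y s - y r)) < e" using d[OF D] by simp
  qed
qed

lemma abs_continuous_on_imp_continuous_on:
  fixes x :: "real \<Rightarrow> 'a::real_normed_vector"
  assumes "abs_continuous_on a b x"
  shows "continuous_on {a..b} x"
  unfolding continuous_on_iff
proof (intro ballI allI impI)
  fix t e :: real assume t: "t \<in> {a..b}" and e: "e > 0"
  from assms[unfolded abs_continuous_on_def, rule_format, OF e] obtain \<delta> where d0: "\<delta> > 0"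
    and d: "\<And>D. finite D \<and> (\<forall>(r, s)\<in>D. a \<le> r \<and> r \<le> s \<and> s \<le> b) \<and>
          disjoint_family_on (\<lambda>(r, s). {r<..<s}) D \<and> (\<Sum>(r, s)\<in>D. s - r) < \<delta>
        \<Longrightarrow> (\<Sum>(r, s)\<in>D. norm (x s - x r)) < e"
    by meson
  show "\<exists>d>0. \<forall>s\<in>{a..b}. dist s t < d \<longrightarrow> dist (x s) (x t) < e"
  proof (intro exI[of _ \<delta>] conjI ballI impI d0)
    fix s assume "s \<in> {a..b}" "dist s t < \<delta>"
    then show "dist (x s) (x t) < e"
      using d[of "{(min s t, max s t)}"] t
      by (cases "s \<le> t") (auto simp: disjoint_family_on_def dist_norm min_def max_def norm_minus_commute)
  qed
qed

section \<open>Caratheodory differential equations of linear growth\<close>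

lemma AE_lebesgue_on_iff_negligible:
  fixes S :: "'a::euclidean_space set"
  assumes "S \<in> sets lebesgue"
  shows "(AE t in lebesgue_on S. P t) \<longleftrightarrow> negligible {t \<in> S. \<not> P t}"
proof -
  have "(AE t in lebesgue_on S. P t) \<longleftrightarrow> (AE t in lebesgue. t \<in> S \<longrightarrow> P t)"
    using assms by (intro AE_restrict_space_iff) auto
  also have "\<dots> \<longleftrightarrow> {t \<in> S. \<not> P t} \<in> null_sets lebesgue"
    by (subst completion.AE_iff_null_sets) (simp add: Collect_conj_eq)
  finally show ?thesis by (simp add: negligible_iff_null_sets)
qed

text \<open>Completeness of Lebesgue measure: whatever \<open>g\<close> does on \<open>N\<close>,
  its preimages change only by a subset of a null set, which is measurable.\<close>

lemma borel_measurable_lebesgue_on_spike: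
  fixes f g :: "'a::euclidean_space \<Rightarrow> 'b::topological_space"
  assumes f: "f \<in> borel_measurable (lebesgue_on S)" and S: "S \<in> sets lebesgue"
    and N: "negligible N" "\<And>t. t \<in> S - N \<Longrightarrow> g t = f t"
  shows "g \<in> borel_measurable (lebesgue_on S)"
proof (rule measurableI)
  fix A :: "'b set" assume A: "A \<in> sets borel"
  have "f -` A \<inter> S \<in> sets (lebesgue_on S)" using measurable_sets[OF f A] by simp
  then have *: "f -` A \<inter> S \<in> sets lebesgue" using S by (simp add: sets_restrict_space_iff)
  have "negligible (g -` A \<inter> S \<inter> N)" using N(1) by (rule negligible_subset) auto
  moreover have "N \<in> sets lebesgue" using N(1) negligible_imp_sets by blast
  ultimately have "(f -` A \<inter> S - N) \<union> (g -` A \<inter> S \<inter> N) \<in> sets lebesgue"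
    using * negligible_imp_sets by blast
  moreover have "(f -` A \<inter> S - N) \<union> (g -` A \<inter> S \<inter> N) = g -` A \<inter> S" using N(2) by auto
  ultimately show "g -` A \<inter> space (lebesgue_on S) \<in> sets (lebesgue_on S)"
    using S by (simp add: sets_restrict_space_iff)
qed simp

text \<open>Along a simple function \<open>G\<close> is evaluated at finitely many constants, where
  measurability is given. Simple functions converge pointwise to \<open>u\<close>, and continuity in
  the second argument carries measurability to the limit; on the null set where continuity fails the
  values are replaced by 0.\<close>

lemma caratheodory_measurable:
  fixes G :: "'c::euclidean_space \<Rightarrow> 'a::euclidean_space \<Rightarrow> 'b::euclidean_space"
  assumes S: "S \<in> sets lebesgue" and meas: "\<And>v. (\<lambda>t. G t v) \<in> borel_measurable (lebesgue_on S)"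
    and cont: "AE t in lebesgue_on S. continuous_on UNIV (G t)"
    and u: "u \<in> borel_measurable (lebesgue_on S)"
  shows "(\<lambda>t. G t (u t)) \<in> borel_measurable (lebesgue_on S)"
proof -
  define N where "N = {t \<in> S. \<not> continuous_on UNIV (G t)}"
  have N: "negligible N" using cont S by (simp add: N_def AE_lebesgue_on_iff_negligible)
  obtain s where s: "\<And>i. simple_function (lebesgue_on S) (s i)"
    "\<And>t. t \<in> S \<Longrightarrow> (\<lambda>i. s i t) \<longlonglongrightarrow> u t"
    using borel_measurable_implies_sequence_metric[OF u, of 0] by (auto simp: space_lebesgue_on)
  have m: "(\<lambda>t. G t (s i t)) \<in> borel_measurable (lebesgue_on S)" for i
  proof (rule measurable_compose_countable'[where I = "s i ` S"])
    show "s i \<in> lebesgue_on S \<rightarrow>\<^sub>M count_space (s i ` S)"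
      using measurable_simple_function[OF s(1)[of i]] 
      by (simp add: measurable_count_space_eq2_countable simple_functionD[OF s(1)] measurable_def)
    show "countable (s i ` S)"
      using simple_functionD(1)[OF s(1)[of i]] by (simp add: countable_finite)
  qed (rule meas)
  have "(\<lambda>t. if t \<in> N then 0 else G t (u t)) \<in> borel_measurable (lebesgue_on S)"
  proof (rule borel_measurable_LIMSEQ_metric)
    show "(\<lambda>t. if t \<in> N then 0 else G t (s i t)) \<in> borel_measurable (lebesgue_on S)" for i
      by (rule borel_measurable_lebesgue_on_spike[OF m[of i] S N]) auto
    fix t assume "t \<in> space (lebesgue_on S)"
    then have t: "t \<in> S" by simp
    show "(\<lambda>i. if t \<in> N then 0 else G t (s i t)) \<longlonglongrightarrow> (if t \<in> N then 0 else G t (u t))"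
    proof (cases "t \<in> N")
      case False
      then have "isCont (G t) (u t)" using t by (simp add: N_def continuous_on_eq_continuous_at)
      then show ?thesis using False isCont_tendsto_compose[OF _ s(2)[OF t]] by simp
    qed auto
  qed
  then show ?thesis by (rule borel_measurable_lebesgue_on_spike[OF _ S N]) auto
qed

lemma continuous_on_interval_bound:
  fixes \<phi> :: "real \<Rightarrow> 'a::real_normed_vector"
  assumes "continuous_on {a..b} \<phi>"
  obtains B where "0 \<le> B" "\<And>s. s \<in> {a..b} \<Longrightarrow> norm (\<phi> s) \<le> B"
proof -
  have "bounded (\<phi> ` {a..b})" using assms by (intro compact_imp_bounded compact_continuous_image) auto
  then obtain B where "0 < B" "\<forall>y\<in>\<phi> ` {a..b}. norm y \<le> B" by (auto simp: bounded_pos)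
  then show thesis by (intro that[of B]) auto
qed

lemma absolutely_integrable_scaleR_continuous:
  fixes h :: "real \<Rightarrow> real" and \<phi> :: "real \<Rightarrow> 'a::euclidean_space"
  assumes h: "h absolutely_integrable_on {a..b}" and \<phi>: "continuous_on {a..b} \<phi>"
  shows "(\<lambda>s. h s *\<^sub>R \<phi> s) absolutely_integrable_on {a..b}"
proof -
  obtain B where B: "\<And>s. s \<in> {a..b} \<Longrightarrow> norm (\<phi> s) \<le> B"
    using continuous_on_interval_bound[OF \<phi>] by blast
  have hm: "h \<in> borel_measurable (lebesgue_on {a..b})"
    by (rule absolutely_integrable_imp_borel_measurable[OF h]) simp
  have "\<phi> \<in> borel_measurable (lebesgue_on {a..b})"
    by (rule continuous_imp_measurable_on_sets_lebesgue[OF \<phi>]) auto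
  then have m: "(\<lambda>s. h s *\<^sub>R \<phi> s) \<in> borel_measurable (lebesgue_on {a..b})"
    by (intro borel_measurable_scaleR hm)
  have "(\<lambda>s. \<bar>h s\<bar>) absolutely_integrable_on {a..b}"
    using absolutely_integrable_norm[OF h] by (simp add: o_def)
  from set_lebesgue_integral_eq_integral(1)[OF this]
  have "(\<lambda>s. \<bar>h s\<bar> * B) integrable_on {a..b}"
    by (rule integrable_on_mult_left)
  then show ?thesis
    by (intro measurable_bounded_by_integrable_imp_absolutely_integrable[OF m])
     (auto intro!: mult_left_mono B)
qed

text \<open>The Lipschitz bound is asked only along the values of \<open>x\<close>, so that a
  locally Lipschitz function such as \<open>exp\<close> qualifies as soon as \<open>x\<close> is
  bounded.\<close>

lemma abs_continuous_on_lipschitz_compose: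
  assumes ac: "abs_continuous_on a b x"
    and lip: "\<And>r s. r \<in> {a..b} \<Longrightarrow> s \<in> {a..b} \<Longrightarrow> norm (g (x s) - g (x r)) \<le> K * norm (x s - x r)"
  shows "abs_continuous_on a b (\<lambda>t. g (x t))"
  unfolding abs_continuous_on_def
proof (intro allI impI)
  fix e :: real assume e: "e > 0"
  then have "e / (\<bar>K\<bar> + 1) > 0" by simp
  from ac[unfolded abs_continuous_on_def, rule_format, OF this] obtain \<delta> where d0: "\<delta> > 0"
    and d: "\<And>D. finite D \<and> (\<forall>(r, s)\<in>D. a \<le> r \<and> r \<le> s \<and> s \<le> b) \<and>
          disjoint_family_on (\<lambda>(r, s). {r<..<s}) D \<and> (\<Sum>(r, s)\<in>D. s - r) < \<delta>
        \<Longrightarrow> (\<Sum>(r, s)\<in>D. norm (x s - x r)) < e / (\<bar>K\<bar> + 1)"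
    by meson
  show "\<exists>\<delta>>0. \<forall>D. finite D \<and> (\<forall>(r, s)\<in>D. a \<le> r \<and> r \<le> s \<and> s \<le> b) \<and>
          disjoint_family_on (\<lambda>(r, s). {r<..<s}) D \<and> (\<Sum>(r, s)\<in>D. s - r) < \<delta>
        \<longrightarrow> (\<Sum>(r, s)\<in>D. norm (g (x s) - g (x r))) < e"
  proof (intro exI[of _ \<delta>] conjI allI impI d0)
    fix D :: "(real \<times> real) set"
    assume D: "finite D \<and> (\<forall>(r, s)\<in>D. a \<le> r \<and> r \<le> s \<and> s \<le> b) \<and>
          disjoint_family_on (\<lambda>(r, s). {r<..<s}) D \<and> (\<Sum>(r, s)\<in>D. s - r) < \<delta>"
    have "(\<Sum>(r, s)\<in>D. norm (g (x s) - g (x r))) \<le> (\<Sum>(r, s)\<in>D. (\<bar>K\<bar> + 1) * norm (x s - x r))"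
    proof (rule sum_mono, safe)
      fix r s assume "(r, s) \<in> D"
      then have "norm (g (x s) - g (x r)) \<le> K * norm (x s - x r)" using D by (intro lip) auto
      also have "\<dots> \<le> (\<bar>K\<bar> + 1) * norm (x s - x r)" by (rule mult_right_mono) auto
      finally show "norm (g (x s) - g (x r)) \<le> (\<bar>K\<bar> + 1) * norm (x s - x r)" .
    qed
    also have "\<dots> = (\<bar>K\<bar> + 1) * (\<Sum>(r, s)\<in>D. norm (x s - x r))"
      by (simp add: sum_distrib_left split_def)
    also have "\<dots> < (\<bar>K\<bar> + 1) * (e / (\<bar>K\<bar> + 1))"
      using d[OF D] by (intro mult_strict_left_mono) auto
    also have "\<dots> = e" by (simp add: field_simps)
    finally show "(\<Sum>(r, s)\<in>D. norm (g (x s) - g (x r))) < e" .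
  qed
qed

section \<open>Exponential weights and Gronwall's inequality\<close>

lemma abs_exp_diff_le:
  fixes x y :: real
  assumes "x \<le> M" "y \<le> M"
  shows "\<bar>exp x - exp y\<bar> \<le> exp M * \<bar>x - y\<bar>"
proof -
  have *: "exp v - exp w \<le> exp M * (v - w)" if "w \<le> v" "v \<le> M" for v w :: real
  proof -
    have "exp v - exp w = exp v * (1 - exp (w - v))" by (simp add: algebra_simps flip: exp_add)
    also have "\<dots> \<le> exp v * (v - w)"
      using exp_ge_add_one_self[of "w - v"] by (intro mult_left_mono) (linarith, simp)
    also have "\<dots> \<le> exp M * (v - w)" using that by (intro mult_right_mono) auto
    finally show ?thesis .
  qed
  show ?thesis using *[of x y] *[of y x] assms by (cases "x \<le> y") (auto simp: abs_if)
qed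

text \<open>\<open>exp (2 * H) / 2\<close>, with \<open>H\<close> the primitive of \<open>h\<close>,
  is absolutely continuous and has the integrand as its derivative almost everywhere. The 2 in the
  exponent becomes the factor 1/2 on the right, which is the origin of the contraction
  constant.\<close>

lemma has_integral_mult_exp_integral:
  fixes h :: "real \<Rightarrow> real"
  assumes h: "h absolutely_integrable_on {0..T}" and t: "t \<in> {0..T}"
  shows "((\<lambda>s. h s * exp (2 * integral {0..s} h)) has_integral (exp (2 * integral {0..t} h) - 1) / 2) {0..t}"
proof -
  define H where "H s = integral {0..s} h" for s
  have ht: "h absolutely_integrable_on {0..t}"
    using absolutely_integrable_on_subinterval[OF h, of 0 t] t by auto
  then have hi: "h integrable_on {0..t}" using set_lebesgue_integral_eq_integral(1) by blast
  have "continuous_on {0..t} H"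
    unfolding H_def by (rule indefinite_integral_continuous_1[OF hi])
  then obtain M where "\<And>s. s \<in> {0..t} \<Longrightarrow> norm (H s) \<le> M"
    using continuous_on_interval_bound by blast
  then have M: "H s \<le> M" if "s \<in> {0..t}" for s using that by (simp add: abs_le_iff)
  have "abs_continuous_on 0 t H"
    using abs_continuous_on_integral[OF ht, of 0] by (simp add: H_def[abs_def])
  then have ac: "abs_continuous_on 0 t (\<lambda>s. exp (2 * H s) / 2)"
  proof (rule abs_continuous_on_lipschitz_compose[where g = "\<lambda>y. exp (2 * y) / 2" and K = "exp (2 * M)"])
    fix r s assume "r \<in> {0..t}" "s \<in> {0..t}"
    then have "\<bar>exp (2 * H s) - exp (2 * H r)\<bar> \<le> exp (2 * M) * \<bar>2 * H s - 2 * H r\<bar>"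
      using M by (intro abs_exp_diff_le) simp_all
    also have "\<bar>2 * H s - 2 * H r\<bar> = 2 * \<bar>H s - H r\<bar>"
      unfolding right_diff_distrib[symmetric] by (simp only: abs_mult abs_numeral)
    finally have "\<bar>exp (2 * H s) - exp (2 * H r)\<bar> / 2 \<le> exp (2 * M) * \<bar>H s - H r\<bar>" by simp
    moreover have "norm (exp (2 * H s) / 2 - exp (2 * H r) / 2) = \<bar>exp (2 * H s) - exp (2 * H r)\<bar> / 2"
      unfolding diff_divide_distrib[symmetric] by simp
    ultimately show "norm (exp (2 * H s) / 2 - exp (2 * H r) / 2) \<le> exp (2 * M) * norm (H s - H r)"
      by simp
  qed
  obtain N where N: "negligible N" "\<And>s. s \<in> {0..t} - N \<Longrightarrow> (H has_vector_derivative h s) (at s within {0..t})"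
    using integral_has_vector_derivative_ae[OF hi] unfolding H_def by blast
  have "((\<lambda>s. h s * exp (2 * H s)) has_integral (exp (2 * H t) / 2 - exp (2 * H 0) / 2)) {0..t}"
  proof (rule abs_continuous_on_has_integral[OF _ ac N(1)])
    fix s assume "s \<in> {0..t} - N"
    then have "(H has_real_derivative h s) (at s within {0..t})"
      using N(2) by (simp add: has_real_derivative_iff_has_vector_derivative)
    then have "((\<lambda>s. exp (2 * H s) / 2) has_real_derivative h s * exp (2 * H s)) (at s within {0..t})"
      by (auto intro!: derivative_eq_intros)
    then show "((\<lambda>s. exp (2 * H s) / 2) has_vector_derivative h s * exp (2 * H s)) (at s within {0..t})"
      by (simp add: has_real_derivative_iff_has_vector_derivative)
  qed (use t in auto)
  then show ?thesis by (simp add: H_def diff_divide_distrib)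
qed

text \<open>The weight \<open>exp (- 2 * H)\<close>, with \<open>H\<close> the primitive of \<open>h\<close>, turns the integral
  operator with kernel \<open>h\<close> into a contraction with constant \<open>1/2\<close>.\<close>

lemma gronwall:
  fixes \<phi> h :: "real \<Rightarrow> real"
  assumes h: "h absolutely_integrable_on {0..T}" "\<And>t. t \<in> {0..T} \<Longrightarrow> 0 \<le> h t"
    and \<phi>: "continuous_on {0..T} \<phi>"
    and le: "\<And>t. t \<in> {0..T} \<Longrightarrow> \<phi> t \<le> A + integral {0..t} (\<lambda>s. h s * \<phi> s)"
    and A: "0 \<le> A" and t: "t \<in> {0..T}"
  shows "\<phi> t \<le> 2 * A * exp (2 * integral {0..t} h)"
proof -
  define H where "H s = integral {0..s} h" for s
  have hi: "h integrable_on {0..T}" using h(1) set_lebesgue_integral_eq_integral(1) by blast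
  have "continuous_on {0..T} H"
    unfolding H_def by (rule indefinite_integral_continuous_1[OF hi])
  then have "continuous_on {0..T} (\<lambda>s. \<phi> s * exp (- 2 * H s))"
    by (intro continuous_intros \<phi>)
  \<comment> \<open>The integral inequality is used at a maximum point of the weighted function
    \<open>\<phi> s * exp (- 2 * H s)\<close>; the maximum \<open>S\<close> bounds
    \<open>\<phi>\<close> everywhere.\<close>
  then obtain m where m: "m \<in> {0..T}" "\<And>s. s \<in> {0..T} \<Longrightarrow> \<phi> s * exp (- 2 * H s) \<le> \<phi> m * exp (- 2 * H m)"
    using continuous_attains_sup[of "{0..T}" "\<lambda>s. \<phi> s * exp (- 2 * H s)"] t by auto
  define S where "S = \<phi> m * exp (- 2 * H m)"
  have bd: "\<phi> s \<le> S * exp (2 * H s)" if "s \<in> {0..T}" for s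
  proof -
    have "\<phi> s = \<phi> s * exp (- 2 * H s) * exp (2 * H s)" by (simp add: exp_minus)
    also have "\<dots> \<le> S * exp (2 * H s)"
      using m(2)[OF that] by (intro mult_right_mono) (auto simp: S_def)
    finally show ?thesis .
  qed
  have "h absolutely_integrable_on {0..m}" "continuous_on {0..m} \<phi>"
    using absolutely_integrable_on_subinterval[OF h(1), of 0 m] continuous_on_subset[OF \<phi>, of "{0..m}"] m by auto
  then have "(\<lambda>s. h s *\<^sub>R \<phi> s) absolutely_integrable_on {0..m}"
    by (rule absolutely_integrable_scaleR_continuous)
  from set_lebesgue_integral_eq_integral(1)[OF this]
  have i1: "(\<lambda>s. h s * \<phi> s) integrable_on {0..m}" by simp
  note i2 = has_integral_mult_right[OF has_integral_mult_exp_integral[OF h(1) m(1)], of S]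
  have "S * exp (2 * H m) = \<phi> m" by (simp add: S_def exp_minus field_simps)
  also have "\<dots> \<le> A + integral {0..m} (\<lambda>s. h s * \<phi> s)" using le m(1) by blast
  also have "integral {0..m} (\<lambda>s. h s * \<phi> s) \<le> S * ((exp (2 * H m) - 1) / 2)"
  proof (rule has_integral_le[OF _ i2[folded H_def]])
    show "((\<lambda>s. h s * \<phi> s) has_integral integral {0..m} (\<lambda>s. h s * \<phi> s)) {0..m}" using i1 by blast
    fix s assume "s \<in> {0..m}"
    then have s: "s \<in> {0..T}" using m by auto
    show "h s * \<phi> s \<le> S * (h s * exp (2 * H s))"
      using mult_left_mono[OF bd[OF s] h(2)[OF s]] by (simp add: algebra_simps)
  qed
  finally have *: "S * exp (2 * H m) \<le> 2 * A - S"
    by (simp add: field_simps)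
  \<comment> \<open>For \<open>S > 0\<close> the left side of the preceding inequality is
    nonnegative, which forces this bound. The factors 2 are cruder than the classical ones, but only
    proportionality to \<open>A\<close> matters in the applications.\<close>
  have "S \<le> 2 * A"
  proof (cases "S \<le> 0")
    case False
    then have "0 \<le> S * exp (2 * H m)" by simp
    with * show ?thesis by simp
  qed (use A in auto)
  then show ?thesis using bd[OF t] by (smt (verit) H_def exp_gt_zero mult_right_mono)
qed

text \<open>The control is hidden in the time dependence: \<open>G t\<close> will be the vector
  field with the value \<open>u t\<close> inserted. This is why the Lipschitz constant
  \<open>h t\<close> is assumed integrable in time and not bounded.\<close>

locale linear_growth_field =
  fixes T :: real and G :: "real \<Rightarrow> 'a::euclidean_space \<Rightarrow> 'a" and h :: "real \<Rightarrow> real"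
  assumes T: "0 < T"
    and G_meas: "\<And>v. (\<lambda>t. G t v) \<in> borel_measurable (lebesgue_on {0..T})"
    and G_lip: "\<And>t v w. t \<in> {0..T} \<Longrightarrow> norm (G t v - G t w) \<le> h t * norm (v - w)"
    and G_zero: "(\<lambda>t. G t 0) absolutely_integrable_on {0..T}"
    and h_int: "h absolutely_integrable_on {0..T}"
    and h_nonneg: "\<And>t. t \<in> {0..T} \<Longrightarrow> 0 \<le> h t"
begin

lemma field_absolutely_integrable:
  assumes y: "continuous_on {0..T} y"
  shows "(\<lambda>s. G s (y s)) absolutely_integrable_on {0..T}"
proof -
  have "continuous_on UNIV (G t)" if "t \<in> {0..T}" for t
  proof (rule lipschitz_on_continuous_on[OF lipschitz_onI])
    show "dist (G t v) (G t w) \<le> h t * dist v w" for v w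
      using G_lip[OF that] by (simp add: dist_norm)
  qed (use h_nonneg that in auto)
  then have "AE t in lebesgue_on {0..T}. continuous_on UNIV (G t)"
    by (intro AE_I2) simp
  moreover have "y \<in> borel_measurable (lebesgue_on {0..T})"
    by (rule continuous_imp_measurable_on_sets_lebesgue[OF y]) simp
  ultimately have m: "(\<lambda>s. G s (y s)) \<in> borel_measurable (lebesgue_on {0..T})"
    by (rule caratheodory_measurable[where G = G, OF _ G_meas, rotated]) simp
  have "(\<lambda>s. h s * norm (y s)) absolutely_integrable_on {0..T}"
    using absolutely_integrable_scaleR_continuous[OF h_int continuous_on_norm[OF y]] by simp
  moreover have "(\<lambda>s. norm (G s 0)) absolutely_integrable_on {0..T}"
    using absolutely_integrable_norm[OF G_zero] by (simp add: o_def)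
  ultimately have "(\<lambda>s. norm (G s 0) + h s * norm (y s)) integrable_on {0..T}"
    by (intro integrable_add set_lebesgue_integral_eq_integral(1))
  then show ?thesis
  proof (rule measurable_bounded_by_integrable_imp_absolutely_integrable[OF m, rotated])
    fix s assume "s \<in> {0..T}"
    then show "norm (G s (y s)) \<le> norm (G s 0) + h s * norm (y s)"
      using G_lip[of s "y s" 0] norm_triangle_sub[of "G s (y s)" "G s 0"] by simp
  qed auto
qed

lemma field_integrable:
  assumes "continuous_on {0..T} y" "t \<in> {0..T}"
  shows "(\<lambda>s. G s (y s)) integrable_on {0..t}"
proof -
  have "(\<lambda>s. G s (y s)) integrable_on {0..T}"
    by (rule set_lebesgue_integral_eq_integral(1)[OF field_absolutely_integrable[OF assms(1)]])
  then show ?thesis by (rule integrable_on_subinterval) (use assms(2) in simp)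
qed

text \<open>Banach's fixed point theorem for the Picard operator in Bielecki's weighted norm: the
  unknown is \<open>y = exp (- 2 * H) x\<close>, whose sup norm is the weighted norm of the solution
  \<open>x\<close>. The contraction holds on all of \<open>{0..T}\<close> at once, so no
  continuation from short intervals is needed.\<close>

lemma integral_equation_exists:
  obtains x where "continuous_on {0..T} x"
    "\<And>t. t \<in> {0..T} \<Longrightarrow> x t = x0 + integral {0..t} (\<lambda>s. G s (x s))"
proof -
  define H where "H s = integral {0..s} h" for s
  have hi: "h integrable_on {0..T}" by (rule set_lebesgue_integral_eq_integral(1)[OF h_int])
  have H: "continuous_on {0..T} H"
    unfolding H_def by (rule indefinite_integral_continuous_1[OF hi])
  \<comment> \<open>The complete space consists of bounded continuous functions on the whole line;
    clamping the time to \<open>{0..T}\<close> turns functions on the interval into members of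
    it.\<close>
  define c where "c t = max 0 (min T t)" for t :: real
  have c: "c t \<in> {0..T}" "t \<in> {0..T} \<Longrightarrow> c t = t" for t using T by (auto simp: c_def)
  have cc: "continuous_on UNIV c" unfolding c_def by (intro continuous_intros)
  define Q where "Q y t = exp (- 2 * H t) *\<^sub>R (x0 + integral {0..t} (\<lambda>s. G s (exp (2 * H s) *\<^sub>R y s)))" for y t
  have yc: "continuous_on {0..T} (\<lambda>s. exp (2 * H s) *\<^sub>R apply_bcontfun y s)" for y :: "real \<Rightarrow>\<^sub>C 'a"
    by (rule continuous_on_scaleR[OF _ continuous_on_apply_bcontfun]) (intro continuous_intros H)
  have Qc: "continuous_on {0..T} (Q (apply_bcontfun y))" for y
    unfolding Q_def
    by (intro continuous_intros H indefinite_integral_continuous_1 field_integrable yc) (use T in auto)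
  have Qb: "(\<lambda>t. Q (apply_bcontfun y) (c t)) \<in> bcontfun" for y
  proof -
    obtain B where B: "\<And>s. s \<in> {0..T} \<Longrightarrow> norm (Q (apply_bcontfun y) s) \<le> B"
      using continuous_on_interval_bound[OF Qc] by blast
    show ?thesis
    proof (rule bcontfun_normI)
      show "continuous_on UNIV (\<lambda>t. Q (apply_bcontfun y) (c t))"
        by (rule continuous_on_compose2[OF Qc cc]) (use c in auto)
      show "norm (Q (apply_bcontfun y) (c t)) \<le> B" for t using B c by blast
    qed
  qed
  define P where "P y = Bcontfun (\<lambda>t. Q (apply_bcontfun y) (c t))" for y :: "real \<Rightarrow>\<^sub>C 'a"
  have Pa: "apply_bcontfun (P y) t = Q (apply_bcontfun y) (c t)" for y t
    unfolding P_def using Bcontfun_inverse[OF Qb] by simp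
  have "dist (P y) (P z) \<le> 1/2 * dist y z" for y z
  proof (rule dist_bound)
    fix t' :: real
    define t where "t = c t'"
    have t: "t \<in> {0..T}" using c by (simp add: t_def)
    let ?Y = "\<lambda>s. exp (2 * H s) *\<^sub>R apply_bcontfun y s" and ?Z = "\<lambda>s. exp (2 * H s) *\<^sub>R apply_bcontfun z s"
    have "norm (integral {0..t} (\<lambda>s. G s (?Y s)) - integral {0..t} (\<lambda>s. G s (?Z s)))
      = norm (integral {0..t} (\<lambda>s. G s (?Y s) - G s (?Z s)))"
      by (subst integral_diff) (auto intro!: field_integrable yc t)
    also have "\<dots> \<le> dist y z * ((exp (2 * H t) - 1) / 2)"
    proof (rule integral_norm_bound_integral[THEN order_trans])
      note i = has_integral_mult_right[OF has_integral_mult_exp_integral[OF h_int t], of "dist y z"]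
      show "(\<lambda>s. G s (?Y s) - G s (?Z s)) integrable_on {0..t}"
        by (intro integrable_diff field_integrable yc t)
      show "(\<lambda>s. dist y z * (h s * exp (2 * H s))) integrable_on {0..t}"
        using i unfolding H_def by blast
      show "integral {0..t} (\<lambda>s. dist y z * (h s * exp (2 * H s))) \<le> dist y z * ((exp (2 * H t) - 1) / 2)"
        unfolding H_def by (rule eq_refl[OF integral_unique[OF i]])
      fix s assume "s \<in> {0..t}"
      then have s: "s \<in> {0..T}" using t by auto
      have "norm (G s (?Y s) - G s (?Z s)) \<le> h s * norm (?Y s - ?Z s)" by (rule G_lip[OF s])
      also have "\<dots> = h s * (exp (2 * H s) * norm (apply_bcontfun y s - apply_bcontfun z s))"
        by (simp flip: scaleR_diff_right)
      also have "\<dots> \<le> h s * (exp (2 * H s) * dist y z)"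
        using dist_bounded[of y s z] h_nonneg[OF s] by (intro mult_left_mono) (auto simp: dist_norm)
      finally show "norm (G s (?Y s) - G s (?Z s)) \<le> dist y z * (h s * exp (2 * H s))"
        by (simp add: algebra_simps)
    qed
    finally have *: "norm (integral {0..t} (\<lambda>s. G s (?Y s)) - integral {0..t} (\<lambda>s. G s (?Z s)))
      \<le> dist y z * ((exp (2 * H t) - 1) / 2)" .
    have "dist (apply_bcontfun (P y) t') (apply_bcontfun (P z) t') =
       exp (- 2 * H t) * norm (integral {0..t} (\<lambda>s. G s (?Y s)) - integral {0..t} (\<lambda>s. G s (?Z s)))"
      by (simp add: Pa Q_def dist_norm flip: t_def scaleR_diff_right)
    also have "\<dots> \<le> exp (- 2 * H t) * (dist y z * ((exp (2 * H t) - 1) / 2))"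
      using * by (intro mult_left_mono) auto
    also have "\<dots> = dist y z * ((1 - exp (- 2 * H t)) / 2)"
    proof -
      have "exp (- 2 * H t) * exp (2 * H t) = 1" by (simp add: exp_minus)
      then show ?thesis by (simp add: field_simps)
    qed
    also have "\<dots> \<le> dist y z * (1 / 2)"
      by (intro mult_left_mono) auto
    finally show "dist (apply_bcontfun (P y) t') (apply_bcontfun (P z) t') \<le> 1/2 * dist y z" by simp
  qed
  then have "\<forall>y z. dist (P y) (P z) \<le> 1/2 * dist y z" by blast
  then have "\<exists>!y. P y = y" by (intro banach_fix_type[of "1/2" P]) auto
  then obtain y where y: "P y = y" by blast
  show thesis
  proof (rule that)
    show "continuous_on {0..T} (\<lambda>s. exp (2 * H s) *\<^sub>R apply_bcontfun y s)" by (rule yc)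
    fix t assume t: "t \<in> {0..T}"
    have "exp (2 * H t) *\<^sub>R exp (- 2 * H t) *\<^sub>R z = z" for z :: 'a
      by (simp add: exp_minus)
    note cancel = this
    have "apply_bcontfun y t = Q (apply_bcontfun y) t"
      using Pa[of y t] unfolding y c(2)[OF t] .
    then have "exp (2 * H t) *\<^sub>R apply_bcontfun y t = exp (2 * H t) *\<^sub>R Q (apply_bcontfun y) t"
      by (rule arg_cong)
    then show "exp (2 * H t) *\<^sub>R apply_bcontfun y t = x0 + integral {0..t} (\<lambda>s. G s (exp (2 * H s) *\<^sub>R apply_bcontfun y s))"
      unfolding Q_def cancel .
  qed
qed

lemma integral_equation_unique:
  assumes x: "continuous_on {0..T} x" "\<And>t. t \<in> {0..T} \<Longrightarrow> x t = x0 + integral {0..t} (\<lambda>s. G s (x s))"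
    and y: "continuous_on {0..T} y" "\<And>t. t \<in> {0..T} \<Longrightarrow> y t = x0 + integral {0..t} (\<lambda>s. G s (y s))"
    and t: "t \<in> {0..T}"
  shows "x t = y t"
proof -
  have "norm (x t - y t) \<le> 2 * 0 * exp (2 * integral {0..t} h)"
  proof (rule gronwall[OF h_int h_nonneg])
    show c: "continuous_on {0..T} (\<lambda>t. norm (x t - y t))" by (intro continuous_intros x y)
    fix t assume t: "t \<in> {0..T}"
    have "x t - y t = integral {0..t} (\<lambda>s. G s (x s) - G s (y s))"
      using x(2)[OF t] y(2)[OF t] by (subst integral_diff) (auto intro!: field_integrable x y t)
    also have "norm \<dots> \<le> integral {0..t} (\<lambda>s. h s * norm (x s - y s))"
    proof (rule integral_norm_bound_integral)
      show "(\<lambda>s. G s (x s) - G s (y s)) integrable_on {0..t}"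
        by (intro integrable_diff field_integrable x y t)
      have "(\<lambda>s. h s * norm (x s - y s)) integrable_on {0..T}"
        using set_lebesgue_integral_eq_integral(1)[OF absolutely_integrable_scaleR_continuous[OF h_int c]] by simp
      then show "(\<lambda>s. h s * norm (x s - y s)) integrable_on {0..t}"
        by (rule integrable_on_subinterval) (use t in auto)
    qed (use t G_lip in auto)
    finally show "norm (x t - y t) \<le> 0 + integral {0..t} (\<lambda>s. h s * norm (x s - y s))" by simp
  qed (use t in auto)
  then show ?thesis by simp
qed

text \<open>From left to right this is the fundamental theorem for absolutely continuous functions;
  from right to left, absolute continuity of an indefinite integral together with Lebesgue's
  differentiation theorem.\<close>

lemma caratheodory_iff_integral_equation:
  "abs_continuous_on 0 T x \<and>
     (AE t in lebesgue_on {0..T}. (x has_vector_derivative G t (x t)) (at t within {0..T})) \<longleftrightarrow>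
   continuous_on {0..T} x \<and> (\<forall>t\<in>{0..T}. x t = x 0 + integral {0..t} (\<lambda>s. G s (x s)))"
  (is "?ac \<and> ?der \<longleftrightarrow> ?cont \<and> ?eq")
proof
  assume L: "?ac \<and> ?der"
  have "negligible {t \<in> {0..T}. \<not> (x has_vector_derivative G t (x t)) (at t within {0..T})}"
    by (rule AE_lebesgue_on_iff_negligible[THEN iffD1]) (use L in simp_all)
  then obtain N where N: "negligible N"
    "\<And>t. t \<in> {0..T} - N \<Longrightarrow> (x has_vector_derivative G t (x t)) (at t within {0..T})"
    by blast
  have "x t = x 0 + integral {0..t} (\<lambda>s. G s (x s))" if t: "t \<in> {0..T}" for t
  proof -
    have "((\<lambda>s. G s (x s)) has_integral (x t - x 0)) {0..t}"
    proof (rule abs_continuous_on_has_integral[OF _ _ N(1)])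
      show "abs_continuous_on 0 t x" using L t by (auto intro: abs_continuous_on_subinterval)
      fix s assume "s \<in> {0..t} - N"
      then show "(x has_vector_derivative G s (x s)) (at s within {0..t})"
        using t by (intro has_vector_derivative_within_subset[OF N(2)]) auto
    qed (use t in auto)
    then show ?thesis by (simp add: integral_unique)
  qed
  then show "?cont \<and> ?eq" using L abs_continuous_on_imp_continuous_on by blast
next
  assume R: "?cont \<and> ?eq"
  have i: "(\<lambda>s. G s (x s)) absolutely_integrable_on {0..T}"
    using R field_absolutely_integrable by blast
  have "abs_continuous_on 0 T (\<lambda>t. x 0 + integral {0..t} (\<lambda>s. G s (x s)))"
    by (rule abs_continuous_on_integral[OF i])
  then have ac: ?ac by (rule abs_continuous_on_transform) (use R in blast)
  obtain N where N: "negligible N" "\<And>t. t \<in> {0..T} - N \<Longrightarrow>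
      ((\<lambda>t. integral {0..t} (\<lambda>s. G s (x s))) has_vector_derivative G t (x t)) (at t within {0..T})"
    using integral_has_vector_derivative_ae[OF set_lebesgue_integral_eq_integral(1)[OF i]] by blast
  have "(x has_vector_derivative G t (x t)) (at t within {0..T})" if t: "t \<in> {0..T} - N" for t
  proof (rule has_vector_derivative_transform)
    show "((\<lambda>t. x 0 + integral {0..t} (\<lambda>s. G s (x s))) has_vector_derivative G t (x t)) (at t within {0..T})"
      using has_vector_derivative_add[OF has_vector_derivative_const N(2)[OF t], of "x 0"] by simp
    show "x s = x 0 + integral {0..s} (\<lambda>s. G s (x s))" if "s \<in> {0..T}" for s using R that by blast
  qed (use t in auto)
  then have "negligible {t \<in> {0..T}. \<not> (x has_vector_derivative G t (x t)) (at t within {0..T})}"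
    by (intro negligible_subset[OF N(1)]) auto
  then have ?der by (rule AE_lebesgue_on_iff_negligible[THEN iffD2, rotated]) simp
  with ac show "?ac \<and> ?der" ..
qed

end

section \<open>Strongly convergent selections from convex sets\<close>

lemma le_powr_tail:
  fixes r R p :: real
  assumes "R > 0" "R \<le> r" "1 \<le> p"
  shows "r \<le> R powr (1 - p) * r powr p"
proof -
  have "r powr (1 - p) \<le> R powr (1 - p)"
    using assms by (intro powr_mono2') auto
  then have "r powr (1 - p) * r powr p \<le> R powr (1 - p) * r powr p"
    by (intro mult_right_mono) auto
  then show ?thesis using assms by (simp flip: powr_add)
qed

text \<open>Splitting at the level \<open>R\<close>. For \<open>p > 1\<close> the factor
  \<open>R powr (1 - p)\<close> tends to 0 as \<open>R\<close> grows, so bounded sets in Lp are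
  uniformly integrable; this takes the place of Hoelder's inequality.\<close>

lemma le_add_powr_tail:
  fixes r R p :: real
  assumes "R > 0" "0 \<le> r" "1 \<le> p"
  shows "r \<le> R + R powr (1 - p) * r powr p"
proof (cases "R \<le> r")
  case True
  then show ?thesis using le_powr_tail[of R r p] assms by simp
next
  case False
  then have "r \<le> R" by simp
  also have "\<dots> \<le> R + R powr (1 - p) * r powr p" by simp
  finally show ?thesis .
qed

section \<open>Quantitative strict convexity of the bracket\<close>

definition japanese_bracket :: "'a::real_inner \<Rightarrow> real" where
  "japanese_bracket v = sqrt (1 + (norm v)\<^sup>2)"

text \<open>The defect in midpoint convexity. The bracket is the Euclidean norm of the pair (1, v):
  it grows linearly, as the norm of \<open>v\<close> does, but unlike that norm it is strictly
  convex.\<close>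

definition midpoint_gap :: "'a::real_inner \<Rightarrow> 'a \<Rightarrow> real" where
  "midpoint_gap v w = (japanese_bracket v + japanese_bracket w) / 2 - japanese_bracket ((1/2) *\<^sub>R (v + w))"

lemma japanese_bracket_pos: "0 < japanese_bracket v"
  by (simp add: japanese_bracket_def add_pos_nonneg)

text \<open>Multiplication by the conjugate sum turns the gap into a difference of squares; of the
  square roots only the product of the two brackets survives.\<close>

lemma midpoint_gap_identity:
  "midpoint_gap v w * ((japanese_bracket v + japanese_bracket w) / 2 + japanese_bracket ((1/2) *\<^sub>R (v + w))) =
     (japanese_bracket v * japanese_bracket w - (1 + v \<bullet> w)) / 2"
proof -
  have sq: "(japanese_bracket x)\<^sup>2 = 1 + x \<bullet> x" for x :: 'a
    by (simp add: japanese_bracket_def add_nonneg_nonneg power2_norm_eq_inner)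
  have "midpoint_gap v w * ((japanese_bracket v + japanese_bracket w) / 2 + japanese_bracket ((1/2) *\<^sub>R (v + w)))
      = ((japanese_bracket v + japanese_bracket w) / 2)\<^sup>2 - (japanese_bracket ((1/2) *\<^sub>R (v + w)))\<^sup>2"
    by (simp add: midpoint_gap_def power2_eq_square algebra_simps)
  also have "((japanese_bracket v + japanese_bracket w) / 2)\<^sup>2 = ((japanese_bracket v)\<^sup>2 + (japanese_bracket w)\<^sup>2 + 2 * japanese_bracket v * japanese_bracket w) / 4"
    by (simp add: power2_eq_square algebra_simps add_divide_distrib)
  finally show ?thesis unfolding sq
    by (simp add: inner_simps inner_commute field_simps)
qed

text \<open>For the pairs (1, v) and (1, w) the brackets are the norms and
  \<open>1 + v \<bullet> w\<close> is the inner product. The product of the squared norms minus the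
  squared inner product equals \<open>(norm (v - w))\<^sup>2\<close> plus the Gram determinant of
  \<open>v\<close> and \<open>w\<close>, which is nonnegative. The second claim is the
  Cauchy-Schwarz inequality for the pairs.\<close>

lemma japanese_bracket_mult_inner:
  "(norm (v - w))\<^sup>2 \<le> (japanese_bracket v * japanese_bracket w - (1 + v \<bullet> w)) * (japanese_bracket v * japanese_bracket w + (1 + v \<bullet> w))"
  "\<bar>1 + v \<bullet> w\<bar> \<le> japanese_bracket v * japanese_bracket w"
proof -
  have sq: "(japanese_bracket x)\<^sup>2 = 1 + x \<bullet> x" for x :: 'a
    by (simp add: japanese_bracket_def add_nonneg_nonneg power2_norm_eq_inner)
  have "(japanese_bracket v * japanese_bracket w - (1 + v \<bullet> w)) * (japanese_bracket v * japanese_bracket w + (1 + v \<bullet> w))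
     = (japanese_bracket v)\<^sup>2 * (japanese_bracket w)\<^sup>2 - (1 + v \<bullet> w)\<^sup>2"
    by (simp add: power2_eq_square algebra_simps)
  also have "\<dots> = (norm (v - w))\<^sup>2 + ((v \<bullet> v) * (w \<bullet> w) - (v \<bullet> w)\<^sup>2)"
    unfolding sq power2_norm_eq_inner by (simp add: power2_eq_square inner_simps inner_commute algebra_simps)
  finally have eq: "(japanese_bracket v * japanese_bracket w - (1 + v \<bullet> w)) * (japanese_bracket v * japanese_bracket w + (1 + v \<bullet> w))
    = (norm (v - w))\<^sup>2 + ((v \<bullet> v) * (w \<bullet> w) - (v \<bullet> w)\<^sup>2)" .
  have cs: "(v \<bullet> w)\<^sup>2 \<le> (v \<bullet> v) * (w \<bullet> w)" by (rule Cauchy_Schwarz_ineq)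
  show "(norm (v - w))\<^sup>2 \<le> (japanese_bracket v * japanese_bracket w - (1 + v \<bullet> w)) * (japanese_bracket v * japanese_bracket w + (1 + v \<bullet> w))"
    unfolding eq using cs by simp
  then have "0 \<le> (japanese_bracket v * japanese_bracket w - (1 + v \<bullet> w)) * (japanese_bracket v * japanese_bracket w + (1 + v \<bullet> w))"
    by (rule order_trans[OF zero_le_power2])
  also have "\<dots> = (japanese_bracket v * japanese_bracket w)\<^sup>2 - (1 + v \<bullet> w)\<^sup>2"
    by (simp add: power2_eq_square square_diff_square_factored mult.commute)
  finally have "(1 + v \<bullet> w)\<^sup>2 \<le> (japanese_bracket v * japanese_bracket w)\<^sup>2" by simp
  then show "\<bar>1 + v \<bullet> w\<bar> \<le> japanese_bracket v * japanese_bracket w"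
    using japanese_bracket_pos[of v] japanese_bracket_pos[of w] abs_le_square_iff[of "1 + v \<bullet> w" "japanese_bracket v * japanese_bracket w"]
    by simp
qed

lemma midpoint_gap_nonneg: "0 \<le> midpoint_gap v w"
proof -
  let ?s = "(japanese_bracket v + japanese_bracket w) / 2 + japanese_bracket ((1/2) *\<^sub>R (v + w))"
  have "0 < ?s" by (intro add_pos_pos divide_pos_pos japanese_bracket_pos) simp
  moreover have "0 \<le> midpoint_gap v w * ?s"
    unfolding midpoint_gap_identity using japanese_bracket_mult_inner(2)[of v w] by simp
  ultimately show ?thesis by (simp add: zero_le_mult_iff)
qed

text \<open>On a ball all brackets are at most \<open>\<rho> = sqrt (1 + R\<^sup>2)\<close>. The
  conjugate sum is then at most \<open>2 * \<rho>\<close> and the factor \<open>japanese_bracket v *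
  japanese_bracket w + (1 + v \<bullet> w)\<close> at most \<open>2 * \<rho>\<^sup>2\<close>; with
  the 2 from the midpoint identity this makes \<open>8 * \<rho> ^ 3\<close>.\<close>

lemma norm_diff_le_midpoint_gap:
  assumes "norm v \<le> R" "norm w \<le> R"
  shows "(norm (v - w))\<^sup>2 \<le> 8 * sqrt (1 + R\<^sup>2) ^ 3 * midpoint_gap v w"
proof -
  define \<rho> where "\<rho> = sqrt (1 + R\<^sup>2)"
  have le: "japanese_bracket x \<le> \<rho>" if "norm x \<le> R" for x :: 'a
    using that by (simp add: japanese_bracket_def \<rho>_def power_mono)
  have "norm ((1/2) *\<^sub>R (v + w)) \<le> R" using norm_triangle_ineq[of v w] assms by simp
  note j = le[OF assms(1)] le[OF assms(2)] le[OF this]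
  have \<rho>: "1 \<le> \<rho>" by (simp add: \<rho>_def)
  let ?s = "(japanese_bracket v + japanese_bracket w) / 2 + japanese_bracket ((1/2) *\<^sub>R (v + w))"
  let ?d = "japanese_bracket v * japanese_bracket w - (1 + v \<bullet> w)"
  have ab: "japanese_bracket v * japanese_bracket w \<le> \<rho> * \<rho>"
    using j japanese_bracket_pos[of v] japanese_bracket_pos[of w] by (intro mult_mono) auto
  have "(norm (v - w))\<^sup>2 \<le> ?d * (japanese_bracket v * japanese_bracket w + (1 + v \<bullet> w))"
    by (rule japanese_bracket_mult_inner)
  also have "\<dots> \<le> ?d * (2 * (\<rho> * \<rho>))"
    using japanese_bracket_mult_inner(2)[of v w] ab by (intro mult_left_mono) auto
  also have "?d = 2 * (midpoint_gap v w * ?s)" unfolding midpoint_gap_identity by simp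
  also have "2 * (midpoint_gap v w * ?s) * (2 * (\<rho> * \<rho>)) \<le> 2 * (midpoint_gap v w * (2 * \<rho>)) * (2 * (\<rho> * \<rho>))"
  proof -
    have "?s \<le> (\<rho> + \<rho>) / 2 + \<rho>" using j by (intro add_mono divide_right_mono) auto
    then have "?s \<le> 2 * \<rho>" by simp
    then show ?thesis using midpoint_gap_nonneg[of v w] \<rho> by (intro mult_right_mono mult_left_mono) auto
  qed
  also have "\<dots> = 8 * \<rho> ^ 3 * midpoint_gap v w" by (simp add: power3_eq_cube)
  finally show ?thesis by (simp add: \<rho>_def)
qed

text \<open>Three cases: values closer than \<open>\<epsilon>\<close>; values in the ball of radius
  \<open>R\<close> but further apart, where the distance is at most its square divided by
  \<open>\<epsilon>\<close> and the gap bounds the square; and a value outside the ball, where the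
  p-th powers take over. After integration all three terms can be made small, the gap last because
  its coefficient depends on \<open>R\<close> and \<open>\<epsilon>\<close>.\<close>

lemma norm_diff_le_midpoint_gap_powr:
  assumes "0 < R" "0 < \<epsilon>" "1 \<le> p"
  shows "norm (v - w) \<le> \<epsilon> + 8 * sqrt (1 + R\<^sup>2) ^ 3 / \<epsilon> * midpoint_gap v w
    + 2 * R powr (1 - p) * (norm v powr p + norm w powr p)"
proof -
  have n: "0 \<le> 8 * sqrt (1 + R\<^sup>2) ^ 3 / \<epsilon> * midpoint_gap v w"
    using midpoint_gap_nonneg[of v w] assms by simp
  show ?thesis
  proof (cases "norm v \<le> R \<and> norm w \<le> R")
    case True
    have "norm (v - w) \<le> \<epsilon> + (norm (v - w))\<^sup>2 / \<epsilon>"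
    proof (cases "norm (v - w) \<le> \<epsilon>")
      case False
      then have "\<epsilon> * norm (v - w) \<le> norm (v - w) * norm (v - w)" by (intro mult_right_mono) auto
      then have "norm (v - w) \<le> (norm (v - w))\<^sup>2 / \<epsilon>"
        using assms by (simp add: power2_eq_square field_simps)
      then show ?thesis using assms by simp
    qed (use assms in \<open>simp add: add_increasing2\<close>)
    also have "(norm (v - w))\<^sup>2 / \<epsilon> \<le> (8 * sqrt (1 + R\<^sup>2) ^ 3 * midpoint_gap v w) / \<epsilon>"
      using assms True by (intro divide_right_mono norm_diff_le_midpoint_gap) auto
    finally have "norm (v - w) \<le> \<epsilon> + 8 * sqrt (1 + R\<^sup>2) ^ 3 / \<epsilon> * midpoint_gap v w" by simp
    moreover have "0 \<le> 2 * R powr (1 - p) * (norm v powr p + norm w powr p)" by simp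
    ultimately show ?thesis by linarith
  next
    case False
    define r where "r = max (norm v) (norm w)"
    have "norm (v - w) \<le> 2 * r" using norm_triangle_ineq4[of v w] by (simp add: r_def)
    also have "\<dots> \<le> 2 * (R powr (1 - p) * r powr p)"
      using False assms by (intro mult_left_mono le_powr_tail) (auto simp: r_def)
    also have "\<dots> \<le> 2 * (R powr (1 - p) * (norm v powr p + norm w powr p))"
      by (intro mult_left_mono) (auto simp: r_def max_def)
    finally have "norm (v - w) \<le> 2 * (R powr (1 - p) * (norm v powr p + norm w powr p))" .
    then show ?thesis using n assms by (simp add: mult.assoc)
  qed
qed

lemma japanese_bracket_le: "japanese_bracket v \<le> 2 + norm v powr p" if "1 \<le> p" for v :: "'a::real_inner"
proof -
  have "japanese_bracket v \<le> sqrt ((1 + norm v)\<^sup>2)"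
    unfolding japanese_bracket_def by (rule real_sqrt_le_mono) (simp add: power2_eq_square algebra_simps)
  then show ?thesis using le_add_powr_tail[of 1 "norm v" p] that by simp
qed

text \<open>Almost-minimisers of the strictly convex functional \<open>\<integral> sqrt (1 + |v|\<^sup>2)\<close> over the sets
  \<open>K n\<close> form a Cauchy sequence in \<open>L\<^sup>1\<close>: midpoints stay in \<open>K n\<close>, so the midpoint gaps have
  small integrals. Unlike \<open>\<integral> |v|\<^sup>2\<close>, this functional is finite on \<open>L\<^sup>p\<close> for every \<open>p\<close>.\<close>

lemma midpoint_convex_Cauchy_selection:
  fixes K :: "nat \<Rightarrow> ('b \<Rightarrow> 'a::euclidean_space) set" and p B :: real
  assumes M: "finite_measure M" and p: "1 < p"
    and ne: "\<And>n. K n \<noteq> {}" and dec: "\<And>m n. m \<le> n \<Longrightarrow> K n \<subseteq> K m"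
    and mid: "\<And>n v w. v \<in> K n \<Longrightarrow> w \<in> K n \<Longrightarrow> (\<lambda>t. (1/2) *\<^sub>R (v t + w t)) \<in> K n"
    and meas: "\<And>v. v \<in> K 0 \<Longrightarrow> v \<in> borel_measurable M"
    and int: "\<And>v. v \<in> K 0 \<Longrightarrow> integrable M (\<lambda>t. norm (v t) powr p)"
    and bd: "\<And>v. v \<in> K 0 \<Longrightarrow> (\<integral>t. norm (v t) powr p \<partial>M) \<le> B"
  obtains v where "\<And>n. v n \<in> K n"
    "\<And>e. e > 0 \<Longrightarrow> \<exists>N. \<forall>n\<ge>N. \<forall>m\<ge>n. (\<integral>t. norm (v n t - v m t) \<partial>M) < e"
proof -
  interpret finite_measure M by (rule M)
  define \<Phi> where "\<Phi> v = (\<integral>t. japanese_bracket (v t) \<partial>M)" for v :: "'b \<Rightarrow> 'a"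
  have K0: "v \<in> K 0" if "v \<in> K n" for v n using dec[of 0 n] that by auto
  have jm: "(\<lambda>t. japanese_bracket (v t)) \<in> borel_measurable M" if "v \<in> borel_measurable M" for v :: "'b \<Rightarrow> 'a"
    unfolding japanese_bracket_def using that by measurable
  have ji: "integrable M (\<lambda>t. japanese_bracket (v t))" if "v \<in> K 0" for v
  proof (rule Bochner_Integration.integrable_bound)
    show "integrable M (\<lambda>t. 2 + norm (v t) powr p)" using int[OF that] by simp
    show "AE t in M. norm (japanese_bracket (v t)) \<le> norm (2 + norm (v t) powr p)"
    proof (rule AE_I2)
      fix t
      show "norm (japanese_bracket (v t)) \<le> norm (2 + norm (v t) powr p)"
        using japanese_bracket_le[of p "v t"] japanese_bracket_pos[of "v t"] p by simp
    qed
  qed (use jm meas that in auto)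
  have \<Phi>0: "0 \<le> \<Phi> v" for v unfolding \<Phi>_def by (intro Bochner_Integration.integral_nonneg less_imp_le japanese_bracket_pos)
  have \<Phi>B: "\<Phi> v \<le> 2 * measure M (space M) + B" if "v \<in> K 0" for v
  proof -
    have "\<Phi> v \<le> (\<integral>t. 2 + norm (v t) powr p \<partial>M)"
      unfolding \<Phi>_def using ji[OF that] int[OF that] japanese_bracket_le[of p] p by (intro integral_mono) auto
    also have "\<dots> = 2 * measure M (space M) + (\<integral>t. norm (v t) powr p \<partial>M)"
      using int[OF that] by simp
    finally show ?thesis using bd[OF that] by simp
  qed
  define s where "s n = Inf (\<Phi> ` K n)" for n
  have bb: "bdd_below (\<Phi> ` K n)" for n using \<Phi>0 by (intro bdd_belowI[of _ 0]) auto
  have sle: "s n \<le> \<Phi> v" if "v \<in> K n" for n v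
    unfolding s_def using that bb by (intro cInf_lower) auto
  have "\<exists>v\<in>K n. \<Phi> v < s n + inverse (real (Suc n))" for n
  proof -
    have "Inf (\<Phi> ` K n) < s n + inverse (real (Suc n))" by (simp add: s_def)
    then show ?thesis using cInf_lessD[of "\<Phi> ` K n"] ne[of n] by auto
  qed
  then obtain v where v: "\<And>n. v n \<in> K n" "\<And>n. \<Phi> (v n) < s n + inverse (real (Suc n))" by metis
  have inc: "incseq s"
  proof (rule incseq_SucI)
    fix n show "s n \<le> s (Suc n)" unfolding s_def[of "Suc n"]
      using ne[of "Suc n"] dec[of n "Suc n"] by (intro cInf_greatest) (auto intro: sle)
  qed
  have sb: "s n \<le> 2 * measure M (space M) + B" for n using sle[OF v(1)] \<Phi>B[OF K0[OF v(1)]] by (rule order_trans)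
  then obtain l where l: "s \<longlonglongrightarrow> l" "\<And>n. s n \<le> l"
    using incseq_convergent[OF inc, of "2 * measure M (space M) + B"] by auto
  \<comment> \<open>The midpoint of \<open>v n\<close> and \<open>v m\<close> lies in
    \<open>K n\<close> and hence costs at least \<open>s n\<close>, while \<open>v m\<close> costs
    at most \<open>l\<close> plus the selection error; averaging gives this bound for the integral
    of the gap. It vanishes in the limit because the infima increase to \<open>l\<close>.\<close>
  define g where "g n = (l - s n) / 2 + inverse (real (Suc n))" for n
  have "g \<longlonglongrightarrow> (l - l) / 2 + 0"
    unfolding g_def by (intro tendsto_intros l LIMSEQ_inverse_real_of_nat) auto
  then have g0: "g \<longlonglongrightarrow> 0" by simp
  have gapi: "integrable M (\<lambda>t. midpoint_gap (v n t) (v m t))" if "n \<le> m" for n m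
  proof -
    have "v m \<in> K n" using dec[OF that] v by auto
    then have "(\<lambda>t. (1/2) *\<^sub>R (v n t + v m t)) \<in> K n" using mid v by blast
    then show ?thesis unfolding midpoint_gap_def
      using K0 v by (intro Bochner_Integration.integrable_diff integrable_divide Bochner_Integration.integrable_add ji) blast+
  qed
  have gap: "(\<integral>t. midpoint_gap (v n t) (v m t) \<partial>M) \<le> g n" if "n \<le> m" for n m
  proof -
    have "v m \<in> K n" using dec[OF that] v by auto
    then have w: "(\<lambda>t. (1/2) *\<^sub>R (v n t + v m t)) \<in> K n" using mid v by blast
    have "(\<integral>t. midpoint_gap (v n t) (v m t) \<partial>M) = (\<Phi> (v n) + \<Phi> (v m)) / 2 - \<Phi> (\<lambda>t. (1/2) *\<^sub>R (v n t + v m t))"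
      unfolding midpoint_gap_def \<Phi>_def
      using ji[OF K0[OF v(1)], of n] ji[OF K0[OF v(1)], of m] ji[OF K0[OF w]]
      by (subst Bochner_Integration.integral_diff) auto
    also have "\<dots> \<le> g n"
    proof -
      have "inverse (real (Suc m)) \<le> inverse (real (Suc n))" using that by (intro le_imp_inverse_le) auto
      moreover have "(x + y) / 2 - z \<le> (l - s n) / 2 + i"
        if "x < s n + i" "y < s m + j" "j \<le> i" "s n \<le> z" "s m \<le> l" for x y z i j :: real
        using that by (simp add: field_simps)
      ultimately show ?thesis
        unfolding g_def using v(2)[of n] v(2)[of m] sle[OF w] l(2)[of m] by blast
    qed
    finally show ?thesis .
  qed
  show thesis
  proof (rule that[OF v(1)])
    fix e :: real assume e: "e > 0"
    define \<mu> where "\<mu> = measure M (space M)"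
    have \<mu>: "0 \<le> \<mu>" by (simp add: \<mu>_def)
    have B: "0 \<le> B" using bd[OF K0[OF v(1)], of 0] by (smt (verit) Bochner_Integration.integral_nonneg powr_ge_zero)
    \<comment> \<open>The error is split into thirds. \<open>R\<close> makes the tail term small,
      with 4 coming from the factor 2 and the two bounds \<open>B\<close>; \<open>\<epsilon>\<close>
      is weighed against the total mass; \<open>N\<close> is chosen last, as it depends on both
      through \<open>C\<close>.\<close>
    have "((\<lambda>R. 4 * B * R powr (1 - p)) \<longlongrightarrow> 4 * B * 0) at_top"
      using p by (intro tendsto_mult_left tendsto_neg_powr filterlim_ident) auto
    then have "\<forall>\<^sub>F R in at_top. 4 * B * R powr (1 - p) < e / 3 \<and> R > 0"
      using e by (intro eventually_conj order_tendstoD(2)[of _ 0] eventually_gt_at_top) auto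
    then obtain R where R: "4 * B * R powr (1 - p) < e / 3" "R > 0"
      by (metis (mono_tags, lifting) eventually_at_top_linorder order_refl)
    define \<epsilon> where "\<epsilon> = e / (3 * (\<mu> + 1))"
    have \<epsilon>: "\<epsilon> > 0" "\<epsilon> * \<mu> < e / 3" using e \<mu> by (auto simp: \<epsilon>_def field_simps)
    define C where "C = 8 * sqrt (1 + R\<^sup>2) ^ 3 / \<epsilon>"
    have C: "0 \<le> C" using \<epsilon> by (simp add: C_def)
    have "(\<lambda>n. C * g n) \<longlonglongrightarrow> C * 0" by (intro tendsto_intros g0)
    then have "\<forall>\<^sub>F n in sequentially. C * g n < e / 3" using e by (intro order_tendstoD(2)[of _ 0]) auto
    then obtain N where N: "\<And>n. n \<ge> N \<Longrightarrow> C * g n < e / 3" by (auto simp: eventually_sequentially)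
    show "\<exists>N. \<forall>n\<ge>N. \<forall>m\<ge>n. (\<integral>t. norm (v n t - v m t) \<partial>M) < e"
    proof (intro exI allI impI)
      fix n m :: nat assume nm: "N \<le> n" "n \<le> m"
      let ?q = "\<lambda>t. \<epsilon> + C * midpoint_gap (v n t) (v m t) + 2 * R powr (1 - p) * (norm (v n t) powr p + norm (v m t) powr p)"
      note i = gapi[OF nm(2)] int[OF K0[OF v(1)], of n] int[OF K0[OF v(1)], of m]
      have le: "norm (v n t - v m t) \<le> ?q t" for t
        using norm_diff_le_midpoint_gap_powr[OF R(2) \<epsilon>(1), of p "v n t" "v m t"] p unfolding C_def by simp
      have "(\<integral>t. norm (v n t - v m t) \<partial>M) \<le> (\<integral>t. ?q t \<partial>M)"
      proof (rule integral_mono')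
        show "0 \<le> ?q t" for t by (rule order_trans[OF norm_ge_zero le])
      qed (use i le in auto)
      also have "\<dots> = \<epsilon> * \<mu> + C * (\<integral>t. midpoint_gap (v n t) (v m t) \<partial>M)
         + 2 * R powr (1 - p) * ((\<integral>t. norm (v n t) powr p \<partial>M) + (\<integral>t. norm (v m t) powr p \<partial>M))"
        using i by (simp add: \<mu>_def)
      also have "\<dots> \<le> \<epsilon> * \<mu> + C * g n + 2 * R powr (1 - p) * (B + B)"
        using gap[OF nm(2)] bd[OF K0[OF v(1)]] C by (intro add_mono mult_left_mono order_refl) auto
      also have "\<dots> < e" using \<epsilon>(2) N[OF nm(1)] R(1) by (simp add: algebra_simps)
      finally show "(\<integral>t. norm (v n t - v m t) \<partial>M) < e" .
    qed
  qed
qed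

text \<open>The Riesz-Fischer argument. Along the subsequence the increments have integrals at most
  \<open>(1/2) ^ k\<close>, so the series of their norms is finite almost everywhere and the values
  converge; Fatou's lemma turns the pointwise limit into a limit in L1.\<close>

lemma L1_Cauchy_imp_convergent_subseq:
  fixes v :: "nat \<Rightarrow> 'b \<Rightarrow> 'a::euclidean_space"
  assumes int: "\<And>n. integrable M (v n)"
    and Cauchy: "\<And>e. e > 0 \<Longrightarrow> \<exists>N. \<forall>n\<ge>N. \<forall>m\<ge>n. (\<integral>t. norm (v n t - v m t) \<partial>M) < e"
  obtains u and r :: "nat \<Rightarrow> nat" where "strict_mono r" "integrable M u"
    "AE t in M. (\<lambda>k. v (r k) t) \<longlonglongrightarrow> u t"
    "(\<lambda>k. \<integral>t. norm (v (r k) t - u t) \<partial>M) \<longlonglongrightarrow> 0"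
proof -
  have "\<forall>k. \<exists>N. \<forall>n\<ge>N. \<forall>m\<ge>n. (\<integral>t. norm (v n t - v m t) \<partial>M) < (1/2) ^ k"
    using Cauchy by simp
  then obtain N where N: "\<And>k n m. N k \<le> n \<Longrightarrow> n \<le> m \<Longrightarrow> (\<integral>t. norm (v n t - v m t) \<partial>M) < (1/2) ^ k"
    by metis
  \<comment> \<open>Summation makes the index strictly increasing and at least \<open>N k\<close>,
    although \<open>N\<close> need not be monotone.\<close>
  define r where "r k = (\<Sum>i\<le>k. Suc (N i))" for k
  have r: "strict_mono r" unfolding strict_mono_Suc_iff by (simp add: r_def)
  have rN: "N k \<le> r k" for k unfolding r_def by (cases k) auto
  define w where "w k = v (r k)" for k
  have wi: "integrable M (w k)" for k by (simp add: w_def int)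
  have wc: "(\<integral>t. norm (w k t - w m t) \<partial>M) \<le> (1/2) ^ k" if "k \<le> m" for k m
    unfolding w_def using N[of k "r k" "r m", OF rN] strict_mono_less_eq[OF r, of k m] that by simp
  have nn: "(\<integral>\<^sup>+t. ennreal (norm (w k t - w m t)) \<partial>M) \<le> ennreal ((1/2) ^ k)" if "k \<le> m" for k m
  proof -
    have "(\<integral>\<^sup>+t. ennreal (norm (w k t - w m t)) \<partial>M) = ennreal (\<integral>t. norm (w k t - w m t) \<partial>M)"
      using wi by (intro nn_integral_eq_integral) auto
    then show ?thesis using wc[OF that] by (simp add: ennreal_leI)
  qed
  have wm[measurable]: "w k \<in> borel_measurable M" for k by (rule borel_measurable_integrable[OF wi])
  have "(\<integral>\<^sup>+t. (\<Sum>k. ennreal (norm (w k t - w (Suc k) t))) \<partial>M) = (\<Sum>k. \<integral>\<^sup>+t. ennreal (norm (w k t - w (Suc k) t)) \<partial>M)"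
    by (rule nn_integral_suminf) measurable
  also have "\<dots> \<le> (\<Sum>k. ennreal ((1/2) ^ k))"
    by (intro suminf_le nn) auto
  also have "\<dots> = ennreal (\<Sum>k. (1/2) ^ k)"
    by (intro suminf_ennreal2) (auto intro: summable_geometric)
  also have "\<dots> < \<infinity>" by simp
  finally have "AE t in M. (\<Sum>k. ennreal (norm (w k t - w (Suc k) t))) \<noteq> \<infinity>"
    by (intro nn_integral_PInf_AE) auto
  then have conv: "AE t in M. convergent (\<lambda>k. w k t)"
  proof eventually_elim
    case (elim t)
    then have "summable (\<lambda>k. norm (w k t - w (Suc k) t))"
      by (intro summable_suminf_not_top) auto
    then have "summable (\<lambda>k. norm (w (Suc k) t - w k t))"
      by (simp add: norm_minus_commute)
    then have "summable (\<lambda>k. w (Suc k) t - w k t)" by (rule summable_norm_cancel)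
    then have "convergent (\<lambda>n. \<Sum>k<n. w (Suc k) t - w k t)"
      by (simp add: summable_iff_convergent)
    then have "convergent (\<lambda>n. w n t - w 0 t)"
      by (simp add: sum_lessThan_telescope[of "\<lambda>k. w k t"])
    then have "convergent (\<lambda>n. (w n t - w 0 t) + w 0 t)"
      by (intro convergent_add convergent_const)
    then show ?case by simp
  qed
  define u where "u t = lim (\<lambda>k. w k t)" for t
  have um[measurable]: "u \<in> borel_measurable M"
    unfolding u_def by measurable
  have lim: "AE t in M. (\<lambda>k. w k t) \<longlonglongrightarrow> u t"
    using conv by eventually_elim (simp add: u_def convergent_LIMSEQ_iff)
  have nu: "(\<integral>\<^sup>+t. ennreal (norm (w k t - u t)) \<partial>M) \<le> ennreal ((1/2) ^ k)" for k
  proof -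
    have "(\<integral>\<^sup>+t. ennreal (norm (w k t - u t)) \<partial>M) = (\<integral>\<^sup>+t. liminf (\<lambda>m. ennreal (norm (w k t - w m t))) \<partial>M)"
    proof (rule nn_integral_cong_AE, use lim in eventually_elim)
      case (elim t)
      then have "(\<lambda>m. ennreal (norm (w k t - w m t))) \<longlonglongrightarrow> ennreal (norm (w k t - u t))"
        by (intro tendsto_intros)
      then show ?case by (rule lim_imp_Liminf[OF trivial_limit_sequentially, symmetric])
    qed
    also have "\<dots> \<le> liminf (\<lambda>m. \<integral>\<^sup>+t. ennreal (norm (w k t - w m t)) \<partial>M)"
      by (rule nn_integral_liminf) measurable
    also have "\<dots> \<le> ennreal ((1/2) ^ k)"
    proof -
      have "\<forall>\<^sub>F m in sequentially. (\<integral>\<^sup>+t. ennreal (norm (w k t - w m t)) \<partial>M) \<le> ennreal ((1/2) ^ k)"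
        using eventually_ge_at_top[of k] by eventually_elim (rule nn)
      then have "liminf (\<lambda>m. \<integral>\<^sup>+t. ennreal (norm (w k t - w m t)) \<partial>M) \<le> liminf (\<lambda>m. ennreal ((1/2) ^ k))"
        by (rule Liminf_mono)
      then show ?thesis by (simp add: Liminf_const)
    qed
    finally show ?thesis .
  qed
  have di: "integrable M (\<lambda>t. w k t - u t)" for k
    using le_less_trans[OF nu[of k]] by (intro integrableI_bounded) auto
  have ui: "integrable M u"
    using Bochner_Integration.integrable_diff[OF wi[of 0] di[of 0]] by simp
  have "(\<integral>t. norm (w k t - u t) \<partial>M) \<le> (1/2) ^ k" for k
  proof -
    have "ennreal (\<integral>t. norm (w k t - u t) \<partial>M) = (\<integral>\<^sup>+t. ennreal (norm (w k t - u t)) \<partial>M)"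
      using di by (intro nn_integral_eq_integral[symmetric]) auto
    also note nu[of k]
    finally show ?thesis by (subst (asm) ennreal_le_iff) auto
  qed
  then have "(\<lambda>k. \<integral>t. norm (w k t - u t) \<partial>M) \<longlonglongrightarrow> 0"
    by (intro real_tendsto_sandwich[OF _ _ tendsto_const LIMSEQ_power_zero[of "1/2"]]) auto
  then show thesis using that[OF r ui] lim by (simp add: w_def)
qed

section \<open>Dependence of the trajectories on the control and the parameter\<close>

lemma bilinear_matrix_vector_mult: "bilinear ((*v) :: real ^ 'n ^ 'm \<Rightarrow> real ^ 'n \<Rightarrow> real ^ 'm)"
  by (auto simp: bilinear_def linear_iff matrix_vector_right_distrib matrix_vector_mult_add_rdistrib
    matrix_vector_mult_scaleR scaleR_matrix_vector_assoc)

lemma integral_bilinear_continuous_bound: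
  fixes \<beta> :: "'a::euclidean_space \<Rightarrow> 'b::euclidean_space \<Rightarrow> 'c::euclidean_space"
  assumes \<beta>: "bilinear \<beta>" and K: "0 \<le> K" "\<And>y z. norm (\<beta> y z) \<le> K * norm y * norm z"
    and Y: "continuous_on {0..T} Y" and R: "\<And>s. s \<in> {0..T} \<Longrightarrow> norm (Y s) \<le> R"
    and w: "w absolutely_integrable_on {0..T}"
    and W: "\<And>t. t \<in> {0..T} \<Longrightarrow> norm (integral {0..t} w) \<le> \<delta>"
    and m: "0 < m" and osc: "\<And>r s. r \<in> {0..T} \<Longrightarrow> s \<in> {0..T} \<Longrightarrow> \<bar>s - r\<bar> \<le> T / real m \<Longrightarrow> norm (Y s - Y r) \<le> \<eta>"
    and t: "t \<in> {0..T}"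
  shows "norm (integral {0..t} (\<lambda>s. \<beta> (Y s) (w s))) \<le> K * \<eta> * integral {0..T} (\<lambda>s. norm (w s)) + real m * (2 * K * R * \<delta>)"
proof -
  \<comment> \<open>The nodes divide \<open>{0..t}\<close> and not \<open>{0..T}\<close>, so that
    the last one is \<open>t\<close> itself; their spacing is still at most
    \<open>T / m\<close>.\<close>
  define \<tau> where "\<tau> j = t * real j / real m" for j
  have \<tau>: "\<tau> j \<in> {0..T}" if "j \<le> m" for j
  proof -
    have "t * real j \<le> t * real m" using that t by (intro mult_left_mono) auto
    then have "\<tau> j \<le> t" using m by (simp add: \<tau>_def field_simps)
    moreover have "0 \<le> \<tau> j" using t by (simp add: \<tau>_def)
    ultimately show ?thesis using t by simp
  qed
  have \<tau>m: "\<tau> m = t" "\<tau> 0 = 0" using m by (auto simp: \<tau>_def)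
  have R0: "0 \<le> R" using R[of t] t norm_ge_zero order_trans by blast
  have \<eta>0: "0 \<le> \<eta>" using osc[of t t] t by simp
  have lin: "linear (\<beta> y)" "linear (\<lambda>y. \<beta> y z)" for y z using \<beta> by (auto simp: bilinear_def)
  have "bounded (Y ` {0..T})" using Y by (intro compact_imp_bounded compact_continuous_image) auto
  moreover have "Y \<in> borel_measurable (lebesgue_on {0..T})"
    by (rule continuous_imp_measurable_on_sets_lebesgue[OF Y]) simp
  ultimately have bi: "(\<lambda>s. \<beta> (Y s) (w s)) absolutely_integrable_on {0..T}"
    using absolutely_integrable_bounded_measurable_product[OF \<beta>, of Y "{0..T}" w] w by simp
  have nw: "(\<lambda>s. norm (w s)) absolutely_integrable_on {0..T}"
    using absolutely_integrable_norm[OF w] by (simp add: o_def)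
  have sub: "q integrable_on {u..v}" if "q absolutely_integrable_on {0..T}" "u \<in> {0..T}" "v \<in> {0..T}"
    for u v and q :: "real \<Rightarrow> 'e::euclidean_space"
    by (rule integrable_on_subinterval[OF set_lebesgue_integral_eq_integral(1)[OF that(1)]]) (use that in auto)
  have comb: "integral {0..v} q = integral {0..u} q + integral {u..v} q"
    if "q absolutely_integrable_on {0..T}" "u \<in> {0..T}" "v \<in> {0..T}" "u \<le> v" for u v and q :: "real \<Rightarrow> 'e::euclidean_space"
    using that by (intro Henstock_Kurzweil_Integration.integral_combine[symmetric] sub) auto
  have "norm (integral {0..\<tau> j} (\<lambda>s. \<beta> (Y s) (w s))) \<le> K * \<eta> * integral {0..\<tau> j} (\<lambda>s. norm (w s)) + real j * (2 * K * R * \<delta>)"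
    if "j \<le> m" for j using that
  proof (induction j)
    case 0
    then show ?case by (simp add: \<tau>m)
  next
    case (Suc j)
    let ?u = "\<tau> j" and ?v = "\<tau> (Suc j)"
    have u: "?u \<in> {0..T}" and v: "?v \<in> {0..T}" using \<tau> Suc.prems by auto
    have uv: "?u \<le> ?v" "?v - ?u \<le> T / real m"
      using t m by (auto simp: \<tau>_def field_simps)
    have i1: "(\<lambda>s. \<beta> (Y s - Y ?u) (w s)) integrable_on {?u..?v}"
      and i2: "(\<lambda>s. \<beta> (Y ?u) (w s)) integrable_on {?u..?v}"
      and eq2: "integral {?u..?v} (\<lambda>s. \<beta> (Y ?u) (w s)) = \<beta> (Y ?u) (integral {?u..?v} w)"
    proof -
      show i2: "(\<lambda>s. \<beta> (Y ?u) (w s)) integrable_on {?u..?v}"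
        using integrable_linear[OF sub[OF w u v], of "\<beta> (Y ?u)"] lin(1) linear_conv_bounded_linear by (auto simp: o_def)
      show "integral {?u..?v} (\<lambda>s. \<beta> (Y ?u) (w s)) = \<beta> (Y ?u) (integral {?u..?v} w)"
        using integral_linear[OF sub[OF w u v], of "\<beta> (Y ?u)"] lin(1) linear_conv_bounded_linear by (auto simp: o_def)
      have "(\<lambda>s. \<beta> (Y s) (w s) - \<beta> (Y ?u) (w s)) integrable_on {?u..?v}"
        by (rule integrable_diff[OF sub[OF bi u v] i2])
      then show "(\<lambda>s. \<beta> (Y s - Y ?u) (w s)) integrable_on {?u..?v}"
        by (simp add: linear_diff[OF lin(2)])
    qed
    have "integral {?u..?v} (\<lambda>s. \<beta> (Y s) (w s)) = integral {?u..?v} (\<lambda>s. \<beta> (Y s - Y ?u) (w s) + \<beta> (Y ?u) (w s))"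
      by (simp add: linear_diff[OF lin(2)])
    also have "\<dots> = integral {?u..?v} (\<lambda>s. \<beta> (Y s - Y ?u) (w s)) + \<beta> (Y ?u) (integral {?u..?v} w)"
      by (subst integral_add[OF i1 i2]) (simp add: eq2)
    finally have eq: "integral {?u..?v} (\<lambda>s. \<beta> (Y s) (w s)) = integral {?u..?v} (\<lambda>s. \<beta> (Y s - Y ?u) (w s)) + \<beta> (Y ?u) (integral {?u..?v} w)" .
    have "norm (integral {?u..?v} (\<lambda>s. \<beta> (Y s - Y ?u) (w s))) \<le> integral {?u..?v} (\<lambda>s. K * \<eta> * norm (w s))"
    proof (rule integral_norm_bound_integral[OF i1])
      show "(\<lambda>s. K * \<eta> * norm (w s)) integrable_on {?u..?v}"
        by (rule integrable_on_mult_right[OF sub[OF nw u v]])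
      fix s assume s: "s \<in> {?u..?v}"
      have "norm (\<beta> (Y s - Y ?u) (w s)) \<le> K * norm (Y s - Y ?u) * norm (w s)" by (rule K(2))
      also have "\<dots> \<le> K * \<eta> * norm (w s)"
        using s u v uv K(1) by (intro mult_right_mono mult_left_mono osc) auto
      finally show "norm (\<beta> (Y s - Y ?u) (w s)) \<le> K * \<eta> * norm (w s)" .
    qed
    then have a: "norm (integral {?u..?v} (\<lambda>s. \<beta> (Y s - Y ?u) (w s))) \<le> K * \<eta> * integral {?u..?v} (\<lambda>s. norm (w s))"
      by simp
    have "norm (integral {?u..?v} w) = norm (integral {0..?v} w - integral {0..?u} w)"
      using comb[OF w u v uv(1)] by simp
    also have "\<dots> \<le> \<delta> + \<delta>" using W[OF u] W[OF v] norm_triangle_ineq4 by (smt (verit))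
    finally have "norm (integral {?u..?v} w) \<le> \<delta> + \<delta>" .
    then have "K * norm (Y ?u) * norm (integral {?u..?v} w) \<le> K * R * (\<delta> + \<delta>)"
      using R[OF u] K(1) R0 by (intro mult_mono mult_left_mono) auto
    then have b: "norm (\<beta> (Y ?u) (integral {?u..?v} w)) \<le> 2 * K * R * \<delta>"
      using K(2)[of "Y ?u" "integral {?u..?v} w"] by simp
    have "norm (integral {0..?v} (\<lambda>s. \<beta> (Y s) (w s)))
      \<le> norm (integral {0..?u} (\<lambda>s. \<beta> (Y s) (w s))) + norm (integral {?u..?v} (\<lambda>s. \<beta> (Y s) (w s)))"
      unfolding comb[OF bi u v uv(1)] by (rule norm_triangle_ineq)
    also have "\<dots> \<le> (K * \<eta> * integral {0..?u} (\<lambda>s. norm (w s)) + real j * (2 * K * R * \<delta>))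
      + (K * \<eta> * integral {?u..?v} (\<lambda>s. norm (w s)) + 2 * K * R * \<delta>)"
      unfolding eq using Suc a b by (intro add_mono norm_triangle_mono) auto
    also have "\<dots> = K * \<eta> * integral {0..?v} (\<lambda>s. norm (w s)) + real (Suc j) * (2 * K * R * \<delta>)"
      unfolding comb[OF nw u v uv(1)] by (simp add: algebra_simps)
    finally show ?case .
  qed
  from this[of m] have "norm (integral {0..t} (\<lambda>s. \<beta> (Y s) (w s)))
     \<le> K * \<eta> * integral {0..t} (\<lambda>s. norm (w s)) + real m * (2 * K * R * \<delta>)" by (simp add: \<tau>m)
  also have "integral {0..t} (\<lambda>s. norm (w s)) \<le> integral {0..T} (\<lambda>s. norm (w s))"
    using t by (intro integral_subset_le sub nw) auto
  finally show ?thesis using K(1) \<eta>0 by (simp add: mult_left_mono)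
qed

text \<open>Uniform convergence of the primitives is the form of weak convergence used for the controls.\<close>

lemma integral_bilinear_continuous_tendsto:
  fixes \<beta> :: "'a::euclidean_space \<Rightarrow> 'b::euclidean_space \<Rightarrow> 'c::euclidean_space"
    and Y :: "real \<Rightarrow> 'a" and w :: "nat \<Rightarrow> real \<Rightarrow> 'b"
  assumes \<beta>: "bilinear \<beta>" and Y: "continuous_on {0..T} Y" and T: "0 < T"
    and w: "\<And>n. w n absolutely_integrable_on {0..T}"
    and B: "\<And>n. integral {0..T} (\<lambda>s. norm (w n s)) \<le> B"
    and \<delta>: "\<And>n t. t \<in> {0..T} \<Longrightarrow> norm (integral {0..t} (w n)) \<le> \<delta> n" "\<delta> \<longlonglongrightarrow> 0"
  obtains E :: "nat \<Rightarrow> real" where "E \<longlonglongrightarrow> 0"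
    "\<And>n t. t \<in> {0..T} \<Longrightarrow> norm (integral {0..t} (\<lambda>s. \<beta> (Y s) (w n s))) \<le> E n"
proof -
  obtain K where K: "K > 0" "\<And>y z. norm (\<beta> y z) \<le> K * norm y * norm z"
    using bilinear_bounded_pos[OF \<beta>] by blast
  obtain R where R: "0 \<le> R" "\<And>s. s \<in> {0..T} \<Longrightarrow> norm (Y s) \<le> R"
    using continuous_on_interval_bound[OF Y] by blast
  have B0: "0 \<le> B"
  proof -
    have "0 \<le> integral {0..T} (\<lambda>s. norm (w 0 s))" by (rule integral_nonneg)
      (use absolutely_integrable_norm[OF w, of 0] in \<open>auto simp: o_def intro: set_lebesgue_integral_eq_integral(1)\<close>)
    then show ?thesis using B[of 0] by simp
  qed
  \<comment> \<open>The supremum over \<open>t\<close> serves as the common bound; it is finite by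
    the estimate below with tolerance 1.\<close>
  define S where "S n = (SUP t\<in>{0..T}. norm (integral {0..t} (\<lambda>s. \<beta> (Y s) (w n s))))" for n
  have ev: "\<exists>m>0. \<forall>n. \<forall>t\<in>{0..T}. norm (integral {0..t} (\<lambda>s. \<beta> (Y s) (w n s))) \<le> K * \<eta> * B + real m * (2 * K * R * \<delta> n)"
    if \<eta>: "\<eta> > 0" for \<eta>
  proof -
    have "uniformly_continuous_on {0..T} Y" using Y by (intro compact_uniformly_continuous) auto
    then obtain d where d: "d > 0" "\<And>r s. r \<in> {0..T} \<Longrightarrow> s \<in> {0..T} \<Longrightarrow> dist s r < d \<Longrightarrow> dist (Y s) (Y r) < \<eta>"
      unfolding uniformly_continuous_on_def using \<eta> by metis
    obtain m :: nat where m: "T / d < real m" using reals_Archimedean2 by blast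
    have m0: "0 < m" using m T d(1) by (metis divide_pos_pos gr0I not_less_iff_gr_or_eq of_nat_0 order_less_trans)
    have "T / real m < d" using m m0 d(1) by (simp add: field_simps)
    then have osc: "norm (Y s - Y r) \<le> \<eta>" if "r \<in> {0..T}" "s \<in> {0..T}" "\<bar>s - r\<bar> \<le> T / real m" for r s
      using d(2)[of r s] that by (auto simp: dist_norm)
    show ?thesis
    proof (intro exI[of _ m] conjI allI ballI m0)
      fix n t assume t: "t \<in> {0..T}"
      have "norm (integral {0..t} (\<lambda>s. \<beta> (Y s) (w n s)))
         \<le> K * \<eta> * integral {0..T} (\<lambda>s. norm (w n s)) + real m * (2 * K * R * \<delta> n)"
        using K(1) by (intro integral_bilinear_continuous_bound[OF \<beta> _ K(2) Y R(2) w \<delta>(1) m0 osc t]) auto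
      also have "\<dots> \<le> K * \<eta> * B + real m * (2 * K * R * \<delta> n)"
        using B[of n] K(1) \<eta> by (intro add_right_mono mult_left_mono) auto
      finally show "norm (integral {0..t} (\<lambda>s. \<beta> (Y s) (w n s))) \<le> K * \<eta> * B + real m * (2 * K * R * \<delta> n)" .
    qed
  qed
  have bdd: "bdd_above ((\<lambda>t. norm (integral {0..t} (\<lambda>s. \<beta> (Y s) (w n s)))) ` {0..T})" for n
  proof -
    obtain m where "\<And>t. t \<in> {0..T} \<Longrightarrow> norm (integral {0..t} (\<lambda>s. \<beta> (Y s) (w n s))) \<le> K * 1 * B + real m * (2 * K * R * \<delta> n)"
      using ev[OF zero_less_one] by blast
    then show ?thesis by (rule bdd_aboveI2)
  qed
  have ne: "{0..T} \<noteq> {}" using T by simp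
  show thesis
  proof (rule that[of S])
    show "norm (integral {0..t} (\<lambda>s. \<beta> (Y s) (w n s))) \<le> S n" if "t \<in> {0..T}" for n t
      unfolding S_def by (rule cSUP_upper[OF that bdd])
    then have S0: "0 \<le> S n" for n using T by (meson atLeastAtMost_iff less_imp_le norm_ge_zero order_refl order_trans)
    show "S \<longlonglongrightarrow> 0"
    proof (rule LIMSEQ_I)
      fix e :: real assume e: "e > 0"
      \<comment> \<open>\<open>B + 1\<close> because \<open>B\<close> may be 0. The number
        \<open>m\<close> of pieces depends on \<open>\<eta>\<close> but not on \<open>n\<close>, so
        \<open>\<delta> n\<close> can be made small against it afterwards.\<close>
      define \<eta> where "\<eta> = e / 2 / K / (B + 1)"
      have \<eta>0: "\<eta> > 0" unfolding \<eta>_def using e K(1) B0 by (intro divide_pos_pos) auto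
      have "K * \<eta> * B < K * \<eta> * (B + 1)" using \<eta>0 K(1) by (intro mult_strict_left_mono) auto
      also have "\<dots> = e / 2"
      proof -
        have "k * (x / k / b) * b = x" if "k \<noteq> 0" "b \<noteq> 0" for k x b :: real using that by simp
        from this[of K "B + 1" "e / 2"] show ?thesis unfolding \<eta>_def using K(1) B0 by argo
      qed
      finally have \<eta>: "\<eta> > 0" "K * \<eta> * B < e / 2" using \<eta>0 by auto
      obtain m where m: "\<And>n t. t \<in> {0..T} \<Longrightarrow> norm (integral {0..t} (\<lambda>s. \<beta> (Y s) (w n s))) \<le> K * \<eta> * B + real m * (2 * K * R * \<delta> n)"
        using ev[OF \<eta>(1)] by blast
      have "(\<lambda>n. real m * (2 * K * R * \<delta> n)) \<longlonglongrightarrow> real m * (2 * K * R * 0)"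
        by (intro tendsto_intros \<delta>)
      then have "\<forall>\<^sub>F n in sequentially. real m * (2 * K * R * \<delta> n) < e / 2"
        using e by (intro order_tendstoD(2)[of _ 0]) auto
      then obtain N where N: "\<And>n. n \<ge> N \<Longrightarrow> real m * (2 * K * R * \<delta> n) < e / 2" by (auto simp: eventually_sequentially)
      show "\<exists>N. \<forall>n\<ge>N. norm (S n - 0) < e"
      proof (intro exI allI impI)
        fix n assume "N \<le> n"
        have "S n \<le> K * \<eta> * B + real m * (2 * K * R * \<delta> n)"
          unfolding S_def by (rule cSUP_least[OF ne m])
        then show "norm (S n - 0) < e" using \<eta>(2) N[OF \<open>N \<le> n\<close>] S0[of n] by simp
      qed
    qed
  qed
qed

section \<open>The control system and its trajectories\<close>

definition l1_norm :: "real ^ 'k \<Rightarrow> real" where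
  "l1_norm w = (\<Sum>i\<in>UNIV. \<bar>w $ i\<bar>)"

lemma l1_norm_bounds: "0 \<le> l1_norm w" "l1_norm (w :: real ^ 'k) \<le> real CARD('k) * norm w"
proof -
  show "0 \<le> l1_norm w" by (simp add: l1_norm_def sum_nonneg)
  show "l1_norm w \<le> real CARD('k) * norm w"
    unfolding l1_norm_def using sum_bounded_above[of UNIV "\<lambda>i. \<bar>w $ i\<bar>" "norm w"] component_le_norm_cart by auto
qed

locale control_system =
  fixes T L :: real and \<Theta> :: "(real ^ 'l) set"
    and F0 :: "real ^ 'd \<Rightarrow> real ^ 'l \<Rightarrow> real ^ 'd"
    and F :: "real ^ 'd \<Rightarrow> real ^ 'l \<Rightarrow> real ^ 'k ^ 'd"
    and x0 :: "real ^ 'l \<Rightarrow> real ^ 'd"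
  assumes T: "0 < T" and L: "0 < L" and compact_Theta: "compact \<Theta>"
    and lipschitz: "\<And>x1 x2 \<theta>1 \<theta>2. \<theta>1 \<in> \<Theta> \<Longrightarrow> \<theta>2 \<in> \<Theta> \<Longrightarrow>
      Max (insert (norm (F0 x1 \<theta>1 - F0 x2 \<theta>2))
             (range (\<lambda>i. norm (column i (F x1 \<theta>1) - column i (F x2 \<theta>2)))))
      \<le> L * (norm (x1 - x2) + norm (x1 + x2) * norm (\<theta>1 - \<theta>2))"
    and x0: "continuous_on \<Theta> x0"
begin

definition field :: "real ^ 'l \<Rightarrow> real ^ 'k \<Rightarrow> real ^ 'd \<Rightarrow> real ^ 'd" where
  "field \<theta> w x = F0 x \<theta> + F x \<theta> *v w"

text \<open>The Lipschitz constant in the state when the control has the value \<open>w\<close>: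
  \<open>L\<close> from the drift and \<open>L * \<bar>w $ i\<bar>\<close> from each column. It
  grows linearly in \<open>w\<close>, so it is integrable along every integrable control.\<close>

definition rate :: "real ^ 'k \<Rightarrow> real" where
  "rate w = L * (1 + l1_norm w)"

lemma rate_nonneg: "0 \<le> rate w"
  using L l1_norm_bounds(1)[of w] by (simp add: rate_def)

lemma rate_le: "rate w \<le> L * (1 + real CARD('k) * norm w)"
  using L l1_norm_bounds(2)[of w] by (simp add: rate_def)

text \<open>The product with \<open>w\<close> is the combination of the columns with the weights
  \<open>w $ i\<close>, and the hypothesis bounds the drift and each column by the same
  quantity.\<close>

lemma field_diff:
  assumes "\<theta>1 \<in> \<Theta>" "\<theta>2 \<in> \<Theta>"
  shows "norm (field \<theta>1 w x1 - field \<theta>2 w x2) \<le> rate w * (norm (x1 - x2) + norm (x1 + x2) * norm (\<theta>1 - \<theta>2))"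
    (is "_ \<le> _ * ?D")
proof -
  have *: "y \<le> L * ?D" if "y \<in> insert (norm (F0 x1 \<theta>1 - F0 x2 \<theta>2))
      (range (\<lambda>i. norm (column i (F x1 \<theta>1) - column i (F x2 \<theta>2))))" for y
    by (rule order_trans[OF Max_ge[OF _ that] lipschitz[OF assms]]) simp
  have "field \<theta>1 w x1 - field \<theta>2 w x2 = (F0 x1 \<theta>1 - F0 x2 \<theta>2) + (F x1 \<theta>1 - F x2 \<theta>2) *v w"
    by (simp add: field_def matrix_vector_mult_diff_rdistrib)
  also have "(F x1 \<theta>1 - F x2 \<theta>2) *v w = (\<Sum>i\<in>UNIV. w $ i *\<^sub>R (column i (F x1 \<theta>1) - column i (F x2 \<theta>2)))"
    by (simp add: matrix_mult_sum scalar_mult_eq_scaleR column_def vec_eq_iff)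
  also have "norm ((F0 x1 \<theta>1 - F0 x2 \<theta>2) + \<dots>) \<le> norm (F0 x1 \<theta>1 - F0 x2 \<theta>2) + norm \<dots>"
    by (rule norm_triangle_ineq)
  also have "norm (\<Sum>i\<in>UNIV. w $ i *\<^sub>R (column i (F x1 \<theta>1) - column i (F x2 \<theta>2)))
    \<le> (\<Sum>i\<in>UNIV. \<bar>w $ i\<bar> * (L * ?D))"
    by (rule sum_norm_le) (auto intro!: mult_left_mono *)
  also have "norm (F0 x1 \<theta>1 - F0 x2 \<theta>2) \<le> L * ?D" by (rule *) simp
  also have "(\<Sum>i\<in>UNIV. \<bar>w $ i\<bar> * (L * ?D)) = l1_norm w * (L * ?D)"
    by (simp add: l1_norm_def sum_distrib_right)
  finally show ?thesis by (simp add: rate_def algebra_simps)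
qed

text \<open>For fixed \<open>\<theta>\<close> the hypothesis makes every entry of the matrix
  Lipschitz in the state. Continuity along a trajectory is what the matrix must have to be tested
  against weakly convergent controls.\<close>

lemma matrix_continuous:
  assumes "\<theta> \<in> \<Theta>"
  shows "continuous_on UNIV (\<lambda>x. F x \<theta>)"
proof -
  have "L-lipschitz_on UNIV (\<lambda>x. F x \<theta> $ i $ j)" for i j
  proof (rule lipschitz_onI)
    fix x y :: "real ^ 'd"
    have "norm (column j (F x \<theta>) - column j (F y \<theta>)) \<le> L * norm (x - y)"
      using lipschitz[OF assms assms, of x y] by (subst (asm) Max_le_iff) auto
    moreover have "\<bar>(column j (F x \<theta>) - column j (F y \<theta>)) $ i\<bar> \<le> norm (column j (F x \<theta>) - column j (F y \<theta>))"
      by (rule component_le_norm_cart)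
    ultimately show "dist (F x \<theta> $ i $ j) (F y \<theta> $ i $ j) \<le> L * dist x y"
      by (simp add: dist_norm column_def)
  qed (use L in simp)
  then have "continuous_on UNIV (\<lambda>x. F x \<theta> $ i $ j)" for i j
    by (rule lipschitz_on_continuous_on)
  then have "continuous_on UNIV (\<lambda>x. \<chi> i j. F x \<theta> $ i $ j)"
    by (intro continuous_on_vec_lambda)
  then show ?thesis by simp
qed

lemma rate_integrable:
  assumes u: "u absolutely_integrable_on {0..T}"
  shows "(\<lambda>t. rate (u t)) absolutely_integrable_on {0..T}"
    "integral {0..T} (\<lambda>t. rate (u t)) \<le> L * (T + real CARD('k) * integral {0..T} (\<lambda>t. norm (u t)))"
proof -
  have "(\<lambda>t. \<bar>u t $ i\<bar>) absolutely_integrable_on {0..T}" for i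
    using absolutely_integrable_norm[OF absolutely_integrable_component[OF u, of "axis i 1"]]
    by (simp add: o_def inner_axis)
  then have "(\<lambda>t. l1_norm (u t)) absolutely_integrable_on {0..T}"
    unfolding l1_norm_def by (intro absolutely_integrable_sum) auto
  then have "(\<lambda>t. 1 + l1_norm (u t)) absolutely_integrable_on {0..T}"
    by (intro set_integral_add(1)) auto
  then show r: "(\<lambda>t. rate (u t)) absolutely_integrable_on {0..T}"
    unfolding rate_def by (intro set_integrable_mult_right)
  have nu: "(\<lambda>t. norm (u t)) integrable_on {0..T}"
    using set_lebesgue_integral_eq_integral(1)[OF absolutely_integrable_norm[OF u]] by (simp add: o_def)
  then have i: "(\<lambda>t. 1 + real CARD('k) * norm (u t)) integrable_on {0..T}"
    by (intro integrable_add integrable_on_mult_right) auto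
  have "integral {0..T} (\<lambda>t. rate (u t)) \<le> integral {0..T} (\<lambda>t. L * (1 + real CARD('k) * norm (u t)))"
    by (intro integral_le set_lebesgue_integral_eq_integral(1)[OF r] integrable_on_mult_right i rate_le)
  also have "\<dots> = L * (T + real CARD('k) * integral {0..T} (\<lambda>t. norm (u t)))"
    using nu T by (subst integral_mult_right, subst integral_add) (auto intro: integrable_on_mult_right)
  finally show "integral {0..T} (\<lambda>t. rate (u t)) \<le> L * (T + real CARD('k) * integral {0..T} (\<lambda>t. norm (u t)))" .
qed

lemma linear_growth:
  assumes u: "u absolutely_integrable_on {0..T}" and \<theta>: "\<theta> \<in> \<Theta>"
  shows "linear_growth_field T (\<lambda>t. field \<theta> (u t)) (\<lambda>t. rate (u t))"
proof
  have bl: "bounded_linear ((*v) (F v \<theta>))" for v by (rule matrix_vector_mul_bounded_linear)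
  have ai: "(\<lambda>t. field \<theta> (u t) v) absolutely_integrable_on {0..T}" for v
  proof -
    have "(\<lambda>t. F v \<theta> *v u t) absolutely_integrable_on {0..T}"
      using absolutely_integrable_linear[OF u bl] by (simp add: o_def)
    then show ?thesis unfolding field_def by (intro set_integral_add(1)) auto
  qed
  show "(\<lambda>t. field \<theta> (u t) v) \<in> borel_measurable (lebesgue_on {0..T})" for v
    by (rule absolutely_integrable_imp_borel_measurable[OF ai]) simp
  show "(\<lambda>t. field \<theta> (u t) 0) absolutely_integrable_on {0..T}" by (rule ai)
  show "norm (field \<theta> (u t) v - field \<theta> (u t) w) \<le> rate (u t) * norm (v - w)" for t v w
    using field_diff[OF \<theta> \<theta>, of "u t" v w] by simp
qed (use T rate_nonneg rate_integrable u in auto)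

abbreviation X :: "(real \<Rightarrow> real ^ 'k) \<Rightarrow> real ^ 'l \<Rightarrow> real \<Rightarrow> real ^ 'd" where
  "X u \<theta> t \<equiv> state F0 F x0 T u t \<theta>"

text \<open>The description in \<open>state\<close> denotes the value at \<open>t\<close> of the
  solution obtained from the fixed point, since any two solutions agree on \<open>{0..T}\<close>.
  From here on trajectories are handled only through the integral equation.\<close>

lemma state_integral_equation:
  assumes u: "u absolutely_integrable_on {0..T}" and \<theta>: "\<theta> \<in> \<Theta>"
  shows "continuous_on {0..T} (X u \<theta>)"
    and "\<And>t. t \<in> {0..T} \<Longrightarrow> X u \<theta> t = x0 \<theta> + integral {0..t} (\<lambda>s. field \<theta> (u s) (X u \<theta> s))"
proof -
  interpret linear_growth_field T "\<lambda>t. field \<theta> (u t)" "\<lambda>t. rate (u t)" by (rule linear_growth[OF u \<theta>])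
  have sol: "caratheodory_solution F0 F x0 T u \<theta> x \<longleftrightarrow>
     continuous_on {0..T} x \<and> (\<forall>t\<in>{0..T}. x t = x0 \<theta> + integral {0..t} (\<lambda>s. field \<theta> (u s) (x s)))" for x
  proof -
    have "caratheodory_solution F0 F x0 T u \<theta> x \<longleftrightarrow> x 0 = x0 \<theta> \<and>
       continuous_on {0..T} x \<and> (\<forall>t\<in>{0..T}. x t = x 0 + integral {0..t} (\<lambda>s. field \<theta> (u s) (x s)))"
      unfolding caratheodory_iff_integral_equation[symmetric] by (auto simp: caratheodory_solution_def field_def)
    also have "\<dots> \<longleftrightarrow> x 0 = x0 \<theta> \<and>
       continuous_on {0..T} x \<and> (\<forall>t\<in>{0..T}. x t = x0 \<theta> + integral {0..t} (\<lambda>s. field \<theta> (u s) (x s)))"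
      by (rule conj_cong[OF refl]) (simp only:)
    finally have iff: "caratheodory_solution F0 F x0 T u \<theta> x \<longleftrightarrow> x 0 = x0 \<theta> \<and>
       continuous_on {0..T} x \<and> (\<forall>t\<in>{0..T}. x t = x0 \<theta> + integral {0..t} (\<lambda>s. field \<theta> (u s) (x s)))" .
    have "x 0 = x0 \<theta>" if "\<forall>t\<in>{0..T}. x t = x0 \<theta> + integral {0..t} (\<lambda>s. field \<theta> (u s) (x s))"
      using bspec[OF that, of 0] T by simp
    then show ?thesis unfolding iff by blast
  qed
  obtain x where x: "continuous_on {0..T} x"
    "\<And>t. t \<in> {0..T} \<Longrightarrow> x t = x0 \<theta> + integral {0..t} (\<lambda>s. field \<theta> (u s) (x s))"
    using integral_equation_exists[of "x0 \<theta>"] by blast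
  have X: "X u \<theta> t = x t" if t: "t \<in> {0..T}" for t
    unfolding state_def
  proof (rule the_equality)
    show "\<exists>y. caratheodory_solution F0 F x0 T u \<theta> y \<and> y t = x t" using x by (intro exI[of _ x]) (simp add: sol)
    fix y assume "\<exists>z. caratheodory_solution F0 F x0 T u \<theta> z \<and> z t = y"
    then obtain z where z: "caratheodory_solution F0 F x0 T u \<theta> z" "z t = y" by blast
    then have "z t = x t" using x unfolding sol by (intro integral_equation_unique[of z "x0 \<theta>" x t] t) auto
    then show "y = x t" using z by simp
  qed
  show "continuous_on {0..T} (X u \<theta>)"
    using x(1) X by (subst continuous_on_cong[OF refl, of _ _ x]) auto
  show "X u \<theta> t = x0 \<theta> + integral {0..t} (\<lambda>s. field \<theta> (u s) (X u \<theta> s))" if t: "t \<in> {0..T}" for t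
  proof -
    have "integral {0..t} (\<lambda>s. field \<theta> (u s) (X u \<theta> s)) = integral {0..t} (\<lambda>s. field \<theta> (u s) (x s))"
      using X t by (intro Henstock_Kurzweil_Integration.integral_cong) simp
    then show ?thesis using x(2)[OF t] X[OF t] by simp
  qed
qed

lemma field_state_integrable:
  assumes "u absolutely_integrable_on {0..T}" "\<theta> \<in> \<Theta>" "continuous_on {0..T} y" "t \<in> {0..T}"
  shows "(\<lambda>s. field \<theta> (u s) (y s)) integrable_on {0..t}"
proof -
  interpret linear_growth_field T "\<lambda>t. field \<theta> (u t)" "\<lambda>t. rate (u t)" by (rule linear_growth[OF assms(1,2)])
  show ?thesis by (rule field_integrable[OF assms(3,4)])
qed

end

context control_system
begin

text \<open>Needed so that the maximum in the cost is attained. The factor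
  \<open>norm (x1 + x2)\<close> in the hypothesis is at most the distance of the two trajectories
  plus \<open>2 * R\<close>, where \<open>R\<close> bounds the fixed one. With the diameter-type
  bound \<open>D\<close> on \<open>\<Theta>\<close> the first part joins the Gronwall kernel, giving
  \<open>1 + D\<close>, and the second is a forcing term proportional to
  \<open>norm (\<theta>' - \<theta>)\<close>.\<close>

lemma state_continuous_on_parameters:
  assumes u: "u absolutely_integrable_on {0..T}"
  shows "continuous_on \<Theta> (\<lambda>\<theta>. X u \<theta> T)"
  unfolding continuous_on_def
proof
  fix \<theta> assume \<theta>: "\<theta> \<in> \<Theta>"
  obtain D where D: "\<And>\<theta>'. \<theta>' \<in> \<Theta> \<Longrightarrow> norm (\<theta>' - \<theta>) \<le> D"
    using compact_imp_bounded[OF compact_Theta] by (metis bounded_any_center dist_norm norm_minus_commute)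
  have D0: "0 \<le> D" using D[OF \<theta>] by simp
  obtain R where R: "0 \<le> R" "\<And>s. s \<in> {0..T} \<Longrightarrow> norm (X u \<theta> s) \<le> R"
    using continuous_on_interval_bound[OF state_integral_equation(1)[OF u \<theta>]] by blast
  let ?r = "\<lambda>s. rate (u s)"
  let ?h = "\<lambda>s. (1 + D) * ?r s"
  have r: "?r absolutely_integrable_on {0..T}" by (rule rate_integrable[OF u])
  then have ri: "?r integrable_on {0..T}" by (rule set_lebesgue_integral_eq_integral(1))
  have h: "?h absolutely_integrable_on {0..T}" using r by (rule set_integrable_mult_right)
  have bound: "norm (X u \<theta>' T - X u \<theta> T) \<le>
     2 * (norm (x0 \<theta>' - x0 \<theta>) + 2 * R * norm (\<theta>' - \<theta>) * integral {0..T} ?r) * exp (2 * integral {0..T} ?h)"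
    if \<theta>': "\<theta>' \<in> \<Theta>" for \<theta>'
  proof (rule gronwall[OF h, where \<phi> = "\<lambda>t. norm (X u \<theta>' t - X u \<theta> t)"])
    show "0 \<le> ?h t" for t using D0 rate_nonneg by simp
    have c: "continuous_on {0..T} (X u \<theta>)" "continuous_on {0..T} (X u \<theta>')"
      using state_integral_equation(1)[OF u] \<theta> \<theta>' by auto
    show cn: "continuous_on {0..T} (\<lambda>t. norm (X u \<theta>' t - X u \<theta> t))" by (intro continuous_intros c)
    have r0: "0 \<le> integral {0..T} ?r" using ri rate_nonneg by (intro integral_nonneg) auto
    show "0 \<le> norm (x0 \<theta>' - x0 \<theta>) + 2 * R * norm (\<theta>' - \<theta>) * integral {0..T} ?r" using R r0 by simp
    show "T \<in> {0..T}" using T by simp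
    fix t assume t: "t \<in> {0..T}"
    let ?e = "\<lambda>s. field \<theta>' (u s) (X u \<theta>' s) - field \<theta> (u s) (X u \<theta> s)"
    have hi: "(\<lambda>s. ?h s * norm (X u \<theta>' s - X u \<theta> s)) integrable_on {0..t}"
    proof (rule integrable_on_subinterval)
      show "(\<lambda>s. ?h s * norm (X u \<theta>' s - X u \<theta> s)) integrable_on {0..T}"
        using set_lebesgue_integral_eq_integral(1)[OF absolutely_integrable_scaleR_continuous[OF h cn]] by simp
    qed (use t in auto)
    have rt: "?r integrable_on {0..t}" by (rule integrable_on_subinterval[OF ri]) (use t in auto)
    have "X u \<theta>' t - X u \<theta> t = (x0 \<theta>' - x0 \<theta>) + integral {0..t} ?e"
      using state_integral_equation(2)[OF u \<theta> t] state_integral_equation(2)[OF u \<theta>' t] t c u \<theta> \<theta>'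
      by (subst integral_diff) (auto intro!: field_state_integrable)
    then have "norm (X u \<theta>' t - X u \<theta> t) \<le> norm (x0 \<theta>' - x0 \<theta>) + norm (integral {0..t} ?e)"
      by (simp add: norm_triangle_ineq)
    also have "norm (integral {0..t} ?e) \<le> integral {0..t} (\<lambda>s. 2 * R * norm (\<theta>' - \<theta>) * ?r s + ?h s * norm (X u \<theta>' s - X u \<theta> s))"
    proof (rule integral_norm_bound_integral)
      show "?e integrable_on {0..t}"
        by (intro integrable_diff field_state_integrable u \<theta> \<theta>' c t)
      show "(\<lambda>s. 2 * R * norm (\<theta>' - \<theta>) * ?r s + ?h s * norm (X u \<theta>' s - X u \<theta> s)) integrable_on {0..t}"
        by (intro integrable_add integrable_on_mult_right rt hi)
      fix s assume "s \<in> {0..t}"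
      then have s: "s \<in> {0..T}" using t by auto
      let ?d = "norm (X u \<theta>' s - X u \<theta> s)"
      have "norm (X u \<theta>' s + X u \<theta> s) \<le> ?d + 2 * R"
      proof -
        have "X u \<theta>' s + X u \<theta> s = (X u \<theta>' s - X u \<theta> s) + 2 *\<^sub>R X u \<theta> s" by (simp add: scaleR_2)
        then have "norm (X u \<theta>' s + X u \<theta> s) \<le> ?d + norm (2 *\<^sub>R X u \<theta> s)" by (metis norm_triangle_ineq)
        then show ?thesis using R(2)[OF s] by simp
      qed
      then have "norm (X u \<theta>' s + X u \<theta> s) * norm (\<theta>' - \<theta>) \<le> (?d + 2 * R) * norm (\<theta>' - \<theta>)"
        by (intro mult_right_mono) auto
      also have "\<dots> = ?d * norm (\<theta>' - \<theta>) + 2 * R * norm (\<theta>' - \<theta>)" by (simp add: algebra_simps)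
      also have "?d * norm (\<theta>' - \<theta>) \<le> ?d * D" using D[OF \<theta>'] by (intro mult_left_mono) auto
      finally have le: "?d + norm (X u \<theta>' s + X u \<theta> s) * norm (\<theta>' - \<theta>) \<le> (1 + D) * ?d + 2 * R * norm (\<theta>' - \<theta>)"
        by (simp add: algebra_simps)
      have "norm (?e s) \<le> ?r s * (?d + norm (X u \<theta>' s + X u \<theta> s) * norm (\<theta>' - \<theta>))"
        by (rule field_diff[OF \<theta>' \<theta>])
      also have "\<dots> \<le> ?r s * ((1 + D) * ?d + 2 * R * norm (\<theta>' - \<theta>))"
        by (rule mult_left_mono[OF le rate_nonneg])
      finally show "norm (?e s) \<le> 2 * R * norm (\<theta>' - \<theta>) * ?r s + ?h s * ?d"
        by (simp add: algebra_simps)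
    qed
    also have "\<dots> = 2 * R * norm (\<theta>' - \<theta>) * integral {0..t} ?r + integral {0..t} (\<lambda>s. ?h s * norm (X u \<theta>' s - X u \<theta> s))"
      by (subst integral_add) (auto intro: integrable_on_mult_right rt hi)
    also have "integral {0..t} ?r \<le> integral {0..T} ?r"
      by (rule integral_subset_le) (use t rt ri rate_nonneg in auto)
    finally show "norm (X u \<theta>' t - X u \<theta> t) \<le>
       (norm (x0 \<theta>' - x0 \<theta>) + 2 * R * norm (\<theta>' - \<theta>) * integral {0..T} ?r) + integral {0..t} (\<lambda>s. ?h s * norm (X u \<theta>' s - X u \<theta> s))"
      using R(1) by (simp add: mult_left_mono)
  qed
  have "((\<lambda>\<theta>'. 2 * (norm (x0 \<theta>' - x0 \<theta>) + 2 * R * norm (\<theta>' - \<theta>) * integral {0..T} ?r) * exp (2 * integral {0..T} ?h))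
     \<longlongrightarrow> 2 * (norm (x0 \<theta> - x0 \<theta>) + 2 * R * norm (\<theta> - \<theta>) * integral {0..T} ?r) * exp (2 * integral {0..T} ?h)) (at \<theta> within \<Theta>)"
    using x0 \<theta> by (intro tendsto_intros) (simp add: continuous_on_def)
  then have "((\<lambda>\<theta>'. 2 * (norm (x0 \<theta>' - x0 \<theta>) + 2 * R * norm (\<theta>' - \<theta>) * integral {0..T} ?r) * exp (2 * integral {0..T} ?h))
     \<longlongrightarrow> 0) (at \<theta> within \<Theta>)" by simp
  then have "((\<lambda>\<theta>'. X u \<theta>' T - X u \<theta> T) \<longlongrightarrow> 0) (at \<theta> within \<Theta>)"
    by (rule Lim_null_comparison[rotated]) (use bound in \<open>simp add: eventually_at_filter\<close>)
  then show "((\<lambda>\<theta>'. X u \<theta>' T) \<longlongrightarrow> X u \<theta> T) (at \<theta> within \<Theta>)"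
    by (simp add: LIM_zero_iff)
qed

text \<open>The field with the new control along the limit trajectory is inserted between the two
  fields. The difference in the state is absorbed by Gronwall's inequality; the difference in the
  control is \<open>F\<close> along the limit trajectory applied to \<open>un n - u\<close>, a
  coefficient that does not depend on \<open>n\<close>, so its integral tends to 0 uniformly in
  time.\<close>

lemma state_tendsto:
  assumes u: "u absolutely_integrable_on {0..T}" and un: "\<And>n. un n absolutely_integrable_on {0..T}"
    and \<theta>: "\<theta> \<in> \<Theta>" and B: "\<And>n. integral {0..T} (\<lambda>s. norm (un n s)) \<le> B"
    and \<delta>: "\<And>n t. t \<in> {0..T} \<Longrightarrow> norm (integral {0..t} (un n) - integral {0..t} u) \<le> \<delta> n" "\<delta> \<longlonglongrightarrow> 0"
  shows "(\<lambda>n. X (un n) \<theta> T) \<longlonglongrightarrow> X u \<theta> T"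
proof -
  let ?Y = "\<lambda>s. F (X u \<theta> s) \<theta>"
  have Xc: "continuous_on {0..T} (X u \<theta>)" by (rule state_integral_equation(1)[OF u \<theta>])
  have Y: "continuous_on {0..T} ?Y"
    by (rule continuous_on_compose2[OF matrix_continuous[OF \<theta>] Xc]) simp
  have w: "(\<lambda>s. un n s - u s) absolutely_integrable_on {0..T}" for n
    using un u by (rule set_integral_diff(1))
  have int: "q integrable_on {0..t}" if "q absolutely_integrable_on {0..T}" "t \<in> {0..T}" for q :: "real \<Rightarrow> 'e::euclidean_space" and t
    by (rule integrable_on_subinterval[OF set_lebesgue_integral_eq_integral(1)[OF that(1)]]) (use that in auto)
  have nT: "(\<lambda>s. norm (q s)) integrable_on {0..T}" if "q absolutely_integrable_on {0..T}" for q :: "real \<Rightarrow> 'e::euclidean_space"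
    using set_lebesgue_integral_eq_integral(1)[OF absolutely_integrable_norm[OF that]] by (simp add: o_def)
  obtain E where E: "E \<longlonglongrightarrow> 0" "\<And>n t. t \<in> {0..T} \<Longrightarrow> norm (integral {0..t} (\<lambda>s. ?Y s *v (un n s - u s))) \<le> E n"
  proof (rule integral_bilinear_continuous_tendsto[OF bilinear_matrix_vector_mult Y T w])
    show "integral {0..T} (\<lambda>s. norm (un n s - u s)) \<le> B + integral {0..T} (\<lambda>s. norm (u s))" for n
    proof -
      have "integral {0..T} (\<lambda>s. norm (un n s - u s)) \<le> integral {0..T} (\<lambda>s. norm (un n s) + norm (u s))"
        by (intro integral_le nT w integrable_add un u norm_triangle_ineq4)
      also have "\<dots> = integral {0..T} (\<lambda>s. norm (un n s)) + integral {0..T} (\<lambda>s. norm (u s))"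
        by (intro integral_add nT un u)
      finally show ?thesis using B[of n] by simp
    qed
    show "norm (integral {0..t} (\<lambda>s. un n s - u s)) \<le> \<delta> n" if "t \<in> {0..T}" for n t
      using \<delta>(1)[OF that, of n] by (subst integral_diff) (auto intro: int un u that)
  qed (use \<delta>(2) in auto)
  have E0: "0 \<le> E n" for n using E(2)[of 0 n] T by simp
  \<comment> \<open>The Gronwall factor contains the rate of \<open>un n\<close>, which varies with
    \<open>n\<close>; the uniform bound \<open>B\<close> in L1 makes one constant serve for all
    \<open>n\<close>.\<close>
  define C where "C = exp (2 * (L * (T + real CARD('k) * B)))"
  have bound: "norm (X (un n) \<theta> T - X u \<theta> T) \<le> 2 * E n * C" for n
  proof -
    let ?r = "\<lambda>s. rate (un n s)"
    have r: "?r absolutely_integrable_on {0..T}" by (rule rate_integrable[OF un])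
    have c: "continuous_on {0..T} (X (un n) \<theta>)" by (rule state_integral_equation(1)[OF un \<theta>])
    have cn: "continuous_on {0..T} (\<lambda>t. norm (X (un n) \<theta> t - X u \<theta> t))" by (intro continuous_intros c Xc)
    have "norm (X (un n) \<theta> T - X u \<theta> T) \<le> 2 * E n * exp (2 * integral {0..T} ?r)"
    proof (rule gronwall[OF r rate_nonneg cn _ E0])
      show "T \<in> {0..T}" using T by simp
      fix t assume t: "t \<in> {0..T}"
      let ?e = "\<lambda>s. field \<theta> (un n s) (X (un n) \<theta> s) - field \<theta> (un n s) (X u \<theta> s)"
      let ?g = "\<lambda>s. ?Y s *v (un n s - u s)"
      have g: "?g s = field \<theta> (un n s) (X u \<theta> s) - field \<theta> (u s) (X u \<theta> s)" for s
        by (simp add: field_def matrix_vector_mult_diff_distrib)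
      have ei: "?e integrable_on {0..t}" by (intro integrable_diff field_state_integrable un \<theta> c Xc t)
      have gi: "?g integrable_on {0..t}" unfolding g by (intro integrable_diff field_state_integrable un u \<theta> Xc t)
      have "X (un n) \<theta> t - X u \<theta> t = integral {0..t} (\<lambda>s. field \<theta> (un n s) (X (un n) \<theta> s)) - integral {0..t} (\<lambda>s. field \<theta> (u s) (X u \<theta> s))"
        using state_integral_equation(2)[OF u \<theta> t] state_integral_equation(2)[OF un \<theta> t] by simp
      also have "\<dots> = integral {0..t} (\<lambda>s. field \<theta> (un n s) (X (un n) \<theta> s) - field \<theta> (u s) (X u \<theta> s))"
        by (intro integral_diff[symmetric] field_state_integrable un u \<theta> c Xc t)
      also have "\<dots> = integral {0..t} (\<lambda>s. ?e s + ?g s)" unfolding g by simp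
      also have "\<dots> = integral {0..t} ?e + integral {0..t} ?g" by (rule integral_add[OF ei gi])
      finally have eq: "X (un n) \<theta> t - X u \<theta> t = integral {0..t} ?e + integral {0..t} ?g" .
      have "norm (integral {0..t} ?e + integral {0..t} ?g) \<le> integral {0..t} (\<lambda>s. ?r s * norm (X (un n) \<theta> s - X u \<theta> s)) + E n"
      proof (rule norm_triangle_mono[OF _ E(2)[OF t]])
        show "norm (integral {0..t} ?e) \<le> integral {0..t} (\<lambda>s. ?r s * norm (X (un n) \<theta> s - X u \<theta> s))"
        proof (rule integral_norm_bound_integral[OF ei])
          show "(\<lambda>s. ?r s * norm (X (un n) \<theta> s - X u \<theta> s)) integrable_on {0..t}"
            using int[OF absolutely_integrable_scaleR_continuous[OF r cn] t] by simp
          show "norm (?e s) \<le> ?r s * norm (X (un n) \<theta> s - X u \<theta> s)" for s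
            using field_diff[OF \<theta> \<theta>, of "un n s"] by simp
        qed
      qed
      then show "norm (X (un n) \<theta> t - X u \<theta> t) \<le> E n + integral {0..t} (\<lambda>s. ?r s * norm (X (un n) \<theta> s - X u \<theta> s))"
        unfolding eq by (rule order_trans[OF _ eq_refl[OF add.commute]])
    qed
    also have "\<dots> \<le> 2 * E n * C"
    proof -
      have "integral {0..T} ?r \<le> L * (T + real CARD('k) * integral {0..T} (\<lambda>s. norm (un n s)))"
        by (rule rate_integrable(2)[OF un])
      also have "\<dots> \<le> L * (T + real CARD('k) * B)"
        using B[of n] L by (intro mult_left_mono add_left_mono) auto
      finally show ?thesis using E0[of n] by (auto simp: C_def intro!: mult_left_mono)
    qed
    finally show ?thesis .
  qed
  have "(\<lambda>n. 2 * E n * C) \<longlonglongrightarrow> 2 * 0 * C" by (intro tendsto_intros E)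
  then have "(\<lambda>n. 2 * E n * C) \<longlonglongrightarrow> 0" by simp
  then have "(\<lambda>n. X (un n) \<theta> T - X u \<theta> T) \<longlonglongrightarrow> 0"
    by (rule Lim_null_comparison[rotated]) (use bound in simp)
  then show ?thesis by (simp add: LIM_zero_iff)
qed

end

section \<open>Convex coercive integral functionals\<close>

text \<open>The positive part of \<open>g\<close> plus \<open>c\<close> equals \<open>g + c\<close>
  plus the negative part of \<open>g\<close>. Integrating this sum of nonnegative functions avoids
  subtraction in \<open>ennreal\<close>; the difference may be taken afterwards because the negative
  part is dominated by \<open>c\<close> and has a finite integral.\<close>

lemma ext_integral_eq_shifted:
  assumes g: "g \<in> borel_measurable M" and c: "integrable M c" "AE t in M. 0 \<le> c t"
    and ge: "AE t in M. - c t \<le> g t"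
  shows "ext_integral M g = enn2ereal (\<integral>\<^sup>+t. ennreal (g t + c t) \<partial>M) - ereal (\<integral>t. c t \<partial>M)"
proof -
  note [measurable] = g borel_measurable_integrable[OF c(1)]
  define P N I where "P = (\<integral>\<^sup>+t. ennreal (g t) \<partial>M)" and "N = (\<integral>\<^sup>+t. ennreal (- g t) \<partial>M)"
    and "I = (\<integral>\<^sup>+t. ennreal (g t + c t) \<partial>M)"
  define r where "r = (\<integral>t. c t \<partial>M)"
  have r: "(\<integral>\<^sup>+t. ennreal (c t) \<partial>M) = ennreal r" "0 \<le> r"
    unfolding r_def using c by (auto intro: nn_integral_eq_integral integral_nonneg_AE)
  have "P + ennreal r = (\<integral>\<^sup>+t. ennreal (g t) + ennreal (c t) \<partial>M)"
    unfolding P_def r(1)[symmetric] by (rule nn_integral_add[symmetric]) measurable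
  also have "\<dots> = (\<integral>\<^sup>+t. ennreal (g t + c t) + ennreal (- g t) \<partial>M)"
  proof (rule nn_integral_cong_AE, use c(2) ge in eventually_elim)
    case (elim t)
    then show ?case
      by (cases "0 \<le> g t") (simp_all add: ennreal_neg flip: ennreal_plus)
  qed
  also have "\<dots> = I + N"
    unfolding I_def N_def by (rule nn_integral_add) measurable
  finally have eq: "P + ennreal r = I + N" .
  have "N \<le> (\<integral>\<^sup>+t. ennreal (c t) \<partial>M)"
    unfolding N_def by (rule nn_integral_mono_AE, use ge in eventually_elim) (auto intro: ennreal_leI)
  then have "N < top" using r(1) by (auto intro: le_less_trans)
  then obtain s where s: "N = ennreal s" "0 \<le> s" by (cases N) auto
  have "ereal s = enn2ereal N" "ereal r = enn2ereal (ennreal r)" using s r by (simp_all add: enn2ereal_ennreal)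
  moreover have "enn2ereal P + enn2ereal (ennreal r) = enn2ereal I + enn2ereal N"
    using arg_cong[OF eq, of enn2ereal] by (simp add: plus_ennreal.rep_eq)
  ultimately have "enn2ereal P + ereal r = enn2ereal I + ereal s" by simp
  then have "enn2ereal P - ereal s = enn2ereal I - ereal r"
    by (cases "enn2ereal P"; cases "enn2ereal I") auto
  then show ?thesis
    unfolding ext_integral_def P_def[symmetric] N_def[symmetric] I_def[symmetric] r_def[symmetric]
    using s by (simp add: enn2ereal_ennreal)
qed

section \<open>Lp controls and sublevel sets of the integral cost\<close>

lemma Lp_space_integrable:
  assumes p: "1 \<le> p" and v: "v \<in> Lp_space p T"
  shows "integrable (lebesgue_on {0..T}) v" "v absolutely_integrable_on {0..T}"
proof -
  interpret finite_measure "lebesgue_on {0..T}" by (rule finite_measure_lebesgue_on) simp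
  have v': "v \<in> borel_measurable (lebesgue_on {0..T})" "integrable (lebesgue_on {0..T}) (\<lambda>t. norm (v t) powr p)"
    using v by (auto simp: Lp_space_def)
  show i: "integrable (lebesgue_on {0..T}) v"
  proof (rule Bochner_Integration.integrable_bound)
    show "integrable (lebesgue_on {0..T}) (\<lambda>t. 1 + norm (v t) powr p)" using v'(2) by simp
    show "AE t in lebesgue_on {0..T}. norm (v t) \<le> norm (1 + norm (v t) powr p)"
      using le_add_powr_tail[of 1 "norm (v t)" p for t] p by (intro AE_I2) simp
  qed (rule v')
  then show "v absolutely_integrable_on {0..T}"
    by (simp add: absolutely_integrable_measurable v' o_def)
qed

lemma Lp_space_midpoint:
  assumes p: "1 \<le> p" and v: "v \<in> Lp_space p T" and w: "w \<in> Lp_space p T"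
  shows "(\<lambda>t. (1/2) *\<^sub>R (v t + w t)) \<in> Lp_space p T"
proof -
  have m[measurable]: "v \<in> borel_measurable (lebesgue_on {0..T})" "w \<in> borel_measurable (lebesgue_on {0..T})"
    using v w by (auto simp: Lp_space_def)
  have "integrable (lebesgue_on {0..T}) (\<lambda>t. norm ((1/2) *\<^sub>R (v t + w t)) powr p)"
  proof (rule Bochner_Integration.integrable_bound)
    show "integrable (lebesgue_on {0..T}) (\<lambda>t. norm (v t) powr p + norm (w t) powr p)"
      using v w by (auto simp: Lp_space_def)
    show "AE t in lebesgue_on {0..T}. norm (norm ((1/2) *\<^sub>R (v t + w t)) powr p) \<le> norm (norm (v t) powr p + norm (w t) powr p)"
    proof (rule AE_I2)
      fix t
      have "norm ((1/2) *\<^sub>R (v t + w t)) \<le> max (norm (v t)) (norm (w t))"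
        using norm_triangle_ineq[of "v t" "w t"] by simp
      then have "norm ((1/2) *\<^sub>R (v t + w t)) powr p \<le> max (norm (v t)) (norm (w t)) powr p"
        using p by (intro powr_mono2) auto
      also have "\<dots> \<le> norm (v t) powr p + norm (w t) powr p" by (auto simp: max_def)
      finally show "norm (norm ((1/2) *\<^sub>R (v t + w t)) powr p) \<le> norm (norm (v t) powr p + norm (w t) powr p)" by simp
    qed
  qed measurable
  then show ?thesis unfolding Lp_space_def by simp
qed

locale coercive_integrand =
  fixes p T C :: real and f :: "real \<Rightarrow> real ^ 'k \<Rightarrow> real" and c :: "real \<Rightarrow> real"
  assumes p: "1 < p" and C: "0 < C"
    and f_meas: "\<And>v. (\<lambda>t. f t v) \<in> borel_measurable (lebesgue_on {0..T})"
    and f_convex: "AE t in lebesgue_on {0..T}. continuous_on UNIV (f t) \<and> convex_on UNIV (f t)"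
    and c_int: "integrable (lebesgue_on {0..T}) c"
    and f_ge: "AE t in lebesgue_on {0..T}. \<forall>v. C * norm v powr p - c t \<le> f t v"
begin

abbreviation "M \<equiv> lebesgue_on {0..T}"

text \<open>By coercivity \<open>f t v + c t\<close> is nonnegative for almost every
  \<open>t\<close>, so no truncation takes place in \<open>ennreal\<close> and the value differs
  from the integral cost by the constant integral of \<open>c\<close>.\<close>

definition shifted_integral :: "(real \<Rightarrow> real ^ 'k) \<Rightarrow> ennreal" where
  "shifted_integral v = (\<integral>\<^sup>+t. ennreal (f t (v t) + c t) \<partial>M)"

lemma integrand_measurable:
  assumes "v \<in> borel_measurable M"
  shows "(\<lambda>t. f t (v t)) \<in> borel_measurable M"
proof (rule caratheodory_measurable[OF _ f_meas _ assms])
  show "AE t in M. continuous_on UNIV (f t)" using f_convex by eventually_elim simp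
qed simp

lemma shifted_measurable:
  assumes "v \<in> borel_measurable M"
  shows "(\<lambda>t. ennreal (f t (v t) + c t)) \<in> borel_measurable M"
  using integrand_measurable[OF assms] borel_measurable_integrable[OF c_int] by measurable

text \<open>Midpoint convexity of the sublevel sets is all that the selection of a Cauchy sequence
  asks for.\<close>

lemma shifted_integral_midpoint:
  assumes v: "v \<in> borel_measurable M" "shifted_integral v \<le> ennreal b"
    and w: "w \<in> borel_measurable M" "shifted_integral w \<le> ennreal b" and b: "0 \<le> b"
  shows "shifted_integral (\<lambda>t. (1/2) *\<^sub>R (v t + w t)) \<le> ennreal b"
proof -
  have "shifted_integral (\<lambda>t. (1/2) *\<^sub>R (v t + w t))
    \<le> (\<integral>\<^sup>+t. ennreal (1/2) * (ennreal (f t (v t) + c t) + ennreal (f t (w t) + c t)) \<partial>M)"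
    unfolding shifted_integral_def
  proof (rule nn_integral_mono_AE, use f_convex f_ge in eventually_elim)
    case (elim t)
    have nn: "0 \<le> f t y + c t" for y
    proof -
      have "0 \<le> C * norm y powr p" using C by simp
      then show ?thesis using elim(2)[rule_format, of y] by linarith
    qed
    have "f t ((1 - 1/2) *\<^sub>R v t + (1/2) *\<^sub>R w t) \<le> (1 - 1/2) * f t (v t) + (1/2) * f t (w t)"
      using elim(1) by (intro convex_onD[of UNIV]) auto
    then have "f t ((1/2) *\<^sub>R (v t + w t)) + c t \<le> (1/2) * ((f t (v t) + c t) + (f t (w t) + c t))"
      by (simp add: scaleR_add_right field_simps)
    then have "ennreal (f t ((1/2) *\<^sub>R (v t + w t)) + c t) \<le> ennreal ((1/2) * ((f t (v t) + c t) + (f t (w t) + c t)))"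
      by (rule ennreal_leI)
    also have "\<dots> = ennreal (1/2) * (ennreal (f t (v t) + c t) + ennreal (f t (w t) + c t))"
      unfolding ennreal_plus[OF nn nn, symmetric] by (rule ennreal_mult) (use nn[of "v t"] nn[of "w t"] in auto)
    finally show ?case .
  qed
  also have "\<dots> = ennreal (1/2) * (shifted_integral v + shifted_integral w)"
    unfolding shifted_integral_def using shifted_measurable v w
    by (subst nn_integral_cmult, measurable, subst nn_integral_add) auto
  also have "\<dots> \<le> ennreal (1/2) * (ennreal b + ennreal b)"
    using v w by (intro mult_left_mono add_mono) auto
  also have "\<dots> = ennreal b"
    unfolding ennreal_plus[OF b b, symmetric] by (subst ennreal_mult[symmetric]) (use b in auto)
  finally show ?thesis .
qed

lemma shifted_integral_coercive:
  assumes v: "v \<in> borel_measurable M" "shifted_integral v \<le> ennreal b" and b: "0 \<le> b"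
  shows "integrable M (\<lambda>t. norm (v t) powr p)" "(\<integral>t. norm (v t) powr p \<partial>M) \<le> b / C"
proof -
  note [measurable] = v(1)
  have "ennreal C * (\<integral>\<^sup>+t. ennreal (norm (v t) powr p) \<partial>M) = (\<integral>\<^sup>+t. ennreal C * ennreal (norm (v t) powr p) \<partial>M)"
    by (rule nn_integral_cmult[symmetric]) measurable
  also have "\<dots> \<le> shifted_integral v"
    unfolding shifted_integral_def
  proof (rule nn_integral_mono_AE, use f_ge in eventually_elim)
    case (elim t)
    then have "C * norm (v t) powr p \<le> f t (v t) + c t" by (simp add: algebra_simps)
    then show ?case using C by (simp add: ennreal_leI flip: ennreal_mult)
  qed
  finally have le: "ennreal C * (\<integral>\<^sup>+t. ennreal (norm (v t) powr p) \<partial>M) \<le> ennreal b"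
    using v(2) by (rule order_trans)
  then have fin: "(\<integral>\<^sup>+t. ennreal (norm (v t) powr p) \<partial>M) < \<infinity>"
    using C by (cases "(\<integral>\<^sup>+t. ennreal (norm (v t) powr p) \<partial>M)") (auto simp: ennreal_mult_top top_unique)
  then show i: "integrable M (\<lambda>t. norm (v t) powr p)"
    by (intro integrableI_bounded) auto
  then have "(\<integral>\<^sup>+t. ennreal (norm (v t) powr p) \<partial>M) = ennreal (\<integral>t. norm (v t) powr p \<partial>M)"
    by (intro nn_integral_eq_integral) auto
  then have "ennreal (C * (\<integral>t. norm (v t) powr p \<partial>M)) \<le> ennreal b"
    using le C by (simp add: ennreal_mult)
  then have "C * (\<integral>t. norm (v t) powr p \<partial>M) \<le> b" using b by (subst (asm) ennreal_le_iff) auto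
  then show "(\<integral>t. norm (v t) powr p \<partial>M) \<le> b / C" using C by (simp add: field_simps)
qed

lemma shifted_integral_lsc:
  assumes v: "\<And>k. v k \<in> borel_measurable M" and lim: "AE t in M. (\<lambda>k. v k t) \<longlonglongrightarrow> u t"
    and le: "\<And>k. shifted_integral (v k) \<le> ennreal (b k)" and b: "b \<longlonglongrightarrow> \<beta>"
  shows "shifted_integral u \<le> ennreal \<beta>"
proof -
  have "shifted_integral u = (\<integral>\<^sup>+t. liminf (\<lambda>k. ennreal (f t (v k t) + c t)) \<partial>M)"
    unfolding shifted_integral_def
  proof (rule nn_integral_cong_AE, use f_convex lim in eventually_elim)
    case (elim t)
    then have "isCont (f t) (u t)" by (simp add: continuous_on_eq_continuous_at)
    then have "(\<lambda>k. f t (v k t)) \<longlonglongrightarrow> f t (u t)" using elim(2) by (rule isCont_tendsto_compose)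
    then have "(\<lambda>k. ennreal (f t (v k t) + c t)) \<longlonglongrightarrow> ennreal (f t (u t) + c t)" by (intro tendsto_intros)
    then show ?case by (rule lim_imp_Liminf[OF trivial_limit_sequentially, symmetric])
  qed
  also have "\<dots> \<le> liminf (\<lambda>k. \<integral>\<^sup>+t. ennreal (f t (v k t) + c t) \<partial>M)"
    by (rule nn_integral_liminf) (rule shifted_measurable[OF v])
  also have "\<dots> \<le> liminf (\<lambda>k. ennreal (b k))"
    using le by (intro Liminf_mono) (simp add: shifted_integral_def)
  also have "\<dots> = ennreal \<beta>"
    using b by (intro lim_imp_Liminf tendsto_intros) auto
  finally show ?thesis .
qed

text \<open>Strong limits of midpoint combinations have the same primitive as the original sequence, so
  the Cauchy selection supplies the weak limit, for which the convex functional is controlled.\<close>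

lemma weak_limit_exists:
  fixes U :: "real \<Rightarrow> real ^ 'k"
  assumes z: "\<And>n. z n \<in> Lp_space p T" and \<beta>: "0 \<le> \<beta>"
    and U: "\<And>n t. t \<in> {0..T} \<Longrightarrow> norm (integral {0..t} (z n) - U t) \<le> inverse (real (Suc n))"
    and le: "\<And>n. shifted_integral (z n) \<le> ennreal (\<beta> + inverse (real (Suc n)))"
  obtains u where "u \<in> Lp_space p T" "shifted_integral u \<le> ennreal \<beta>"
    "\<And>t. t \<in> {0..T} \<Longrightarrow> integral {0..t} u = U t"
proof -
  have p1: "1 \<le> p" using p by simp
  \<comment> \<open>Each of the three conditions survives midpoints, the tolerances decrease with
    \<open>n\<close>, and \<open>z n\<close> is a member, which are the requirements of the Cauchy
    selection.\<close>
  define K where "K n = {v \<in> Lp_space p T. shifted_integral v \<le> ennreal (\<beta> + inverse (real (Suc n))) \<and>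
     (\<forall>t\<in>{0..T}. norm (integral {0..t} v - U t) \<le> inverse (real (Suc n)))}" for n
  have KL: "v \<in> borel_measurable M" "v absolutely_integrable_on {0..T}" "integrable M v" "v \<in> Lp_space p T"
    if v: "v \<in> K n" for v n
  proof -
    show L: "v \<in> Lp_space p T" using v by (simp add: K_def)
    then show "v \<in> borel_measurable M" by (simp add: Lp_space_def)
    show "v absolutely_integrable_on {0..T}" "integrable M v" by (rule Lp_space_integrable[OF p1 L])+
  qed
  have Kdec: "K n \<subseteq> K m" if "m \<le> n" for m n
  proof -
    have i: "inverse (real (Suc n)) \<le> inverse (real (Suc m))" using that by (intro le_imp_inverse_le) auto
    then have "ennreal (\<beta> + inverse (real (Suc n))) \<le> ennreal (\<beta> + inverse (real (Suc m)))"
      by (intro ennreal_leI) auto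
    then show ?thesis unfolding K_def using i by (blast intro: order_trans)
  qed
  have int: "q integrable_on {0..t}" if "q absolutely_integrable_on {0..T}" "t \<in> {0..T}" for q :: "real \<Rightarrow> 'e::euclidean_space" and t
    by (rule integrable_on_subinterval[OF set_lebesgue_integral_eq_integral(1)[OF that(1)]]) (use that in auto)
  obtain v where v: "\<And>n. v n \<in> K n"
    "\<And>e. e > 0 \<Longrightarrow> \<exists>N. \<forall>n\<ge>N. \<forall>m\<ge>n. (\<integral>t. norm (v n t - v m t) \<partial>M) < e"
  proof (rule midpoint_convex_Cauchy_selection[of M p K "(\<beta> + 1) / C"])
    show "finite_measure M" by (rule finite_measure_lebesgue_on) simp
    show "K n \<noteq> {}" for n
    proof -
      have "z n \<in> K n" unfolding K_def by (intro CollectI conjI ballI z le U)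
      then show ?thesis by blast
    qed
    show "K n \<subseteq> K m" if "m \<le> n" for m n by (rule Kdec[OF that])
    show "(\<lambda>t. (1/2) *\<^sub>R (v t + w t)) \<in> K n" if v: "v \<in> K n" and w: "w \<in> K n" for n v w
    proof -
      have "norm (integral {0..t} (\<lambda>s. (1/2) *\<^sub>R (v s + w s)) - U t) \<le> inverse (real (Suc n))" if t: "t \<in> {0..T}" for t
      proof -
        have "integral {0..t} (\<lambda>s. (1/2) *\<^sub>R (v s + w s)) = (1/2) *\<^sub>R (integral {0..t} v + integral {0..t} w)"
          by (simp only: integral_cmul integral_add[OF int[OF KL(2)[OF v] t] int[OF KL(2)[OF w] t]])
        then have "integral {0..t} (\<lambda>s. (1/2) *\<^sub>R (v s + w s)) - U t
           = (1/2) *\<^sub>R ((integral {0..t} v - U t) + (integral {0..t} w - U t))"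
          by (simp add: scaleR_add_right scaleR_diff_right flip: scaleR_add_left)
        then have "norm (integral {0..t} (\<lambda>s. (1/2) *\<^sub>R (v s + w s)) - U t)
           \<le> (norm (integral {0..t} v - U t) + norm (integral {0..t} w - U t)) / 2"
          using norm_triangle_ineq[of "integral {0..t} v - U t" "integral {0..t} w - U t"] by simp
        also have "\<dots> \<le> (inverse (real (Suc n)) + inverse (real (Suc n))) / 2"
        proof -
          have "norm (integral {0..t} v - U t) \<le> inverse (real (Suc n))"
            "norm (integral {0..t} w - U t) \<le> inverse (real (Suc n))"
            using v w t unfolding K_def by blast+
          then show ?thesis by (intro divide_right_mono add_mono) simp_all
        qed
        finally show ?thesis by simp
      qed
      moreover have "shifted_integral (\<lambda>t. (1/2) *\<^sub>R (v t + w t)) \<le> ennreal (\<beta> + inverse (real (Suc n)))"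
        using \<beta> by (intro shifted_integral_midpoint KL(1)[OF v] KL(1)[OF w]) (use v w in \<open>auto simp: K_def\<close>)
      ultimately show ?thesis
        unfolding K_def using Lp_space_midpoint[OF p1 KL(4)[OF v] KL(4)[OF w]] by blast
    qed
    fix v assume v: "v \<in> K 0"
    show "v \<in> borel_measurable M" by (rule KL(1)[OF v])
    have "shifted_integral v \<le> ennreal (\<beta> + 1)" using v by (simp add: K_def)
    from shifted_integral_coercive[OF KL(1)[OF v] this]
    show "integrable M (\<lambda>t. norm (v t) powr p)" "(\<integral>t. norm (v t) powr p \<partial>M) \<le> (\<beta> + 1) / C"
      using \<beta> by auto
  qed (use p in auto)
  obtain u r where r: "strict_mono (r :: nat \<Rightarrow> nat)" and u: "integrable M u"
    and lim: "AE t in M. (\<lambda>k. v (r k) t) \<longlonglongrightarrow> u t"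
    and L1: "(\<lambda>k. \<integral>t. norm (v (r k) t - u t) \<partial>M) \<longlonglongrightarrow> 0"
    using L1_Cauchy_imp_convergent_subseq[OF KL(3)[OF v(1)] v(2)] by blast
  \<comment> \<open>Because \<open>k \<le> r k\<close> and the sets decrease, the subsequence meets
    the constraints with its own index.\<close>
  have vr: "v (r k) \<in> K k" for k
    using v(1)[of "r k"] Kdec[OF seq_suble[OF r, of k]] by blast
  have um: "u \<in> borel_measurable M" by (rule borel_measurable_integrable[OF u])
  have "(\<lambda>k. \<beta> + inverse (real (Suc k))) \<longlonglongrightarrow> \<beta> + 0" by (intro tendsto_intros LIMSEQ_inverse_real_of_nat)
  then have b: "(\<lambda>k. \<beta> + inverse (real (Suc k))) \<longlonglongrightarrow> \<beta>" by simp
  have uI: "shifted_integral u \<le> ennreal \<beta>"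
    by (rule shifted_integral_lsc[OF KL(1)[OF vr] lim _ b]) (use vr in \<open>auto simp: K_def\<close>)
  \<comment> \<open>The convergence is only in L1; membership in Lp comes from coercivity, the
    shifted integral of \<open>u\<close> being finite.\<close>
  have uL: "u \<in> Lp_space p T"
    using um shifted_integral_coercive(1)[OF um uI \<beta>] by (simp add: Lp_space_def)
  have ua: "u absolutely_integrable_on {0..T}" using Lp_space_integrable(2)[OF p1 uL] .
  show thesis
  proof (rule that[OF uL uI])
    fix t assume t: "t \<in> {0..T}"
    have "norm (U t - integral {0..t} u) \<le> inverse (real (Suc k)) + (\<integral>t. norm (v (r k) t - u t) \<partial>M)" for k
    proof -
      have d: "(\<lambda>s. v (r k) s - u s) absolutely_integrable_on {0..T}"
        using KL(2)[OF vr] ua by (rule set_integral_diff(1))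
      have dn: "(\<lambda>s. norm (v (r k) s - u s)) absolutely_integrable_on {0..T}"
        using absolutely_integrable_norm[OF d] by (simp add: o_def)
      have "norm (integral {0..t} (v (r k)) - integral {0..t} u) = norm (integral {0..t} (\<lambda>s. v (r k) s - u s))"
        by (subst integral_diff) (auto intro: int KL(2)[OF vr] ua t)
      also have "\<dots> \<le> integral {0..t} (\<lambda>s. norm (v (r k) s - u s))"
        by (rule integral_norm_bound_integral[OF int[OF d t] int[OF dn t]]) simp
      also have "\<dots> \<le> integral {0..T} (\<lambda>s. norm (v (r k) s - u s))"
        using t by (intro integral_subset_le int[OF dn]) auto
      also have "\<dots> = (\<integral>t. norm (v (r k) t - u t) \<partial>M)"
        by (rule lebesgue_integral_eq_integral[symmetric]) (use KL(3)[OF vr] u in auto)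
      finally have "norm (integral {0..t} (v (r k)) - integral {0..t} u) \<le> (\<integral>t. norm (v (r k) t - u t) \<partial>M)" .
      moreover have "norm (integral {0..t} (v (r k)) - U t) \<le> inverse (real (Suc k))"
        using vr[of k] t unfolding K_def by blast
      ultimately show ?thesis
        using norm_triangle_ineq4[of "integral {0..t} (v (r k)) - integral {0..t} u" "integral {0..t} (v (r k)) - U t"] by simp
    qed
    moreover have "(\<lambda>k. inverse (real (Suc k)) + (\<integral>t. norm (v (r k) t - u t) \<partial>M)) \<longlonglongrightarrow> 0 + 0"
      by (intro tendsto_intros L1 LIMSEQ_inverse_real_of_nat)
    ultimately have "norm (U t - integral {0..t} u) \<le> 0 + 0" by (intro LIMSEQ_le_const) blast+
    then show "integral {0..t} u = U t" by simp
  qed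
qed

end

text \<open>The level \<open>R\<close> is free. Taken large for the last term, and then
  \<open>t - s\<close> taken small, it yields equicontinuity of the primitives; \<open>R = 1\<close>
  yields a bound in L1.\<close>

lemma Lp_space_integral_norm_le:
  assumes p: "1 \<le> p" and v: "v \<in> Lp_space p T" and R: "0 < R"
    and st: "s \<in> {0..T}" "t \<in> {0..T}" "s \<le> t"
  shows "integral {s..t} (\<lambda>r. norm (v r)) \<le> R * (t - s) + R powr (1 - p) * (\<integral>r. norm (v r) powr p \<partial>lebesgue_on {0..T})"
proof -
  have vp: "integrable (lebesgue_on {0..T}) (\<lambda>r. norm (v r) powr p)" using v by (simp add: Lp_space_def)
  have i1: "(\<lambda>r. norm (v r) powr p) integrable_on {0..T}" by (rule integrable_on_lebesgue_on[OF vp]) simp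
  have i1': "(\<lambda>r. norm (v r) powr p) integrable_on {s..t}"
    by (rule integrable_on_subinterval[OF i1]) (use st in auto)
  have "(\<lambda>r. norm (v r)) integrable_on {0..T}"
    using set_lebesgue_integral_eq_integral(1)[OF absolutely_integrable_norm[OF Lp_space_integrable(2)[OF p v]]]
    by (simp add: o_def)
  then have i2: "(\<lambda>r. norm (v r)) integrable_on {s..t}"
    by (rule integrable_on_subinterval) (use st in auto)
  have "integral {s..t} (\<lambda>r. norm (v r)) \<le> integral {s..t} (\<lambda>r. R + R powr (1 - p) * norm (v r) powr p)"
    by (intro integral_le i2 integrable_add integrable_on_mult_right i1' integrable_const_ivl le_add_powr_tail R p) simp
  also have "\<dots> = R * (t - s) + R powr (1 - p) * integral {s..t} (\<lambda>r. norm (v r) powr p)"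
    using st(3) by (subst integral_add) (auto intro: integrable_on_mult_right i1')
  also have "integral {s..t} (\<lambda>r. norm (v r) powr p) \<le> integral {0..T} (\<lambda>r. norm (v r) powr p)"
    by (rule integral_subset_le) (use st i1 i1' in auto)
  also have "integral {0..T} (\<lambda>r. norm (v r) powr p) = (\<integral>r. norm (v r) powr p \<partial>lebesgue_on {0..T})"
    by (rule lebesgue_integral_eq_integral[OF vp, symmetric]) simp
  finally show ?thesis by (simp add: mult_left_mono)
qed

lemma Lp_space_primitives_convergent_subseq:
  fixes u :: "nat \<Rightarrow> real \<Rightarrow> real ^ 'k"
  assumes p: "1 < p" and T: "0 < T" and u: "\<And>n. u n \<in> Lp_space p T"
    and B: "\<And>n. (\<integral>r. norm (u n r) powr p \<partial>lebesgue_on {0..T}) \<le> B"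
  obtains U k where "strict_mono (k :: nat \<Rightarrow> nat)"
    "\<And>e. 0 < e \<Longrightarrow> \<exists>N. \<forall>n\<ge>N. \<forall>t\<in>{0..T}. norm (integral {0..t} (u (k n)) - U t) < e"
proof -
  have p1: "1 \<le> p" using p by simp
  define \<Phi> where "\<Phi> n t = integral {0..t} (u n)" for n t
  have ua: "u n absolutely_integrable_on {0..T}" for n by (rule Lp_space_integrable(2)[OF p1 u])
  have ui: "u n integrable_on {s..t}" "(\<lambda>r. norm (u n r)) integrable_on {s..t}" if "s \<in> {0..T}" "t \<in> {0..T}" for n s t
  proof -
    have "(\<lambda>r. norm (u n r)) integrable_on {0..T}"
      using set_lebesgue_integral_eq_integral(1)[OF absolutely_integrable_norm[OF ua[of n]]] by (simp add: o_def)
    then show "(\<lambda>r. norm (u n r)) integrable_on {s..t}"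
      by (rule integrable_on_subinterval) (use that in auto)
    show "u n integrable_on {s..t}"
      by (rule integrable_on_subinterval[OF set_lebesgue_integral_eq_integral(1)[OF ua]]) (use that in auto)
  qed
  have inc1: "norm (\<Phi> n t - \<Phi> n s) \<le> R * (t - s) + R powr (1 - p) * B"
    if R: "0 < R" and st: "s \<in> {0..T}" "t \<in> {0..T}" "s \<le> t" for n s t R
  proof -
    have zero: "0 \<in> {0..T}" using T by simp
    have "\<Phi> n s + integral {s..t} (u n) = \<Phi> n t"
      unfolding \<Phi>_def using st by (intro Henstock_Kurzweil_Integration.integral_combine ui zero) auto
    then have "\<Phi> n t - \<Phi> n s = integral {s..t} (u n)" by (metis add_diff_cancel_left')
    also have "norm (integral {s..t} (u n)) \<le> integral {s..t} (\<lambda>r. norm (u n r))"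
      by (rule integral_norm_bound_integral[OF ui(1)[OF st(1,2)] ui(2)[OF st(1,2)]]) simp
    also have "\<dots> \<le> R * (t - s) + R powr (1 - p) * (\<integral>r. norm (u n r) powr p \<partial>lebesgue_on {0..T})"
      by (rule Lp_space_integral_norm_le[OF p1 u R st])
    also have "\<dots> \<le> R * (t - s) + R powr (1 - p) * B"
      using B by (intro add_left_mono mult_left_mono) auto
    finally show ?thesis .
  qed
  have inc: "norm (\<Phi> n t - \<Phi> n s) \<le> R * \<bar>t - s\<bar> + R powr (1 - p) * B"
    if R: "0 < R" and st: "s \<in> {0..T}" "t \<in> {0..T}" for n s t R
  proof (cases "s \<le> t")
    case True
    then show ?thesis using inc1[OF R st] by simp
  next
    case False
    then show ?thesis using inc1[OF R st(2,1), of n] by (simp add: norm_minus_commute)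
  qed
  obtain g and k :: "nat \<Rightarrow> nat" where "continuous_on {0..T} g" and k: "strict_mono k"
    "\<And>e. 0 < e \<Longrightarrow> \<exists>N. \<forall>n t. n \<ge> N \<and> t \<in> {0..T} \<longrightarrow> norm (\<Phi> (k n) t - g t) < e"
  proof (rule Arzela_Ascoli[of "{0..T}" \<Phi> "T + B"])
    show "compact {0..T}" by simp
    show "norm (\<Phi> n t) \<le> T + B" if "t \<in> {0..T}" for n t
    proof -
      have "norm (\<Phi> n t - \<Phi> n 0) \<le> 1 * \<bar>t - 0\<bar> + 1 powr (1 - p) * B" by (rule inc) (use that in auto)
      then show ?thesis using that by (simp add: \<Phi>_def)
    qed
    fix t e :: real assume t: "t \<in> {0..T}" and e: "0 < e"
    have "((\<lambda>R. R powr (1 - p) * B) \<longlongrightarrow> 0 * B) at_top"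
      using p by (intro tendsto_mult_right tendsto_neg_powr filterlim_ident) auto
    then have "\<forall>\<^sub>F R in at_top. R powr (1 - p) * B < e / 2 \<and> R > 0"
      using e by (intro eventually_conj order_tendstoD(2)[of _ 0] eventually_gt_at_top) auto
    then obtain R where R: "R powr (1 - p) * B < e / 2" "R > 0"
      by (metis (mono_tags, lifting) eventually_at_top_linorder order_refl)
    show "\<exists>d>0. \<forall>n y. y \<in> {0..T} \<and> norm (t - y) < d \<longrightarrow> norm (\<Phi> n t - \<Phi> n y) < e"
    proof (intro exI[of _ "e / (2 * R)"] conjI allI impI)
      show "0 < e / (2 * R)" using e R by simp
      fix n y assume y: "y \<in> {0..T} \<and> norm (t - y) < e / (2 * R)"
      then have "norm (\<Phi> n t - \<Phi> n y) \<le> R * \<bar>t - y\<bar> + R powr (1 - p) * B" by (intro inc R t) auto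
      also have "R * \<bar>t - y\<bar> < e / 2" using y R by (simp add: field_simps)
      finally show "norm (\<Phi> n t - \<Phi> n y) < e" using R(1) by simp
    qed
  qed blast
  show thesis
  proof (rule that[OF k(1)])
    fix e :: real assume "0 < e"
    from k(2)[OF this] show "\<exists>N. \<forall>n\<ge>N. \<forall>t\<in>{0..T}. norm (integral {0..t} (u (k n)) - g t) < e"
      unfolding \<Phi>_def by blast
  qed
qed

lemma Greatest_image_compact:
  fixes g :: "'a::topological_space \<Rightarrow> real"
  assumes "compact S" "S \<noteq> {}" "continuous_on S g"
  obtains x where "x \<in> S" "(GREATEST m. m \<in> g ` S) = g x" "\<And>y. y \<in> S \<Longrightarrow> g y \<le> g x"
proof -
  obtain x where x: "x \<in> S" "\<And>y. y \<in> S \<Longrightarrow> g y \<le> g x"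
    using continuous_attains_sup[OF assms] by blast
  then have "(GREATEST m. m \<in> g ` S) = g x" by (intro Greatest_equality) auto
  with x that show thesis by blast
qed

section \<open>Existence of a minimiser\<close>

theorem proposition2p3:
  fixes p T L :: real
    and \<Theta> :: "(real ^ 'l) set"
    and F0 :: "real ^ 'd \<Rightarrow> real ^ 'l \<Rightarrow> real ^ 'd"
    and F :: "real ^ 'd \<Rightarrow> real ^ 'l \<Rightarrow> real ^ 'k ^ 'd"
    and x0 :: "real ^ 'l \<Rightarrow> real ^ 'd"
    and a :: "real ^ 'd \<Rightarrow> real ^ 'l \<Rightarrow> real"
    and f :: "real \<Rightarrow> real ^ 'k \<Rightarrow> real"
  assumes p: "1 < p" and T: "0 < T"
    and Theta: "\<Theta> \<noteq> {}" "compact \<Theta>"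
    and L: "0 < L"
    and lipschitz: "\<And>x1 x2 \<theta>1 \<theta>2. \<theta>1 \<in> \<Theta> \<Longrightarrow> \<theta>2 \<in> \<Theta> \<Longrightarrow>
      Max (insert (norm (F0 x1 \<theta>1 - F0 x2 \<theta>2))
             (range (\<lambda>i. norm (column i (F x1 \<theta>1) - column i (F x2 \<theta>2)))))
      \<le> L * (norm (x1 - x2) + norm (x1 + x2) * norm (\<theta>1 - \<theta>2))"
    and x0: "continuous_on \<Theta> x0"
    and a_cont: "continuous_on (UNIV \<times> \<Theta>) (\<lambda>(x, \<theta>). a x \<theta>)"
    and a_nonneg: "\<And>x \<theta>. \<theta> \<in> \<Theta> \<Longrightarrow> 0 \<le> a x \<theta>"
    and f_meas: "\<And>v. (\<lambda>t. f t v) \<in> borel_measurable (lebesgue_on {0..T})"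
    and f_convex: "AE t in lebesgue_on {0..T}. continuous_on UNIV (f t) \<and> convex_on UNIV (f t)"
    and f_coercive: "\<exists>c C. integrable (lebesgue_on {0..T}) c \<and> (\<forall>t\<in>{0..T}. 0 \<le> c t) \<and> 0 < C \<and>
      (AE t in lebesgue_on {0..T}. \<forall>v. C * norm v powr p - c t \<le> f t v)"
    and f_bound: "\<exists>u' c'. integrable (lebesgue_on {0..T}) c' \<and> (\<forall>t\<in>{0..T}. 0 \<le> c' t) \<and>
      (AE t in lebesgue_on {0..T}. \<bar>f t u'\<bar> \<le> c' t)"
  shows "\<exists>u\<in>Lp_space p T. cost F0 F x0 T \<Theta> a f u = (INF v\<in>Lp_space p T. cost F0 F x0 T \<Theta> a f v)"
proof -
  obtain c C where c: "integrable (lebesgue_on {0..T}) c" "\<And>t. t \<in> {0..T} \<Longrightarrow> 0 \<le> c t" and C: "0 < C"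
    and f_ge: "AE t in lebesgue_on {0..T}. \<forall>v. C * norm v powr p - c t \<le> f t v"
    using f_coercive by blast
  obtain u' c' where c': "integrable (lebesgue_on {0..T}) c'"
    and u': "AE t in lebesgue_on {0..T}. \<bar>f t u'\<bar> \<le> c' t"
    using f_bound by blast
  interpret control_system T L \<Theta> F0 F x0
    by unfold_locales (rule T L Theta(2) lipschitz x0; assumption)+
  interpret coercive_integrand p T C f c
    by unfold_locales (rule p C f_meas f_convex c(1) f_ge)+
  have p1: "1 \<le> p" using p by simp
  define I where "I = shifted_integral"
  define r where "r = (\<integral>t. c t \<partial>M)"
  define J where "J v = cost F0 F x0 T \<Theta> a f v" for v
  define mx where "mx v = (GREATEST m. m \<in> (\<lambda>\<theta>. a (X v \<theta> T) \<theta>) ` \<Theta>)" for v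
  have mx: "\<exists>\<theta>\<in>\<Theta>. mx v = a (X v \<theta> T) \<theta> \<and> (\<forall>\<theta>'\<in>\<Theta>. a (X v \<theta>' T) \<theta>' \<le> mx v)" if v: "v \<in> Lp_space p T" for v
  proof -
    have "continuous_on \<Theta> (\<lambda>\<theta>. (X v \<theta> T, \<theta>))"
      by (intro continuous_intros state_continuous_on_parameters Lp_space_integrable(2)[OF p1 v])
    then have "continuous_on \<Theta> (\<lambda>\<theta>. (\<lambda>(x, \<theta>). a x \<theta>) (X v \<theta> T, \<theta>))"
      by (rule continuous_on_compose2[OF a_cont]) auto
    then have "continuous_on \<Theta> (\<lambda>\<theta>. a (X v \<theta> T) \<theta>)" by simp
    from Greatest_image_compact[OF Theta(2,1) this]
    obtain \<theta> where "\<theta> \<in> \<Theta>" "mx v = a (X v \<theta> T) \<theta>" "\<And>\<theta>'. \<theta>' \<in> \<Theta> \<Longrightarrow> a (X v \<theta>' T) \<theta>' \<le> a (X v \<theta> T) \<theta>"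
      unfolding mx_def by blast
    then show ?thesis by (intro bexI[of _ \<theta>]) simp_all
  qed
  have mx0: "0 \<le> mx v" if v: "v \<in> Lp_space p T" for v
    using mx[OF v] a_nonneg by auto
  \<comment> \<open>On Lp the cost is a real terminal part, plus a nonnegative integral, minus a
    real constant; only the middle term can be infinite.\<close>
  have J: "J v = ereal (mx v) + (enn2ereal (I v) - ereal r)" if v: "v \<in> Lp_space p T" for v
  proof -
    have vm: "v \<in> borel_measurable M" using v by (simp add: Lp_space_def)
    have "ext_integral M (\<lambda>t. f t (v t)) = enn2ereal (I v) - ereal r"
      unfolding I_def shifted_integral_def r_def
    proof (rule ext_integral_eq_shifted[OF integrand_measurable[OF vm] c(1)])
      show "AE t in M. 0 \<le> c t" by (rule AE_I2) (use c(2) in simp)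
      show "AE t in M. - c t \<le> f t (v t)"
        using f_ge
      proof eventually_elim
        case (elim t)
        have "0 \<le> C * norm (v t) powr p" using C by simp
        then show ?case using elim[rule_format, of "v t"] by linarith
      qed
    qed
    then show ?thesis unfolding J_def cost_def mx_def by simp
  qed
  define \<mu>' where "\<mu>' = (INF v\<in>Lp_space p T. J v)"
  \<comment> \<open>The infimum is finite: the constant control \<open>u'\<close> has finite cost
    because \<open>f t u' + c t\<close> is at most \<open>c' t + c t\<close>, and no cost lies below
    \<open>- r\<close>.\<close>
  obtain \<mu> where \<mu>: "\<mu>' = ereal \<mu>"
  proof -
    let ?v = "\<lambda>_ :: real. u'"
    interpret finite_measure M by (rule finite_measure_lebesgue_on) simp
    have v: "?v \<in> Lp_space p T" by (simp add: Lp_space_def)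
    have "I ?v \<le> (\<integral>\<^sup>+t. ennreal (norm (c' t + c t)) \<partial>M)"
      unfolding I_def shifted_integral_def
      by (rule nn_integral_mono_AE, use u' in eventually_elim) (auto intro!: ennreal_leI)
    also have "\<dots> < \<infinity>"
      using Bochner_Integration.integrable_add[OF c' c(1)] by (simp add: integrable_iff_bounded)
    finally have "I ?v < \<infinity>" .
    then have "J ?v < \<infinity>" unfolding J[OF v] by (cases "I ?v") (auto simp: enn2ereal_ennreal)
    then have 1: "\<mu>' < \<infinity>" unfolding \<mu>'_def using v by (meson INF_lower le_less_trans)
    have "ereal (- r) \<le> \<mu>'"
      unfolding \<mu>'_def
    proof (rule INF_greatest)
      fix v :: "real \<Rightarrow> real ^ 'k" assume v: "v \<in> Lp_space p T"
      have "0 + (0 - ereal r) \<le> ereal (mx v) + (enn2ereal (I v) - ereal r)"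
        using mx0[OF v] by (intro add_mono ereal_minus_mono) auto
      then show "ereal (- r) \<le> J v" unfolding J[OF v] by simp
    qed
    with 1 show thesis using that by (cases \<mu>') auto
  qed
  have "\<exists>v i. v \<in> Lp_space p T \<and> 0 \<le> i \<and> I v = ennreal i \<and> mx v + i - r < \<mu> + inverse (real (Suc n))" for n
  proof -
    have "\<mu>' < ereal (\<mu> + inverse (real (Suc n)))" unfolding \<mu> by simp
    then obtain v where v: "v \<in> Lp_space p T" "J v < ereal (\<mu> + inverse (real (Suc n)))"
      unfolding \<mu>'_def INF_less_iff by blast
    then have "I v \<noteq> top" unfolding J[OF v(1)] by auto
    then obtain i where i: "I v = ennreal i" "0 \<le> i" by (cases "I v") auto
    then have "mx v + i - r < \<mu> + inverse (real (Suc n))"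
      using v(2) unfolding J[OF v(1)] by (simp add: enn2ereal_ennreal)
    then show ?thesis using v(1) i by blast
  qed
  then obtain un i where un: "\<And>n. un n \<in> Lp_space p T" and i: "\<And>n. 0 \<le> i n" "\<And>n. I (un n) = ennreal (i n)"
    and min: "\<And>n. mx (un n) + i n - r < \<mu> + inverse (real (Suc n))" by metis
  \<comment> \<open>A bound for all shifted integrals along the minimising sequence: the terminal
    part is nonnegative and the error 1/(n+1) is at most 1.\<close>
  define b where "b = \<mu> + 1 + r"
  have ib: "i n \<le> b" for n
  proof -
    have "inverse (real (Suc n)) \<le> 1" by (simp add: field_simps)
    then show ?thesis using min[of n] mx0[OF un[of n]] unfolding b_def by linarith
  qed
  have b0: "0 \<le> b" using i(1)[of 0] ib[of 0] by simp
  have Lpb: "(\<integral>t. norm (un n t) powr p \<partial>M) \<le> b / C" for n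
  proof (rule shifted_integral_coercive(2))
    show "un n \<in> borel_measurable M" using un by (simp add: Lp_space_def)
    show "shifted_integral (un n) \<le> ennreal b" using i(2)[of n] ib[of n] by (simp add: I_def ennreal_leI)
  qed (rule b0)
  obtain U k where k: "strict_mono (k :: nat \<Rightarrow> nat)"
    "\<And>e. 0 < e \<Longrightarrow> \<exists>N. \<forall>n\<ge>N. \<forall>t\<in>{0..T}. norm (integral {0..t} (un (k n)) - U t) < e"
    by (rule Lp_space_primitives_convergent_subseq[OF p T un Lpb], rule that)
  have ik: "\<forall>n. (i \<circ> k) n \<in> {0..b}" using i(1) ib by simp
  have sc: "seq_compact {0..b}" by (intro compact_imp_seq_compact compact_Icc)
  \<comment> \<open>Along a minimising sequence only the sum of the two costs is controlled. A
    further subsequence makes the integral parts converge, which splits the bound into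
    \<open>\<beta>\<close> for the integral part and \<open>\<mu> + r - \<beta>\<close> for the
    terminal part.\<close>
  obtain \<beta> k2 where \<beta>: "\<beta> \<in> {0..b}" and k2: "strict_mono (k2 :: nat \<Rightarrow> nat)" "(i \<circ> k \<circ> k2) \<longlonglongrightarrow> \<beta>"
  proof (rule seq_compactE[OF sc ik])
    fix l s assume "l \<in> {0..b}" "strict_mono (s :: nat \<Rightarrow> nat)" "(i \<circ> k \<circ> s) \<longlonglongrightarrow> l"
    then show thesis by (rule that)
  qed
  \<comment> \<open>The two subsequences are merged into one selection with the explicit rate
    1/(n+1), the form in which the shrinking sets are stated. The indices satisfy
    \<open>n \<le> j n\<close> and need not be increasing.\<close>
  have "\<exists>j\<ge>n. (\<forall>t\<in>{0..T}. norm (integral {0..t} (un j) - U t) \<le> inverse (real (Suc n))) \<and> \<bar>i j - \<beta>\<bar> \<le> inverse (real (Suc n))" for n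
  proof -
    have pos: "0 < inverse (real (Suc n))" by simp
    obtain N1 where N1: "\<And>m t. m \<ge> N1 \<Longrightarrow> t \<in> {0..T} \<Longrightarrow> norm (integral {0..t} (un (k m)) - U t) < inverse (real (Suc n))"
      using k(2)[OF pos] by blast
    obtain N2 where N2: "\<And>m. m \<ge> N2 \<Longrightarrow> norm (i (k (k2 m)) - \<beta>) < inverse (real (Suc n))"
      using LIMSEQ_D[OF k2(2) pos] by auto
    define m where "m = max n (max N1 N2)"
    have "m \<le> k2 m" "k2 m \<le> k (k2 m)" by (rule seq_suble[OF k2(1)], rule seq_suble[OF k(1)])
    then have "n \<le> k (k2 m)" "N1 \<le> k2 m" "N2 \<le> m" by (auto simp: m_def)
    then show ?thesis using N1[of "k2 m"] N2[of m] by (intro exI[of _ "k (k2 m)"]) (auto intro: less_imp_le)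
  qed
  then obtain j where j: "\<And>n. n \<le> j n"
    "\<And>n t. t \<in> {0..T} \<Longrightarrow> norm (integral {0..t} (un (j n)) - U t) \<le> inverse (real (Suc n))"
    "\<And>n. \<bar>i (j n) - \<beta>\<bar> \<le> inverse (real (Suc n))" by metis
  define z where "z n = un (j n)" for n
  have z: "z n \<in> Lp_space p T" for n by (simp add: z_def un)
  obtain u where u: "u \<in> Lp_space p T" "shifted_integral u \<le> ennreal \<beta>"
    "\<And>t. t \<in> {0..T} \<Longrightarrow> integral {0..t} u = U t"
  proof (rule weak_limit_exists[where U = U and \<beta> = \<beta>, OF z])
    show "0 \<le> \<beta>" using \<beta> by simp
    show "norm (integral {0..t} (z n) - U t) \<le> inverse (real (Suc n))" if "t \<in> {0..T}" for n t
      unfolding z_def by (rule j(2)[OF that])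
    show "shifted_integral (z n) \<le> ennreal (\<beta> + inverse (real (Suc n)))" for n
      using i(2)[of "j n"] j(3)[of n] unfolding I_def z_def by (auto intro!: ennreal_leI)
  qed (rule that)
  note ua = Lp_space_integrable(2)[OF p1 u(1)]
  obtain \<theta> where \<theta>: "\<theta> \<in> \<Theta>" "mx u = a (X u \<theta> T) \<theta>" using mx[OF u(1)] by blast
  have Xlim: "(\<lambda>n. X (z n) \<theta> T) \<longlonglongrightarrow> X u \<theta> T"
  proof (rule state_tendsto[OF ua Lp_space_integrable(2)[OF p1 z] \<theta>(1)])
    show "integral {0..T} (\<lambda>s. norm (z n s)) \<le> 1 * (T - 0) + 1 powr (1 - p) * (b / C)" for n
    proof -
      have "integral {0..T} (\<lambda>s. norm (z n s)) \<le> 1 * (T - 0) + 1 powr (1 - p) * (\<integral>t. norm (z n t) powr p \<partial>M)"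
        by (rule Lp_space_integral_norm_le[OF p1 z]) (use T in auto)
      also have "\<dots> \<le> 1 * (T - 0) + 1 powr (1 - p) * (b / C)"
        using Lpb[of "j n"] by (simp add: z_def)
      finally show ?thesis .
    qed
    show "norm (integral {0..t} (z n) - integral {0..t} u) \<le> inverse (real (Suc n))" if "t \<in> {0..T}" for n t
      using j(2)[OF that, of n] u(3)[OF that] by (simp add: z_def)
  qed (rule LIMSEQ_inverse_real_of_nat)
  have ac: "continuous_on UNIV (\<lambda>x. a x \<theta>)"
  proof -
    have "continuous_on UNIV (\<lambda>x. (\<lambda>(x, \<theta>). a x \<theta>) (x, \<theta>))"
      by (rule continuous_on_compose2[OF a_cont]) (use \<theta>(1) in \<open>auto intro!: continuous_intros\<close>)
    then show ?thesis by simp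
  qed
  have lim: "(\<lambda>n. a (X (z n) \<theta> T) \<theta>) \<longlonglongrightarrow> mx u"
    unfolding \<theta>(2) by (rule continuous_on_tendsto_compose[OF ac Xlim]) simp_all
  \<comment> \<open>One 1/(n+1) is the minimisation error at the index \<open>j n \<ge> n\<close>,
    the other the distance of \<open>i (j n)\<close> from \<open>\<beta>\<close>.\<close>
  have "a (X (z n) \<theta> T) \<theta> \<le> \<mu> + r - \<beta> + 2 * inverse (real (Suc n))" for n
  proof -
    have "a (X (z n) \<theta> T) \<theta> \<le> mx (un (j n))"
      using mx[OF z[of n]] \<theta>(1) by (auto simp: z_def)
    moreover have "inverse (real (Suc (j n))) \<le> inverse (real (Suc n))"
      using j(1)[of n] by (intro le_imp_inverse_le) auto
    ultimately show ?thesis using min[of "j n"] j(3)[of n] by linarith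
  qed
  moreover have "(\<lambda>n. \<mu> + r - \<beta> + 2 * inverse (real (Suc n))) \<longlonglongrightarrow> \<mu> + r - \<beta> + 2 * 0"
    by (intro tendsto_intros LIMSEQ_inverse_real_of_nat)
  ultimately have le: "mx u \<le> \<mu> + r - \<beta>"
    using LIMSEQ_le[OF lim, of "\<lambda>n. \<mu> + r - \<beta> + 2 * inverse (real (Suc n))"] by auto
  have "enn2ereal (I u) \<le> ereal \<beta>"
    using u(2) \<beta> by (simp add: I_def less_eq_ennreal.rep_eq enn2ereal_ennreal)
  then have "J u \<le> ereal (mx u) + (ereal \<beta> - ereal r)"
    unfolding J[OF u(1)] by (intro add_mono ereal_minus_mono) auto
  also have "\<dots> \<le> \<mu>'" unfolding \<mu> using le by simp
  finally have "J u \<le> \<mu>'" .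
  moreover have "\<mu>' \<le> J u" unfolding \<mu>'_def by (rule INF_lower[OF u(1)])
  ultimately show ?thesis using u(1) unfolding J_def \<mu>'_def by (intro bexI[of _ u] antisym)
qed

end
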